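(* Let $m\in(0,1)$, $\alpha\in(0,1]$ and $q\geq2$, and let $\mathbb I=(0,1)$. (i) If \[ s>\max\left\{\frac12-\frac m4-\frac{(1-m)\alpha}{q},\ \frac12-\frac{\alpha}{q}\right\}, \] then for every $\mu\in\mathcal M^\alpha$ there is a constant $C<\infty$ such that for all $f\in H^s(\mathbb R)$ \[ \|e^{it(-\Delta)^{m/2}}f\|_{L^q_x(\mathbb I,d\mu)L^\infty_t(\mathbb I)}\leq C\|f\|_{H^s(\mathbb R)} . \] (ii) This is sharp in the following sense: if \[ s<\max\left\{\frac12-\frac m4-\frac{(1-m)\alpha}{q},\ \frac12-\frac{\alpha}{q}\right\}, \] then there exists $\mu\in\mathcal M^\alpha$ for which the inequality in (i) fails, i.e. does not hold for all $f\in H^s(\mathbb R)$ with any finite constant $C$.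
   Context: $H^s(\mathbb R)$ is the inhomogeneous $L^2$-Sobolev space with norm $\|f\|_{H^s(\mathbb R)}=\|(1-\Delta)^{s/2}f\|_{L^2(\mathbb R)}$. With $\widehat f(\xi)=\int_{\mathbb R}e^{-ix\xi}f(x)\,dx$, one (formally) sets \[ e^{it(-\Delta)^{m/2}}f(x)=(2\pi)^{-1}\int_{\mathbb R}e^{i(x\xi+t|\xi|^m)}\widehat f(\xi)\,d\xi . \] For $f\in H^s(\mathbb R)$ the value at a given point $x$ and time $t$ is understood as $\lim_{N\to\infty}(2\pi)^{-1}\int_{\mathbb R}e^{i(x\xi+t|\xi|^m)}e^{-|\xi|^2/N^2}\widehat f(\xi)\,d\xi$ whenever this limit exists. $\mathcal M^\alpha$ is the collection of (positive Borel) $\alpha$-dimensional measures $\mu$ on $\mathbb R$ supported in the unit ball, where $\mu$ is $\alpha$-dimensional if $\sup_{x\in\mathbb R,\,r>0}\mu(B(x,r))/r^\alpha<\infty$, with $B(x,r)$ the ball of radius $r$ centered at $x$. The mixed norm is \[ \|F\|_{L^q_x(\mathbb I,d\mu)L^\infty_t(\mathbb I)}=\Big(\int_{\mathbb I}\sup_{t\in\mathbb I}|F(x,t)|^q\,d\mu(x)\Big)^{1/q}. \] *)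

theory Defs
  imports "HOL-Analysis.Analysis"
begin

section \<open>Schwartz functions and tempered distributions on the real line\<close>

definition vderiv :: "(real \<Rightarrow> complex) \<Rightarrow> real \<Rightarrow> complex" where
  "vderiv \<phi> = (\<lambda>x. vector_derivative \<phi> (at x))"

definition schwartz :: "(real \<Rightarrow> complex) set" where
  "schwartz = {\<phi>. (\<forall>k x. (vderiv ^^ k) \<phi> differentiable (at x)) \<and>
                   (\<forall>j k. bounded (range (\<lambda>x. x ^ j *\<^sub>R (vderiv ^^ k) \<phi> x)))}"

definition schwartz_seminorm :: "nat \<Rightarrow> nat \<Rightarrow> (real \<Rightarrow> complex) \<Rightarrow> real" where
  "schwartz_seminorm j k \<phi> = (SUP x. norm (x ^ j *\<^sub>R (vderiv ^^ k) \<phi> x))"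

text \<open>
  Distributions are HOL functions on all of \<open>real \<Rightarrow> complex\<close>; only their values on
  Schwartz functions carry meaning.  Continuity is continuity for the usual Frechet
  topology, i.e. domination by finitely many seminorms.
\<close>

type_synonym distr = "(real \<Rightarrow> complex) \<Rightarrow> complex"

definition tempered :: "distr \<Rightarrow> bool" where
  "tempered u \<longleftrightarrow>
     (\<forall>\<phi>\<in>schwartz. \<forall>\<psi>\<in>schwartz. u (\<lambda>x. \<phi> x + \<psi> x) = u \<phi> + u \<psi>) \<and>
     (\<forall>c. \<forall>\<phi>\<in>schwartz. u (\<lambda>x. c * \<phi> x) = c * u \<phi>) \<and>
     (\<exists>C n. \<forall>\<phi>\<in>schwartz. norm (u \<phi>) \<le> C * (\<Sum>j\<le>n. \<Sum>k\<le>n. schwartz_seminorm j k \<phi>))"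

definition represents :: "(real \<Rightarrow> complex) \<Rightarrow> distr \<Rightarrow> bool" where
  "represents g u \<longleftrightarrow> g \<in> borel_measurable borel \<and>
     (\<forall>\<phi>\<in>schwartz. integrable lborel (\<lambda>x. g x * \<phi> x) \<and>
                     u \<phi> = (\<integral>x. g x * \<phi> x \<partial>lborel))"

text \<open>A representing function is unique up to Lebesgue null sets, if there is one.\<close>

definition function_of :: "distr \<Rightarrow> real \<Rightarrow> complex" where
  "function_of u = (SOME g. represents g u)"

section \<open>Fourier transform and Sobolev spaces\<close>

definition fourier :: "(real \<Rightarrow> complex) \<Rightarrow> real \<Rightarrow> complex" where
  "fourier \<phi> \<xi> = (\<integral>x. exp (- (\<i> * of_real (x * \<xi>))) * \<phi> x \<partial>lborel)"

definition inv_fourier :: "(real \<Rightarrow> complex) \<Rightarrow> real \<Rightarrow> complex" where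
  "inv_fourier \<phi> x =
     of_real (1 / (2 * pi)) * (\<integral>\<xi>. exp (\<i> * of_real (x * \<xi>)) * \<phi> \<xi> \<partial>lborel)"

definition distr_fourier :: "distr \<Rightarrow> distr" where
  "distr_fourier u = (\<lambda>\<phi>. u (fourier \<phi>))"

definition distr_inv_fourier :: "distr \<Rightarrow> distr" where
  "distr_inv_fourier u = (\<lambda>\<phi>. u (inv_fourier \<phi>))"

definition distr_mult :: "(real \<Rightarrow> real) \<Rightarrow> distr \<Rightarrow> distr" where
  "distr_mult a u = (\<lambda>\<phi>. u (\<lambda>x. of_real (a x) * \<phi> x))"

text \<open>\<open>bessel s\<close> is the operator \<open>(1 - \<Delta>)\<close> to the power \<open>s/2\<close>, as a Fourier multiplier.\<close>

definition bessel :: "real \<Rightarrow> distr \<Rightarrow> distr" where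
  "bessel s f =
     distr_inv_fourier (distr_mult (\<lambda>\<xi>. (1 + \<xi>\<^sup>2) powr (s / 2)) (distr_fourier f))"

definition in_L2 :: "(real \<Rightarrow> complex) \<Rightarrow> bool" where
  "in_L2 h \<longleftrightarrow> h \<in> borel_measurable borel \<and> integrable lborel (\<lambda>x. (norm (h x))\<^sup>2)"

definition L2_norm_fun :: "(real \<Rightarrow> complex) \<Rightarrow> real" where
  "L2_norm_fun h = sqrt (\<integral>x. (norm (h x))\<^sup>2 \<partial>lborel)"

definition sobolev :: "real \<Rightarrow> distr set" where
  "sobolev s = {f. tempered f \<and> (\<exists>h. in_L2 h \<and> represents h (bessel s f))}"

definition sobolev_norm :: "real \<Rightarrow> distr \<Rightarrow> real" where
  "sobolev_norm s f = L2_norm_fun (function_of (bessel s f))"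

text \<open>
  For \<open>f\<close> in some \<open>sobolev s\<close> the distributional Fourier transform is a function
  (Plancherel); \<open>fhat f\<close> is a representative of it.
\<close>

definition fhat :: "distr \<Rightarrow> real \<Rightarrow> complex" where
  "fhat f = function_of (distr_fourier f)"

section \<open>The propagator\<close>

definition propagator_reg :: "real \<Rightarrow> distr \<Rightarrow> real \<Rightarrow> real \<Rightarrow> nat \<Rightarrow> complex" where
  "propagator_reg m f x t N =
     of_real (1 / (2 * pi)) *
     (\<integral>\<xi>. exp (\<i> * of_real (x * \<xi> + t * \<bar>\<xi>\<bar> powr m)) *
           of_real (exp (- (\<bar>\<xi>\<bar>\<^sup>2 / (real N)\<^sup>2))) * fhat f \<xi> \<partial>lborel)"

definition propagator_defined :: "real \<Rightarrow> distr \<Rightarrow> real \<Rightarrow> real \<Rightarrow> bool" where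
  "propagator_defined m f x t \<longleftrightarrow> convergent (propagator_reg m f x t)"

text \<open>
  Points without a value are given the value 0, so that they do not contribute to the
  supremum in the mixed norm.
\<close>

definition propagator :: "real \<Rightarrow> distr \<Rightarrow> real \<Rightarrow> real \<Rightarrow> complex" where
  "propagator m f x t =
     (if propagator_defined m f x t then lim (propagator_reg m f x t) else 0)"

section \<open>Fractal measures and the mixed norm\<close>

definition dimensional :: "real \<Rightarrow> real measure \<Rightarrow> bool" where
  "dimensional \<alpha> \<mu> \<longleftrightarrow>
     (SUP x. SUP r\<in>{0<..}. emeasure \<mu> (ball x r) / ennreal (r powr \<alpha>)) < top"

definition fractal_measures :: "real \<Rightarrow> real measure set" where
  "fractal_measures \<alpha> =
     {\<mu>. sets \<mu> = sets borel \<and> emeasure \<mu> (- cball 0 1) = 0 \<and> dimensional \<alpha> \<mu>}"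

definition ennpowr :: "ennreal \<Rightarrow> real \<Rightarrow> ennreal" where
  "ennpowr y a = (if y = top then top else ennreal (enn2real y powr a))"

abbreviation I01 :: "real set" where
  "I01 \<equiv> {0<..<1}"

text \<open>
  The supremum over \<open>t\<close> need not be Borel in \<open>x\<close>, but for the propagator it is universally
  measurable (a projection of Borel sets), so that the integral below, which is
  the supremum over Borel simple functions from below, is its integral with respect to the
  completion of \<open>\<mu>\<close>.
\<close>

definition mixed_norm :: "real \<Rightarrow> real measure \<Rightarrow> (real \<Rightarrow> real \<Rightarrow> complex) \<Rightarrow> ennreal" where
  "mixed_norm q \<mu> F =
     ennpowr (\<integral>\<^sup>+x\<in>I01. (SUP t\<in>I01. ennreal (norm (F x t) powr q)) \<partial>\<mu>) (1 / q)"

end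

theory Submission
  imports Defs "HOL-Probability.Characteristic_Functions" "HOL-Probability.Sinc_Integral" "HOL-Real_Asymp.Real_Asymp"
begin

text \<open>
  Sufficiency: cut the frequencies into dyadic annuli \<open>2\<^sup>k \<le> \<bar>\<xi>\<bar> < 2\<^sup>k\<^sup>+\<^sup>1\<close> and linearise the maximal
  function by letting \<open>t\<close> depend measurably on \<open>x\<close>. By \<open>T T\<^sup>*\<close> the \<open>L\<^sup>2 \<rightarrow> L\<^sup>q(\<mu>)\<close> norm is controlled by a
  Young-type inequality for the kernel \<open>\<integral> exp (\<i> (x \<xi> + t \<bar>\<xi>\<bar>\<^sup>m)) d\<xi>\<close> over the annulus, with \<open>x\<close>, \<open>t\<close>
  now differences. Van der Corput's lemma bounds it, uniformly in \<open>\<bar>t\<bar> \<le> 1\<close> and with \<open>L = 2\<^sup>k\<close>, by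
  \<open>C / \<bar>x\<bar>\<close> for \<open>\<bar>x\<bar> > 2 L powr (m - 1)\<close> and by \<open>C sqrt (L / \<bar>x\<bar>)\<close> for smaller \<open>x\<close> with \<open>\<bar>x\<bar> \<ge> 1 / L\<close>; the ball
  condition on \<open>\<mu>\<close> then gives the two exponents, coming from \<open>\<bar>x\<bar> = L powr (m - 1)\<close> and \<open>\<bar>x\<bar> = 1 / L\<close>,
  up to a factor \<open>k\<close> that the strict inequality for \<open>s\<close> absorbs.

  Necessity: take \<open>\<mu>\<close> comparable to \<open>x powr (\<alpha> - 1) dx\<close> on the unit interval, and let \<open>f\<close> have Fourier
  transform the indicator of an interval at distance \<open>L\<close> from the origin. With length \<open>L\<close> and
  \<open>x < 1 / (4 L)\<close> there is no oscillation for small \<open>t\<close>; with length \<open>L powr (1 - m/2)\<close> and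
  \<open>x < m L powr (m - 1)\<close> the time \<open>t\<close> can be chosen so that the phase is stationary at the end point \<open>-L\<close>.
\<close>

section \<open>Schwartz functions\<close>

text \<open>Distributions are arbitrary functionals here and representing functions are picked by
  choice, so \<open>fhat f\<close> is a function only after a proof: it is built from the L2
  function that represents \<open>bessel s f\<close>. Constants are immaterial, so one inequality of
  Plancherel serves both directions: it bounds \<open>fhat f\<close> by the Sobolev norm for
  sufficiency, and the Sobolev norm of explicit data for sharpness.

  The Young-type inequality integrates the kernel raised to the power q/2 in \<mu>, so that
  everything rests on a pointwise comparison with |x| powr (-\<alpha>); its weights 2/q and 1 - 2/q
  are a reason for q \<ge> 2.

  A bound on the maximal function alone would be hollow, since points without a limit count as 0.
  Existence of the limits is therefore proved along with the bound: the Gaussian cut-off is carried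
  through the kernel estimates as a decreasing amplitude, with constants uniform in it, and the
  strict inequality for s pays both for summing integrals over the annuli and for the uniform
  convergence of the pieces.\<close>

lemma schwartz_coinduct:
  assumes "\<phi> \<in> S"
    and diff: "\<And>\<psi> x. \<psi> \<in> S \<Longrightarrow> \<psi> differentiable (at x)"
    and deriv: "\<And>\<psi>. \<psi> \<in> S \<Longrightarrow> vderiv \<psi> \<in> S"
    and bd: "\<And>\<psi> j. \<psi> \<in> S \<Longrightarrow> bounded (range (\<lambda>x. x ^ j *\<^sub>R \<psi> x))"
  shows "\<phi> \<in> schwartz"
proof -
  \<comment> \<open>Iterating the closure under \<open>vderiv\<close> replaces formulas for higher
    derivatives: the bounds are only ever checked for undifferentiated members of
    \<open>S\<close>.\<close>
  have "(vderiv ^^ k) \<phi> \<in> S" for k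
    by (induction k) (auto simp: assms)
  thus ?thesis by (auto simp: schwartz_def diff bd)
qed

lemma schwartz_differentiable: "\<phi> \<in> schwartz \<Longrightarrow> \<phi> differentiable (at x)"
  by (auto simp: schwartz_def dest!: spec[of _ "0::nat"])

lemma schwartz_vderiv:
  assumes "\<phi> \<in> schwartz" shows "vderiv \<phi> \<in> schwartz"
proof -
  have *: "(vderiv ^^ k) (vderiv \<phi>) = (vderiv ^^ Suc k) \<phi>" for k
    by (simp add: funpow_Suc_right del: funpow.simps)
  show ?thesis
    using assms unfolding schwartz_def mem_Collect_eq * by blast
qed

lemma schwartz_bounded: "\<phi> \<in> schwartz \<Longrightarrow> bounded (range (\<lambda>x. x ^ j *\<^sub>R \<phi> x))"
  unfolding schwartz_def mem_Collect_eq by (metis funpow_0)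

lemma schwartz_bound:
  assumes "\<phi> \<in> schwartz"
  obtains B where "0 \<le> B" "\<And>x. \<bar>x\<bar> ^ j * norm (\<phi> x) \<le> B"
proof -
  obtain B where "\<And>x. norm (x ^ j *\<^sub>R \<phi> x) \<le> B"
    using schwartz_bounded[OF assms, of j] by (auto simp: bounded_iff)
  hence *: "\<bar>x\<bar> ^ j * norm (\<phi> x) \<le> B" for x by (simp add: power_abs)
  moreover have "0 \<le> B" using *[of 0] by (rule order_trans[rotated]) simp
  ultimately show ?thesis using that by blast
qed

lemma schwartz_has_vderiv:
  "\<phi> \<in> schwartz \<Longrightarrow> (\<phi> has_vector_derivative vderiv \<phi> x) (at x)"
  using schwartz_differentiable[of \<phi> x] by (simp add: vderiv_def vector_derivative_works)

lemma schwartz_continuous_on: "\<phi> \<in> schwartz \<Longrightarrow> continuous_on A \<phi>"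
  by (meson schwartz_differentiable continuous_at_imp_continuous_on differentiable_imp_continuous_within)

lemma schwartz_measurable: "\<phi> \<in> schwartz \<Longrightarrow> \<phi> \<in> borel_measurable borel"
  by (simp add: schwartz_continuous_on borel_measurable_continuous_onI)

lemma schwartz_decay:
  assumes "\<phi> \<in> schwartz"
  obtains B where "0 \<le> B" "\<And>x. norm (\<phi> x) \<le> B / (1 + x\<^sup>2) ^ n"
proof -
  \<comment> \<open>The spare power of |x| makes the induction work: one more factor
    \<open>1 + x\<^sup>2\<close> splits into the statements for \<open>j\<close> and
    \<open>j + 2\<close>.\<close>
  have "\<exists>B. 0 \<le> B \<and> (\<forall>x. (1 + x\<^sup>2) ^ n * (\<bar>x\<bar> ^ j * norm (\<phi> x)) \<le> B)" for j
  proof (induction n arbitrary: j)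
    case 0
    then show ?case using schwartz_bound[OF assms, of j] by simp metis
  next
    case (Suc n)
    obtain B1 where B1: "0 \<le> B1" "\<And>x. (1 + x\<^sup>2) ^ n * (\<bar>x\<bar> ^ j * norm (\<phi> x)) \<le> B1"
      using Suc[of j] by blast
    obtain B2 where B2: "0 \<le> B2" "\<And>x. (1 + x\<^sup>2) ^ n * (\<bar>x\<bar> ^ (j+2) * norm (\<phi> x)) \<le> B2"
      using Suc[of "j+2"] by blast
    have "(1 + x\<^sup>2) ^ Suc n * (\<bar>x\<bar> ^ j * norm (\<phi> x)) \<le> B1 + B2" for x
    proof -
      have "(1 + x\<^sup>2) ^ Suc n * (\<bar>x\<bar> ^ j * norm (\<phi> x)) =
        (1 + x\<^sup>2) ^ n * (\<bar>x\<bar> ^ j * norm (\<phi> x)) + (1 + x\<^sup>2) ^ n * (\<bar>x\<bar> ^ (j+2) * norm (\<phi> x))"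
        by (simp add: algebra_simps power_add power2_eq_square)
      thus ?thesis using B1(2)[of x] B2(2)[of x] by linarith
    qed
    thus ?case using B1(1) B2(1) by (intro exI[of _ "B1+B2"]) auto
  qed
  from this[of 0] obtain B where B: "0 \<le> B" "\<And>x. (1 + x\<^sup>2) ^ n * norm (\<phi> x) \<le> B" by auto
  have "norm (\<phi> x) \<le> B / (1 + x\<^sup>2) ^ n" for x
  proof -
    have "(1 + x\<^sup>2) ^ n > 0" by (simp add: add_pos_nonneg)
    thus ?thesis using B(2)[of x] by (simp add: field_simps)
  qed
  thus ?thesis using B(1) that by blast
qed

section \<open>Closure of the Schwartz class under Bessel symbols\<close>

lemma vderivI: "(\<And>x. (\<phi> has_vector_derivative \<phi>' x) (at x)) \<Longrightarrow> vderiv \<phi> = \<phi>'"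
  by (auto simp: vderiv_def vector_derivative_at)

text \<open>A class made for \<open>schwartz_coinduct\<close>: differentiating
  \<open>x ^ i * (1 + x\<^sup>2) powr b * \<phi> x\<close> gives three terms of the same shape, with
  \<open>i\<close> lowered, with \<open>i\<close> raised and \<open>b\<close> lowered, or with
  \<open>\<phi>\<close> replaced by its derivative. The factor \<open>x ^ i\<close> arises from the
  symbol and also yields multiplication by x.\<close>

inductive_set symbol_multiples :: "(real \<Rightarrow> complex) set" where
  base: "\<phi> \<in> schwartz \<Longrightarrow> (\<lambda>x. c * of_real (x ^ i * (1 + x\<^sup>2) powr b) * \<phi> x) \<in> symbol_multiples"
| add: "\<phi> \<in> symbol_multiples \<Longrightarrow> \<psi> \<in> symbol_multiples \<Longrightarrow> (\<lambda>x. \<phi> x + \<psi> x) \<in> symbol_multiples"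

lemma symbol_multiples_deriv:
  assumes "\<psi> \<in> symbol_multiples"
  shows "\<exists>\<psi>'\<in>symbol_multiples. \<forall>x. (\<psi> has_vector_derivative \<psi>' x) (at x)"
  using assms
proof induction
  case (base \<phi> c i b)
  let ?w = "\<lambda>i b (x::real). x ^ i * (1 + x\<^sup>2) powr b"
  let ?A = "\<lambda>x. (c * of_nat i) * of_real (?w (i - 1) b x) * \<phi> x"
  let ?B = "\<lambda>x. (c * of_real (2 * b)) * of_real (?w (i + 1) (b - 1) x) * \<phi> x"
  let ?C = "\<lambda>x. c * of_real (?w i b x) * vderiv \<phi> x"
  have mem: "(\<lambda>x. (?A x + ?B x) + ?C x) \<in> symbol_multiples"
    by (intro symbol_multiples.add symbol_multiples.base base schwartz_vderiv)
  have d: "((\<lambda>x. c * of_real (?w i b x) * \<phi> x) has_vector_derivative ((?A x + ?B x) + ?C x)) (at x)" for x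
  proof -
    have pos: "1 + x\<^sup>2 > 0" by (simp add: add_pos_nonneg)
    hence pow: "(1 + x\<^sup>2) powr b = (1 + x\<^sup>2) * (1 + x\<^sup>2) powr (b - 1)"
      by (simp add: powr_diff)
    have w: "(?w i b has_real_derivative (of_nat i * ?w (i - 1) b x + 2 * b * ?w (i+1) (b - 1) x)) (at x)"
      using pos by (auto intro!: derivative_eq_intros simp: field_simps powr_diff power2_eq_square)
    have "((\<lambda>x. complex_of_real (?w i b x)) has_vector_derivative
        of_real (of_nat i * ?w (i - 1) b x + 2 * b * ?w (i+1) (b - 1) x)) (at x)"
      using w by (intro has_vector_derivative_of_real) (simp add: has_real_derivative_iff_has_vector_derivative)
    from has_vector_derivative_mult[OF has_vector_derivative_mult[OF has_vector_derivative_const[of c] this]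
      schwartz_has_vderiv[OF base]]
    show ?thesis by (rule has_vector_derivative_eq_rhs) (simp add: algebra_simps)
  qed
  show ?case using mem d by (intro bexI[OF _ mem]) blast
next
  case (add \<phi> \<psi>)
  then obtain \<phi>' \<psi>' where "\<phi>' \<in> symbol_multiples" "\<psi>' \<in> symbol_multiples"
    "\<forall>x. (\<phi> has_vector_derivative \<phi>' x) (at x)" "\<forall>x. (\<psi> has_vector_derivative \<psi>' x) (at x)" by blast
  thus ?case by (intro bexI[of _ "\<lambda>x. \<phi>' x + \<psi>' x"] symbol_multiples.add) (auto intro!: derivative_intros)
qed

lemma symbol_multiples_bounded:
  assumes "\<psi> \<in> symbol_multiples"
  shows "bounded (range (\<lambda>x. x ^ j *\<^sub>R \<psi> x))"
  using assms
proof induction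
  case (base \<phi> c i b)
  \<comment> \<open>Enough powers of \<open>1 + x\<^sup>2\<close> to absorb
    \<open>\<bar>x\<bar> ^ (i + j)\<close> and the symbol, whatever the sign of
    \<open>b\<close>.\<close>
  define n where "n = nat \<lceil>\<bar>b\<bar>\<rceil> + i + j"
  obtain B where B: "0 \<le> B" "\<And>x. norm (\<phi> x) \<le> B / (1 + x\<^sup>2) ^ n"
    using schwartz_decay[OF base] by metis
  have "norm (x ^ j *\<^sub>R (c * of_real (x ^ i * (1 + x\<^sup>2) powr b) * \<phi> x)) \<le> norm c * B" for x
  proof -
    have p1: "1 + x\<^sup>2 \<ge> 1" by simp
    have "\<bar>x\<bar> \<le> 1 + x\<^sup>2"
    proof -
      have "0 \<le> (\<bar>x\<bar> - 1)\<^sup>2" by simp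
      thus ?thesis by (simp add: power2_eq_square algebra_simps)
    qed
    hence "\<bar>x\<bar> ^ (i + j) * (1 + x\<^sup>2) powr b \<le> (1 + x\<^sup>2) ^ (i + j) * (1 + x\<^sup>2) powr (nat \<lceil>\<bar>b\<bar>\<rceil>)"
      by (intro mult_mono power_mono powr_mono) (auto, linarith)
    also have "\<dots> = (1 + x\<^sup>2) ^ n"
      unfolding n_def using p1 by (subst powr_realpow) (auto simp: power_add mult_ac intro: less_le_trans[OF zero_less_one])
    finally have *: "\<bar>x\<bar> ^ (i + j) * (1 + x\<^sup>2) powr b \<le> (1 + x\<^sup>2) ^ n" .
    have "norm (x ^ j *\<^sub>R (c * of_real (x ^ i * (1 + x\<^sup>2) powr b) * \<phi> x)) =
       norm c * ((\<bar>x\<bar> ^ (i + j) * (1 + x\<^sup>2) powr b) * norm (\<phi> x))"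
      by (simp add: norm_mult norm_power power_add power_abs abs_mult)
    also have "\<dots> \<le> norm c * ((1 + x\<^sup>2) ^ n * (B / (1 + x\<^sup>2) ^ n))"
      using * B by (intro mult_left_mono mult_mono) auto
    also have "\<dots> = norm c * B"
      using p1 by (metis add_pos_nonneg less_numeral_extra(1) nonzero_mult_div_cancel_left
          order_less_irrefl power_eq_0_iff times_divide_eq_right zero_le_power2)
    finally show ?thesis .
  qed
  thus ?case by (auto simp: bounded_iff)
next
  case (add \<phi> \<psi>)
  from bounded_plus_comp[OF add.IH] show ?case by (simp add: scaleR_add_right)
qed

lemma symbol_multiples_schwartz: "symbol_multiples \<subseteq> schwartz"
proof
  fix \<phi> assume "\<phi> \<in> symbol_multiples"
  thus "\<phi> \<in> schwartz"
  proof (rule schwartz_coinduct)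
    fix \<psi> :: "real \<Rightarrow> complex" and x
    assume "\<psi> \<in> symbol_multiples"
    thus "\<psi> differentiable at x"
      using symbol_multiples_deriv by (meson differentiableI_vector)
  next
    fix \<psi> assume "\<psi> \<in> symbol_multiples"
    then obtain \<psi>' where "\<psi>' \<in> symbol_multiples" "\<forall>x. (\<psi> has_vector_derivative \<psi>' x) (at x)"
      using symbol_multiples_deriv by blast
    thus "vderiv \<psi> \<in> symbol_multiples" by (metis vderivI)
  next
    fix \<psi> :: "real \<Rightarrow> complex" and j assume "\<psi> \<in> symbol_multiples"
    thus "bounded (range (\<lambda>x. x ^ j *\<^sub>R \<psi> x))" by (rule symbol_multiples_bounded)
  qed
qed

lemma schwartz_mult_symbol:
  assumes "\<phi> \<in> schwartz"
  shows "(\<lambda>x. of_real ((1 + x\<^sup>2) powr b) * \<phi> x) \<in> schwartz"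
proof -
  have "(\<lambda>x. 1 * of_real (x ^ 0 * (1 + x\<^sup>2) powr b) * \<phi> x) \<in> schwartz"
    using symbol_multiples.base[OF assms] symbol_multiples_schwartz by blast
  thus ?thesis by simp
qed

lemma schwartz_cmult:
  assumes "\<phi> \<in> schwartz" shows "(\<lambda>x. c * \<phi> x) \<in> schwartz"
proof -
  have "(\<lambda>x. c * of_real (x ^ 0 * (1 + x\<^sup>2) powr 0) * \<phi> x) \<in> schwartz"
    using symbol_multiples.base[OF assms] symbol_multiples_schwartz by blast
  moreover have "(1 + x\<^sup>2 = 0) \<longleftrightarrow> False" for x :: real
    using sum_power2_eq_zero_iff[of 1 x] by simp
  ultimately show ?thesis by simp
qed

lemma schwartz_mult_id:
  assumes "\<phi> \<in> schwartz" shows "(\<lambda>x. of_real x * \<phi> x) \<in> schwartz"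
proof -
  have "(\<lambda>x. 1 * of_real (x ^ 1 * (1 + x\<^sup>2) powr 0) * \<phi> x) \<in> schwartz"
    using symbol_multiples.base[OF assms] symbol_multiples_schwartz by blast
  moreover have "(1 + x\<^sup>2 = 0) \<longleftrightarrow> False" for x :: real
    using sum_power2_eq_zero_iff[of 1 x] by simp
  ultimately show ?thesis by simp
qed

section \<open>Gaussian-type test functions\<close>

lemma poly_exp_bound: "\<exists>B\<ge>0. \<forall>x::real. \<bar>poly p x\<bar> \<le> B * exp \<bar>x\<bar>"
proof -
  have "\<exists>B\<ge>0. \<exists>d. \<forall>x::real. \<bar>poly p x\<bar> \<le> B * (1 + \<bar>x\<bar>) ^ d"
  proof (induction p)
    case 0
    then show ?case by (intro exI[of _ 0]) auto
  next
    case (pCons a p)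
    then obtain B d where B: "B \<ge> 0" "\<And>x::real. \<bar>poly p x\<bar> \<le> B * (1 + \<bar>x\<bar>) ^ d" by blast
    have "\<bar>poly (pCons a p) x\<bar> \<le> (\<bar>a\<bar> + B) * (1 + \<bar>x\<bar>) ^ Suc d" for x
    proof -
      have "\<bar>poly (pCons a p) x\<bar> \<le> \<bar>a\<bar> + \<bar>x\<bar> * (B * (1 + \<bar>x\<bar>) ^ d)"
        using B(2)[of x] by (auto simp: abs_mult intro!: order_trans[OF abs_triangle_ineq] add_left_mono mult_left_mono)
      also have "\<bar>x\<bar> * (B * (1 + \<bar>x\<bar>) ^ d) \<le> B * (1 + \<bar>x\<bar>) ^ Suc d"
        using B(1) by (simp add: algebra_simps)
      also have "\<bar>a\<bar> \<le> \<bar>a\<bar> * (1 + \<bar>x\<bar>) ^ Suc d"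
        using mult_left_mono[OF one_le_power[of "1 + \<bar>x\<bar>" "Suc d"], of "\<bar>a\<bar>"] by simp
      finally show ?thesis by (simp add: algebra_simps)
    qed
    thus ?case using B(1) by (intro exI[of _ "\<bar>a\<bar> + B"]) (auto intro!: exI[of _ "Suc d"])
  qed
  then obtain B d where B: "B \<ge> 0" "\<And>x::real. \<bar>poly p x\<bar> \<le> B * (1 + \<bar>x\<bar>) ^ d" by blast
  have "\<bar>poly p x\<bar> \<le> (B * fact d * exp 1) * exp \<bar>x\<bar>" for x
  proof -
    \<comment> \<open>A single term of the exponential series.\<close>
    have "(1 + \<bar>x\<bar>) ^ d / fact d \<le> exp (1 + \<bar>x\<bar>)"
      using sum_le_suminf[OF summable_exp_generic[of "1 + \<bar>x\<bar>"], of "{d}"]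
      by (auto simp: exp_def divide_inverse_commute)
    hence "(1 + \<bar>x\<bar>) ^ d \<le> fact d * exp 1 * exp \<bar>x\<bar>"
      by (simp add: field_simps exp_add)
    thus ?thesis using B(2)[of x] B(1) by (metis mult.assoc mult_left_mono order_trans)
  qed
  thus ?thesis using B(1) by (intro exI[of _ "B * fact d * exp 1"]) auto
qed

text \<open>The derivative of p exp(-Q) is (p' - p Q') exp(-Q), so for fixed Q these functions are
  closed under \<open>vderiv\<close>. Linear growth of Q suffices, because every polynomial is
  bounded by a multiple of exp |x|.\<close>

lemma poly_exp_schwartz:
  fixes Q p :: "real poly"
  assumes Q: "\<And>x. poly Q x \<ge> \<bar>x\<bar> - C"
  shows "(\<lambda>x. of_real (poly p x * exp (- poly Q x))) \<in> schwartz"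
proof (rule schwartz_coinduct[where S = "{\<lambda>x. of_real (poly p x * exp (- poly Q x)) | p. True}"])
  have d: "((\<lambda>x. of_real (poly p x * exp (- poly Q x)) :: complex) has_vector_derivative
     of_real (poly (pderiv p - p * pderiv Q) x * exp (- poly Q x))) (at x)" for p x
    by (intro has_vector_derivative_of_real)
       (auto intro!: derivative_eq_intros poly_DERIV simp: algebra_simps has_real_derivative_iff_has_vector_derivative[symmetric])
  fix \<psi> :: "real \<Rightarrow> complex" assume "\<psi> \<in> {\<lambda>x. of_real (poly p x * exp (- poly Q x)) | p. True}"
  then obtain p where p: "\<psi> = (\<lambda>x. of_real (poly p x * exp (- poly Q x)))" by auto
  show "\<psi> differentiable at x" for x using d[of p x] p by (auto intro: differentiableI_vector)
  show "vderiv \<psi> \<in> {\<lambda>x. of_real (poly p x * exp (- poly Q x)) | p. True}"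
    unfolding p vderivI[OF d] by blast
  show "bounded (range (\<lambda>x. x ^ j *\<^sub>R \<psi> x))" for j
  proof -
    obtain B where B: "B \<ge> 0" "\<And>x. \<bar>poly (monom 1 j * p) x\<bar> \<le> B * exp \<bar>x\<bar>" using poly_exp_bound by blast
    have "norm (x ^ j *\<^sub>R \<psi> x) \<le> B * exp C" for x
    proof -
      have "norm (x ^ j *\<^sub>R \<psi> x) = \<bar>poly (monom 1 j * p) x\<bar> * exp (- poly Q x)"
        by (simp add: p norm_mult poly_monom abs_mult norm_power power_abs)
      also have "\<dots> \<le> (B * exp \<bar>x\<bar>) * exp (C - \<bar>x\<bar>)"
        using Q[of x] B by (intro mult_mono) auto
      also have "\<dots> = B * exp C" by (simp add: exp_diff)
      finally show ?thesis .
    qed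
    thus ?thesis by (auto simp: bounded_iff)
  qed
qed auto

text \<open>Test functions that tend to the indicator function of an interval; \<open>represents\<close> determines
  the function almost everywhere because of them.\<close>

definition bump :: "real \<Rightarrow> real \<Rightarrow> nat \<Rightarrow> real \<Rightarrow> complex" where
  "bump c r n x = of_real (exp (- (((x - c) / r) ^ (2 * n + 2))))"

text \<open>The exponent 2 * n + 2 is even and positive, so that already n = 0 is a Gaussian; up to
  the factor \<open>exp 1\<close> this case is the common majorant of all the others.\<close>

lemma bump_schwartz:
  assumes "r > 0" shows "bump c r n \<in> schwartz"
proof -
  let ?Q = "[:- c / r, 1 / r:] ^ (2 * n + 2)"
  have pQ: "poly ?Q x = ((x - c) / r) ^ (2 * n + 2)" for x
    by (simp only: poly_power) (simp add: diff_divide_distrib)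
  have "poly ?Q x \<ge> \<bar>x\<bar> - (r\<^sup>2 + 1 + \<bar>c\<bar>)" for x
  proof -
    define y where "y = (x - c) / r"
    have y: "y ^ (2 * n + 2) \<ge> y\<^sup>2 - 1"
    proof (cases "\<bar>y\<bar> \<ge> 1")
      case True
      have "\<bar>y\<bar> ^ 2 \<le> \<bar>y\<bar> ^ (2 * n + 2)" using True by (intro power_increasing) auto
      thus ?thesis by (simp add: power_even_abs)
    next
      case False
      hence "y\<^sup>2 \<le> 1" by (simp add: abs_square_le_1)
      moreover have "y ^ (2 * n + 2) \<ge> 0" by (rule zero_le_even_power) simp
      ultimately show ?thesis by linarith
    qed
    have "2 * (r * \<bar>y\<bar>) \<le> r\<^sup>2 + y\<^sup>2"
      using sum_squares_bound[of r "\<bar>y\<bar>"] by simp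
    moreover have "r * \<bar>y\<bar> \<ge> 0" using assms by simp
    ultimately have "r * \<bar>y\<bar> \<le> r\<^sup>2 + y\<^sup>2" by linarith
    moreover have "\<bar>x\<bar> \<le> \<bar>c\<bar> + r * \<bar>y\<bar>" using assms by (simp add: y_def)
    ultimately show ?thesis using y unfolding pQ y_def by linarith
  qed
  from poly_exp_schwartz[OF this, of 1] show ?thesis
    unfolding bump_def[abs_def] pQ by simp
qed

lemma bump_tendsto:
  assumes "r > 0" "\<bar>x - c\<bar> \<noteq> r"
  shows "(\<lambda>n. bump c r n x) \<longlonglongrightarrow> indicator (ball c r) x"
proof -
  define y where "y = ((x - c) / r)\<^sup>2"
  have eq: "bump c r n x = of_real (exp (- (y * y ^ n)))" for n
    unfolding bump_def y_def power_mult[symmetric] power_add[symmetric] by (simp only: add.commute)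
  have y0: "y \<ge> 0" by (simp add: y_def)
  show ?thesis
  proof (cases "\<bar>x - c\<bar> < r")
    case True
    hence "\<bar>(x - c) / r\<bar> < 1" using assms by simp
    hence "y < 1" by (simp add: y_def abs_square_less_1)
    hence "(\<lambda>n. y ^ n) \<longlonglongrightarrow> 0" using y0 by (intro LIMSEQ_power_zero) auto
    hence "(\<lambda>n. of_real (exp (- (y * y ^ n))) :: complex) \<longlonglongrightarrow> of_real (exp (- (y * 0)))"
      by (intro tendsto_of_real tendsto_exp tendsto_minus tendsto_mult tendsto_const)
    thus ?thesis using True unfolding eq by (simp add: dist_real_def abs_minus_commute)
  next
    case False
    hence "\<bar>(x - c) / r\<bar> > 1" using assms by simp
    hence y1: "y > 1" unfolding y_def
      by (metis one_less_power power2_abs zero_less_numeral)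
    hence "filterlim (\<lambda>n. y ^ n) at_top sequentially"
      by (intro filterlim_at_infinity_imp_filterlim_at_top[OF filterlim_realpow_sequentially_gt1]) auto
    hence "filterlim (\<lambda>n. y * y ^ n) at_top sequentially"
      using y1 by (intro filterlim_tendsto_pos_mult_at_top[OF tendsto_const]) auto
    hence "(\<lambda>n. exp (- (y * y ^ n))) \<longlonglongrightarrow> 0"
      by (intro filterlim_compose[OF exp_at_bot]) (simp add: filterlim_uminus_at_top)
    hence "(\<lambda>n. of_real (exp (- (y * y ^ n))) :: complex) \<longlonglongrightarrow> of_real 0"
      by (intro tendsto_intros)
    thus ?thesis using False unfolding eq by (simp add: dist_real_def abs_minus_commute)
  qed
qed

lemma bump_dominated:
  "norm (bump c r n x) \<le> exp 1 * norm (bump c r 0 x)"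
proof -
  define y where "y = (x - c) / r"
  have "- (y ^ (2 * n + 2)) \<le> 1 - y\<^sup>2"
  proof (cases "\<bar>y\<bar> \<ge> 1")
    case True
    have "\<bar>y\<bar> ^ 2 \<le> \<bar>y\<bar> ^ (2 * n + 2)" using True by (intro power_increasing) auto
    thus ?thesis by (simp add: power_even_abs)
  next
    case False
    hence "y\<^sup>2 \<le> 1" by (simp add: abs_square_le_1)
    moreover have "y ^ (2 * n + 2) \<ge> 0" by (rule zero_le_even_power) simp
    ultimately show ?thesis by linarith
  qed
  hence "exp (- (y ^ (2 * n + 2))) \<le> exp 1 * exp (- (y\<^sup>2))"
    by (simp add: exp_add[symmetric])
  thus ?thesis by (simp add: bump_def y_def power2_eq_square)
qed

lemma indicator_ball_le_bump:
  assumes "r > 0"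
  shows "indicator (ball c r) x \<le> exp 1 * norm (bump c r 0 x)"
proof (cases "x \<in> ball c r")
  case True
  hence "\<bar>(x - c) / r\<bar> \<le> 1" using assms by (simp add: dist_real_def)
  hence "((x - c) / r)\<^sup>2 \<le> 1" by (simp only: abs_square_le_1)
  hence "exp 0 \<le> exp (1 - ((x - c) / r)\<^sup>2)" unfolding exp_le_cancel_iff by simp
  also have "exp (1 - ((x - c) / r)\<^sup>2) = exp 1 * norm (bump c r 0 x)"
    unfolding bump_def norm_of_real by (simp add: exp_add[symmetric] power2_eq_square)
  finally show ?thesis using True by simp
qed simp

section \<open>Uniqueness of representing functions\<close>

lemma zero_AE_of_greaterThan:
  fixes f :: "real \<Rightarrow> real"
  assumes f: "integrable lborel f" and 0: "\<And>x. (\<integral>y\<in>{x<..}. f y \<partial>lborel) = 0"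
  shows "AE x in lborel. f x = 0"
proof -
  have [measurable]: "f \<in> borel_measurable borel" using f by auto
  \<comment> \<open>\<open>ennreal\<close> cuts negative values off, so the densities of
    \<open>f\<close> and \<open>- f\<close> are the positive and the negative part of
    \<open>f\<close>; two finite measures that agree on all half-lines coincide.\<close>
  define \<nu> where "\<nu> = (\<lambda>f :: real \<Rightarrow> real. density lborel (\<lambda>x. ennreal (f x)))"
  have intp: "integrable lborel (\<lambda>y. max 0 (f y) * indicator {x<..} y)" for x
    by (intro integrable_real_mult_indicator integrable_max f) auto
  have intm: "integrable lborel (\<lambda>y. max 0 (- f y) * indicator {x<..} y)" for x
    by (intro integrable_real_mult_indicator integrable_max f integrable_minus) auto
  have em: "emeasure (\<nu> g) {x<..} = ennreal (\<integral>y. max 0 (g y) * indicator {x<..} y \<partial>lborel)"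
    if [measurable]: "g \<in> borel_measurable borel"
      and "integrable lborel (\<lambda>y. max 0 (g y) * indicator {x<..} y)" for g x
  proof -
    have "emeasure (\<nu> g) {x<..} = (\<integral>\<^sup>+y. ennreal (g y) * indicator {x<..} y \<partial>lborel)"
      unfolding \<nu>_def by (subst emeasure_density) auto
    also have "\<dots> = (\<integral>\<^sup>+y. ennreal (max 0 (g y) * indicator {x<..} y) \<partial>lborel)"
      by (intro nn_integral_cong) (auto split: split_indicator simp: max_def ennreal_neg)
    also have "\<dots> = ennreal (\<integral>y. max 0 (g y) * indicator {x<..} y \<partial>lborel)"
      using that(2) by (intro nn_integral_eq_integral) auto
    finally show ?thesis .
  qed
  have "\<nu> f = \<nu> (\<lambda>x. - f x)"
  proof (rule measure_eqI_lessThan)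
    show "sets (\<nu> f) = sets borel" "sets (\<nu> (\<lambda>x. - f x)) = sets borel" by (auto simp: \<nu>_def)
    show "emeasure (\<nu> f) {x<..} < \<infinity>" for x by (subst em) (auto simp: intp)
    show "emeasure (\<nu> f) {x<..} = emeasure (\<nu> (\<lambda>x. - f x)) {x<..}" for x
    proof -
      have "0 = (\<integral>y\<in>{x<..}. f y \<partial>lborel)" using 0 by simp
      also have "\<dots> = (\<integral>y. max 0 (f y) * indicator {x<..} y - max 0 (- f y) * indicator {x<..} y \<partial>lborel)"
        unfolding set_lebesgue_integral_def
        by (intro Bochner_Integration.integral_cong) (auto split: split_indicator)
      also have "\<dots> = (\<integral>y. max 0 (f y) * indicator {x<..} y \<partial>lborel) - (\<integral>y. max 0 (- f y) * indicator {x<..} y \<partial>lborel)"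
        by (intro Bochner_Integration.integral_diff intp intm)
      finally show ?thesis by (subst (1 2) em) (use intp intm in auto)
    qed
  qed
  hence "AE x in lborel. ennreal (f x) = ennreal (- f x)"
    unfolding \<nu>_def by (subst (asm) sigma_finite_measure.density_unique_iff[OF sigma_finite_lborel]) auto
  thus ?thesis
  proof eventually_elim
    case (elim x)
    thus ?case by (cases "f x" "0::real" rule: linorder_cases) (auto simp: ennreal_neg)
  qed
qed

text \<open>Local integrability forces a cut-off at integer radii before half-lines can be tested; a
  half-line meets such a ball in a ball or not at all.\<close>

lemma zero_AE_of_balls_real:
  fixes d :: "real \<Rightarrow> real"
  assumes int: "\<And>c r. r > 0 \<Longrightarrow> set_integrable lborel (ball c r) d"
    and 0: "\<And>c r. r > 0 \<Longrightarrow> (\<integral>x\<in>ball c r. d x \<partial>lborel) = 0"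
  shows "AE x in lborel. d x = 0"
proof -
  have "AE x in lborel. \<forall>N::nat. indicator (ball 0 (real N + 1)) x *\<^sub>R d x = 0"
    unfolding AE_all_countable
  proof
    fix N :: nat
    let ?R = "real N + 1"
    show "AE x in lborel. indicator (ball 0 ?R) x *\<^sub>R d x = 0"
    proof (rule zero_AE_of_greaterThan)
      show "integrable lborel (\<lambda>x. indicator (ball 0 ?R) x *\<^sub>R d x)"
        using int[of ?R 0] by (simp add: set_integrable_def)
      fix x
      have "(\<integral>y\<in>{x<..}. indicator (ball 0 ?R) y *\<^sub>R d y \<partial>lborel) =
            (\<integral>y. indicator ({x<..} \<inter> ball 0 ?R) y *\<^sub>R d y \<partial>lborel)"
        unfolding set_lebesgue_integral_def
        by (intro Bochner_Integration.integral_cong) (auto split: split_indicator)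
      also have "\<dots> = 0"
      proof (cases "x < ?R")
        case True
        define l where "l = max x (- ?R)"
        have "{x<..} \<inter> ball 0 ?R = ball ((?R + l) / 2) ((?R - l) / 2)"
          by (auto simp: l_def dist_real_def abs_less_iff field_simps max_def split: if_splits)
        moreover have "(?R - l) / 2 > 0" using True by (simp add: l_def)
        ultimately show ?thesis using 0 by (simp add: set_lebesgue_integral_def)
      next
        case False
        hence "{x<..} \<inter> ball 0 ?R = {}" by (auto simp: dist_real_def)
        thus ?thesis by simp
      qed
      finally show "(\<integral>y\<in>{x<..}. indicator (ball 0 ?R) y *\<^sub>R d y \<partial>lborel) = 0" .
    qed
  qed
  thus ?thesis
  proof eventually_elim
    case (elim x)
    obtain N where "\<bar>x\<bar> < real N" using reals_Archimedean2 by blast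
    thus ?case using elim[rule_format, of N] by (auto simp: dist_real_def)
  qed
qed

text \<open>Letting n tend to infinity in the pairing with \<open>bump c r n\<close> gives the
  integral over \<open>ball c r\<close>. Local integrability comes from the pairing too, since a
  multiple of \<open>bump c r 0\<close> dominates the indicator function.\<close>

lemma represents_unique_AE:
  assumes "represents g u" "represents g' u"
  shows "AE x in lborel. g x = g' x"
proof -
  define d where "d = (\<lambda>x. g x - g' x)"
  have [measurable]: "g \<in> borel_measurable borel" "g' \<in> borel_measurable borel"
    using assms by (auto simp: represents_def)
  hence [measurable]: "d \<in> borel_measurable borel" by (simp add: d_def)
  have int: "integrable lborel (\<lambda>x. d x * \<phi> x)" and 0: "(\<integral>x. d x * \<phi> x \<partial>lborel) = 0"
    if "\<phi> \<in> schwartz" for \<phi>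
  proof -
    have *: "integrable lborel (\<lambda>x. g x * \<phi> x)" "integrable lborel (\<lambda>x. g' x * \<phi> x)"
      "(\<integral>x. g x * \<phi> x \<partial>lborel) = (\<integral>x. g' x * \<phi> x \<partial>lborel)"
      using assms that by (auto simp: represents_def)
    show "integrable lborel (\<lambda>x. d x * \<phi> x)" "(\<integral>x. d x * \<phi> x \<partial>lborel) = 0"
      using * by (auto simp: d_def left_diff_distrib)
  qed
  have dint: "set_integrable lborel (ball c r) d" if "r > 0" for c r
    unfolding set_integrable_def
  proof (rule Bochner_Integration.integrable_bound)
    show "integrable lborel (\<lambda>x. exp 1 * norm (d x * bump c r 0 x))"
      using int[OF bump_schwartz[OF that]] by (intro integrable_mult_right integrable_norm) auto
    show "AE x in lborel. norm (indicat_real (ball c r) x *\<^sub>R d x) \<le> norm (exp 1 * norm (d x * bump c r 0 x))"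
    proof (rule AE_I2)
      fix x
      show "norm (indicat_real (ball c r) x *\<^sub>R d x) \<le> norm (exp 1 * norm (d x * bump c r 0 x))"
        using mult_right_mono[OF indicator_ball_le_bump[OF that, of c x], of "norm (d x)"]
        by (simp add: norm_mult mult_ac)
    qed
    show "(\<lambda>x. indicat_real (ball c r) x *\<^sub>R d x) \<in> borel_measurable lborel"
      using \<open>d \<in> borel_measurable borel\<close>
      by (intro borel_measurable_scaleR borel_measurable_indicator) auto
  qed
  have d0: "(\<integral>x\<in>ball c r. d x \<partial>lborel) = 0" if "r > 0" for c r
  proof -
    have "(\<lambda>n. \<integral>x. d x * bump c r n x \<partial>lborel) \<longlonglongrightarrow> (\<integral>x. d x * indicator (ball c r) x \<partial>lborel)"
    proof (rule integral_dominated_convergence)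
      show "integrable lborel (\<lambda>x. exp 1 * norm (d x * bump c r 0 x))"
        using int[OF bump_schwartz[OF that]] by (intro integrable_mult_right integrable_norm) auto
      show "AE x in lborel. norm (d x * bump c r n x) \<le> exp 1 * norm (d x * bump c r 0 x)" for n
        using mult_left_mono[OF bump_dominated[of c r n], of "norm (d _)"]
        by (intro AE_I2) (simp add: norm_mult mult_ac)
      have "AE x in lborel. x \<notin> {c - r, c + r}"
        by (intro AE_not_in finite_imp_null_set_lborel) auto
      thus "AE x in lborel. (\<lambda>n. d x * bump c r n x) \<longlonglongrightarrow> d x * indicator (ball c r) x"
      proof eventually_elim
        case (elim x)
        hence "\<bar>x - c\<bar> \<noteq> r" by (auto simp: abs_if split: if_splits)
        thus ?case by (intro tendsto_intros bump_tendsto that)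
      qed
      show "(\<lambda>x. d x * bump c r n x) \<in> borel_measurable lborel" for n
        using int[OF bump_schwartz[OF that], of c n] by auto
      show "(\<lambda>x. d x * indicator (ball c r) x) \<in> borel_measurable lborel"
        using \<open>d \<in> borel_measurable borel\<close>
        by (intro borel_measurable_times borel_measurable_indicator) auto
    qed
    moreover have "(\<integral>x. d x * bump c r n x \<partial>lborel) = 0" for n by (intro 0 bump_schwartz that)
    ultimately have "(\<integral>x. d x * indicator (ball c r) x \<partial>lborel) = 0"
      by (simp add: LIMSEQ_const_iff)
    also have "(\<integral>x. d x * indicator (ball c r) x \<partial>lborel) = (\<integral>x\<in>ball c r. d x \<partial>lborel)"
      unfolding set_lebesgue_integral_def
      by (intro Bochner_Integration.integral_cong) (auto split: split_indicator)
    finally show ?thesis .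
  qed
  have "AE x in lborel. Re (d x) = 0"
  proof (rule zero_AE_of_balls_real)
    fix c r :: real assume r: "r > 0"
    show "set_integrable lborel (ball c r) (\<lambda>x. Re (d x))"
      using integrable_Re[OF dint[OF r, of c, unfolded set_integrable_def]] by (simp add: set_integrable_def)
    show "(\<integral>x\<in>ball c r. Re (d x) \<partial>lborel) = 0"
      using integral_Re[OF dint[OF r, of c, unfolded set_integrable_def]] d0[OF r, of c]
      by (simp add: set_lebesgue_integral_def)
  qed
  moreover have "AE x in lborel. Im (d x) = 0"
  proof (rule zero_AE_of_balls_real)
    fix c r :: real assume r: "r > 0"
    show "set_integrable lborel (ball c r) (\<lambda>x. Im (d x))"
      using integrable_Im[OF dint[OF r, of c, unfolded set_integrable_def]] by (simp add: set_integrable_def)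
    show "(\<integral>x\<in>ball c r. Im (d x) \<partial>lborel) = 0"
      using integral_Im[OF dint[OF r, of c, unfolded set_integrable_def]] d0[OF r, of c]
      by (simp add: set_lebesgue_integral_def)
  qed
  ultimately show ?thesis by eventually_elim (auto simp: d_def complex_eq_iff)
qed

lemma function_of_AE:
  assumes "represents g u"
  shows "represents (function_of u) u" "AE x in lborel. function_of u x = g x"
proof -
  show "represents (function_of u) u"
    unfolding function_of_def using someI[of "\<lambda>g. represents g u", OF assms] .
  thus "AE x in lborel. function_of u x = g x" using assms by (rule represents_unique_AE)
qed

section \<open>The Fourier transform\<close>

lemma cis_borel_measurable [measurable]: "cis \<in> borel_measurable borel"
  by (intro borel_measurable_continuous_onI continuous_intros)

lemma fourier_cis: "fourier \<phi> \<xi> = (\<integral>x. cis (- (x * \<xi>)) * \<phi> x \<partial>lborel)"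
  by (simp add: fourier_def cis_conv_exp)

lemma inv_fourier_cis: "inv_fourier \<phi> x = of_real (1 / (2 * pi)) * (\<integral>\<xi>. cis (x * \<xi>) * \<phi> \<xi> \<partial>lborel)"
  by (simp add: inv_fourier_def cis_conv_exp)

lemma inv_fourier_eq: "inv_fourier \<phi> x = of_real (1 / (2 * pi)) * fourier \<phi> (- x)"
  by (simp add: inv_fourier_cis fourier_cis mult.commute)

lemma integrable_bounded_mult:
  fixes k \<phi> :: "'a \<Rightarrow> complex"
  assumes "integrable M \<phi>" "k \<in> borel_measurable M" "\<And>x. norm (k x) \<le> B"
  shows "integrable M (\<lambda>x. k x * \<phi> x)"
proof (rule Bochner_Integration.integrable_bound)
  show "integrable M (\<lambda>x. B * norm (\<phi> x))" using assms by auto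
  show "(\<lambda>x. k x * \<phi> x) \<in> borel_measurable M" using assms by auto
  show "AE x in M. norm (k x * \<phi> x) \<le> norm (B * norm (\<phi> x))"
    using assms(3) by (intro AE_I2) (auto simp: norm_mult abs_mult intro!: mult_right_mono intro: order_trans[OF _ abs_ge_self])
qed

lemma integrable_cis_mult:
  assumes "integrable M \<phi>" "k \<in> borel_measurable M"
  shows "integrable M (\<lambda>x. cis (k x) * \<phi> x)"
proof (rule integrable_bounded_mult[OF assms(1), of _ 1])
  show "(\<lambda>x. cis (k x)) \<in> borel_measurable M"
    using measurable_compose[OF assms(2) cis_borel_measurable] by simp
qed auto

text \<open>The exchanges of complex integrals below have this shape, for the Fourier kernel as well
  as for the T T* argument. The product f x * g y is integrable on the product space, and a bounded
  measurable factor does not change that.\<close>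

lemma Fubini_bounded_kernel:
  fixes f :: "'a \<Rightarrow> complex" and g :: "'b \<Rightarrow> complex" and k :: "'a \<Rightarrow> 'b \<Rightarrow> complex"
  assumes M: "sigma_finite_measure M1" "sigma_finite_measure M2"
    and f[measurable]: "integrable M1 f" and g[measurable]: "integrable M2 g"
    and k[measurable]: "(\<lambda>(x, y). k x y) \<in> borel_measurable (M1 \<Otimes>\<^sub>M M2)"
    and B: "\<And>x y. norm (k x y) \<le> B"
  shows "(\<integral>x. f x * (\<integral>y. k x y * g y \<partial>M2) \<partial>M1) = (\<integral>y. g y * (\<integral>x. k x y * f x \<partial>M1) \<partial>M2)"
proof -
  interpret M1: sigma_finite_measure M1 by fact
  interpret M2: sigma_finite_measure M2 by fact
  interpret P: pair_sigma_finite M1 M2 ..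
  have fg: "integrable (M1 \<Otimes>\<^sub>M M2) (\<lambda>(x, y). f x * g y)"
  proof (rule P.Fubini_integrable)
    show "integrable M1 (\<lambda>x. \<integral>y. norm (case (x, y) of (x, y) \<Rightarrow> f x * g y) \<partial>M2)"
      using f by (simp add: norm_mult)
    show "AE x in M1. integrable M2 (\<lambda>y. case (x, y) of (x, y) \<Rightarrow> f x * g y)"
      using g by (intro AE_I2) simp
  qed (use f g in measurable)
  have int: "integrable (M1 \<Otimes>\<^sub>M M2) (\<lambda>(x, y). k x y * (f x * g y))"
    using integrable_bounded_mult[OF fg k, of B] B by (simp add: case_prod_unfold)
  have "(\<integral>x. f x * (\<integral>y. k x y * g y \<partial>M2) \<partial>M1) = (\<integral>x. (\<integral>y. k x y * (f x * g y) \<partial>M2) \<partial>M1)"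
  proof (intro Bochner_Integration.integral_cong refl)
    fix x
    have "(\<integral>y. k x y * (f x * g y) \<partial>M2) = (\<integral>y. f x * (k x y * g y) \<partial>M2)" by (simp add: mult_ac)
    thus "f x * (\<integral>y. k x y * g y \<partial>M2) = (\<integral>y. k x y * (f x * g y) \<partial>M2)" by simp
  qed
  also have "\<dots> = (\<integral>y. (\<integral>x. k x y * (f x * g y) \<partial>M1) \<partial>M2)"
    using P.Fubini_integral[OF int] by simp
  also have "\<dots> = (\<integral>y. g y * (\<integral>x. k x y * f x \<partial>M1) \<partial>M2)"
  proof (intro Bochner_Integration.integral_cong refl)
    fix y
    have "(\<integral>x. k x y * (f x * g y) \<partial>M1) = (\<integral>x. g y * (k x y * f x) \<partial>M1)" by (simp add: mult_ac)
    thus "(\<integral>x. k x y * (f x * g y) \<partial>M1) = g y * (\<integral>x. k x y * f x \<partial>M1)" by simp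
  qed
  finally show "(\<integral>x. f x * (\<integral>y. k x y * g y \<partial>M2) \<partial>M1) = (\<integral>y. g y * (\<integral>x. k x y * f x \<partial>M1) \<partial>M2)" .
qed

lemma fourier_multiplication_formula:
  assumes "integrable lborel f" "integrable lborel g"
  shows "(\<integral>x. f x * fourier g x \<partial>lborel) = (\<integral>\<xi>. g \<xi> * fourier f \<xi> \<partial>lborel)"
proof -
  have "(\<integral>x. f x * (\<integral>y. cis (- (y * x)) * g y \<partial>lborel) \<partial>lborel) =
        (\<integral>y. g y * (\<integral>x. cis (- (y * x)) * f x \<partial>lborel) \<partial>lborel)"
    using assms by (intro Fubini_bounded_kernel[where B = 1] sigma_finite_lborel) auto
  thus ?thesis by (simp add: fourier_cis mult.commute)
qed

lemma norm_fourier_le: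
  "norm (fourier f \<xi>) \<le> (\<integral>x. norm (f x) \<partial>lborel)"
proof -
  have "norm (fourier f \<xi>) \<le> (\<integral>x. norm (cis (- (x * \<xi>)) * f x) \<partial>lborel)"
    unfolding fourier_cis by (rule integral_norm_bound)
  thus ?thesis by (simp add: norm_mult)
qed

lemma fourier_continuous:
  assumes "integrable lborel f"
  shows "continuous_on UNIV (fourier f)"
  unfolding continuous_on_sequentially
proof (intro allI ballI impI)
  fix X :: "nat \<Rightarrow> real" and a assume X: "(\<forall>n. X n \<in> UNIV) \<and> X \<longlonglongrightarrow> a"
  have "(\<lambda>n. \<integral>x. cis (- (x * X n)) * f x \<partial>lborel) \<longlonglongrightarrow> (\<integral>x. cis (- (x * a)) * f x \<partial>lborel)"
  proof (rule integral_dominated_convergence[where w = "\<lambda>x. norm (f x)"])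
    show "AE x in lborel. (\<lambda>n. cis (- (x * X n)) * f x) \<longlonglongrightarrow> cis (- (x * a)) * f x"
      using X by (intro AE_I2 tendsto_intros continuous_on_tendsto_compose[OF continuous_on_cis[OF continuous_on_id]]) auto
  qed (use assms in \<open>auto simp: norm_mult\<close>)
  thus "(fourier f \<circ> X) \<longlonglongrightarrow> fourier f a" by (simp add: fourier_cis[abs_def] o_def)
qed

lemma fourier_measurable [measurable]:
  assumes "integrable lborel f" shows "fourier f \<in> borel_measurable borel"
  using fourier_continuous[OF assms] by (rule borel_measurable_continuous_onI)

lemma inv_fourier_measurable [measurable]:
  assumes "integrable lborel f" shows "inv_fourier f \<in> borel_measurable borel"
  unfolding inv_fourier_eq[abs_def] using assms by measurable

lemma integrable_inverse_quadratic: "integrable lborel (\<lambda>x::real. inverse (1 + x\<^sup>2))"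
  using integrable_inverse_1_plus_square by (simp add: set_integrable_def einterval_def)

lemma schwartz_integrable_mult_L2:
  assumes g: "in_L2 g" and "\<phi> \<in> schwartz"
  shows "integrable lborel (\<lambda>x. g x * \<phi> x)"
proof -
  obtain B where B: "0 \<le> B" "\<And>x. norm (\<phi> x) \<le> B / (1 + x\<^sup>2) ^ 1"
    using schwartz_decay[OF assms(2)] by metis
  show ?thesis
  proof (rule Bochner_Integration.integrable_bound)
  have [measurable]: "g \<in> borel_measurable borel" using g by (simp add: in_L2_def)
  have [measurable]: "\<phi> \<in> borel_measurable borel" using assms(2) by (rule schwartz_measurable)
  show "integrable lborel (\<lambda>x. (norm (g x))\<^sup>2 + B\<^sup>2 * inverse (1 + x\<^sup>2))"
    using g integrable_inverse_quadratic by (auto simp: in_L2_def)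
  show "AE x in lborel. norm (g x * \<phi> x) \<le> norm ((norm (g x))\<^sup>2 + B\<^sup>2 * inverse (1 + x\<^sup>2))"
  proof (rule AE_I2)
    fix x :: real
    let ?a = "norm (g x)" and ?b = "norm (\<phi> x)"
    have p: "1 + x\<^sup>2 \<ge> 1" by simp
    have "?b\<^sup>2 \<le> (B / (1 + x\<^sup>2) ^ 1)\<^sup>2" using B by (intro power_mono) auto
    also have "\<dots> = B\<^sup>2 * (inverse (1 + x\<^sup>2) * inverse (1 + x\<^sup>2))"
      by (simp add: power2_eq_square divide_inverse)
    also have "\<dots> \<le> B\<^sup>2 * (inverse (1 + x\<^sup>2) * 1)"
      using p by (intro mult_left_mono) (auto simp: inverse_le_1_iff)
    finally have "?b\<^sup>2 \<le> B\<^sup>2 * inverse (1 + x\<^sup>2)" by simp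
    moreover have "2 * (?a * ?b) \<le> ?a\<^sup>2 + ?b\<^sup>2" using sum_squares_bound[of ?a ?b] by simp
    moreover have "?a * ?b \<ge> 0" by simp
    ultimately have "?a * ?b \<le> ?a\<^sup>2 + B\<^sup>2 * inverse (1 + x\<^sup>2)" by linarith
    thus "norm (g x * \<phi> x) \<le> norm (?a\<^sup>2 + B\<^sup>2 * inverse (1 + x\<^sup>2))"
      by (simp add: norm_mult)
  qed
  qed (use g schwartz_measurable[OF assms(2)] in \<open>auto simp: in_L2_def\<close>)
qed

lemma schwartz_integrable:
  assumes "\<phi> \<in> schwartz" shows "integrable lborel \<phi>"
proof -
  obtain B where B: "0 \<le> B" "\<And>x. norm (\<phi> x) \<le> B / (1 + x\<^sup>2) ^ 1"
    using schwartz_decay[OF assms] by metis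
  show ?thesis
  proof (rule Bochner_Integration.integrable_bound)
  show "integrable lborel (\<lambda>x. B * inverse (1 + x\<^sup>2))" using integrable_inverse_quadratic by auto
  show "AE x in lborel. norm (\<phi> x) \<le> norm (B * inverse (1 + x\<^sup>2))"
    using B by (auto simp: divide_inverse)
  qed (use schwartz_measurable[OF assms] in auto)
qed

section \<open>Derivatives and Fourier transforms\<close>

lemma has_vector_derivative_at_iff:
  "(f has_vector_derivative D) (at x) \<longleftrightarrow>
   ((\<lambda>y. (1 / \<bar>y - x\<bar>) *\<^sub>R (f y - f x - (y - x) *\<^sub>R D)) \<longlongrightarrow> 0) (at (x::real))"
  unfolding has_vector_derivative_def has_derivative_at2
  by (simp add: bounded_linear_scaleR_left algebra_simps divide_inverse)

lemma cis_has_vderiv: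
  "((\<lambda>\<xi>. cis (- (x * \<xi>))) has_vector_derivative (- \<i> * of_real x) * cis (- (x * \<xi>))) (at \<xi>)"
proof -
  have "((\<lambda>z. exp (- (\<i> * of_real x) * z)) has_field_derivative
      exp (- (\<i> * of_real x) * of_real \<xi>) * (- (\<i> * of_real x))) (at (of_real \<xi>))"
    by (auto intro!: derivative_eq_intros)
  from has_vector_derivative_real_field[OF this] show ?thesis
    by (simp add: cis_conv_exp mult_ac)
qed

lemma cis_diff_bound: "norm (cis a - cis b) \<le> \<bar>a - b\<bar>"
proof -
  have "cis a - cis b = cis b * (cis (a - b) - 1)"
    by (simp add: right_diff_distrib cis_mult)
  moreover have "norm (cis (a - b) - 1) \<le> \<bar>a - b\<bar>"
    using iexp_approx1[of "a - b" 0] by (simp add: cis_conv_exp)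
  ultimately show ?thesis by (simp add: norm_mult)
qed

text \<open>Differentiation under the integral sign. \<open>cis\<close> is 1-Lipschitz, so the
  remainder of the difference quotient is at most 2 |x| |f x|, and dominated convergence applies
  along sequences tending to \<xi>.\<close>

lemma fourier_has_vderiv:
  assumes f: "integrable lborel f" and xf: "integrable lborel (\<lambda>x. of_real x * f x)"
  shows "(fourier f has_vector_derivative fourier (\<lambda>x. - \<i> * (of_real x * f x)) \<xi>) (at \<xi>)"
  unfolding has_vector_derivative_at_iff tendsto_at_iff_sequentially
proof (intro allI impI)
  fix X :: "nat \<Rightarrow> real" assume X: "\<forall>n. X n \<in> UNIV - {\<xi>}" "X \<longlonglongrightarrow> \<xi>"
  have [measurable]: "f \<in> borel_measurable borel" using f by auto
  define Q where "Q = (\<lambda>x y. (1 / \<bar>y - \<xi>\<bar>) *\<^sub>R (cis (- (x * y)) - cis (- (x * \<xi>)) -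
     (y - \<xi>) *\<^sub>R ((- \<i> * of_real x) * cis (- (x * \<xi>)))) * f x)"
  have 1: "((\<lambda>y. (1 / \<bar>y - \<xi>\<bar>) *\<^sub>R (fourier f y - fourier f \<xi> - (y - \<xi>) *\<^sub>R fourier (\<lambda>x. - \<i> * (of_real x * f x)) \<xi>)) \<circ> X) n
      = (\<integral>x. Q x (X n) \<partial>lborel)" for n
  proof -
    have i: "integrable lborel (\<lambda>x. cis (- (x * y)) * f x)" for y
      by (intro integrable_cis_mult f) auto
    have i2: "integrable lborel (\<lambda>x. cis (- (x * \<xi>)) * (- \<i> * (of_real x * f x)))"
      using xf by (intro integrable_cis_mult integrable_mult_right) auto
    have "fourier f y - fourier f \<xi> - (y - \<xi>) *\<^sub>R fourier (\<lambda>x. - \<i> * (of_real x * f x)) \<xi> =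
      (\<integral>x. cis (- (x * y)) * f x - cis (- (x * \<xi>)) * f x - (y - \<xi>) *\<^sub>R (cis (- (x * \<xi>)) * (- \<i> * (of_real x * f x))) \<partial>lborel)" for y
      unfolding fourier_cis using i i2 by simp
    hence "(1 / \<bar>y - \<xi>\<bar>) *\<^sub>R (fourier f y - fourier f \<xi> - (y - \<xi>) *\<^sub>R fourier (\<lambda>x. - \<i> * (of_real x * f x)) \<xi>) =
      (\<integral>x. (1 / \<bar>y - \<xi>\<bar>) *\<^sub>R (cis (- (x * y)) * f x - cis (- (x * \<xi>)) * f x - (y - \<xi>) *\<^sub>R (cis (- (x * \<xi>)) * (- \<i> * (of_real x * f x)))) \<partial>lborel)" for y
      by simp
    thus ?thesis unfolding o_def Q_def
      by (simp add: algebra_simps)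
  qed
  have "(\<lambda>n. \<integral>x. Q x (X n) \<partial>lborel) \<longlonglongrightarrow> integral\<^sup>L lborel (\<lambda>x::real. 0)"
  proof (rule integral_dominated_convergence[where w = "\<lambda>x. 2 * norm (of_real x * f x)" and f = "\<lambda>_. 0" and s = "\<lambda>n x. Q x (X n)"])
    show "integrable lborel (\<lambda>x. 2 * norm (of_real x * f x))" using xf by auto
    show "(\<lambda>x. Q x (X n)) \<in> borel_measurable lborel" for n unfolding Q_def by measurable
    show "AE x in lborel. (\<lambda>n. Q x (X n)) \<longlonglongrightarrow> 0"
    proof (rule AE_I2)
      fix x
      have "((\<lambda>y. (1 / \<bar>y - \<xi>\<bar>) *\<^sub>R (cis (- (x * y)) - cis (- (x * \<xi>)) - (y - \<xi>) *\<^sub>R ((- \<i> * of_real x) * cis (- (x * \<xi>))))) \<longlongrightarrow> 0) (at \<xi>)"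
        using cis_has_vderiv[of x \<xi>] unfolding has_vector_derivative_at_iff .
      from this[unfolded tendsto_at_iff_sequentially, rule_format, OF X(1)[rule_format] X(2)]
      show "(\<lambda>n. Q x (X n)) \<longlonglongrightarrow> 0" unfolding Q_def o_def by (intro tendsto_mult_left_zero)
    qed
    show "AE x in lborel. norm (Q x (X n)) \<le> 2 * norm (of_real x * f x)" for n
    proof (rule AE_I2)
      fix x
      let ?y = "X n"
      have ne: "\<bar>?y - \<xi>\<bar> > 0" using X(1) by auto
      have "norm (cis (- (x * ?y)) - cis (- (x * \<xi>)) - (?y - \<xi>) *\<^sub>R ((- \<i> * of_real x) * cis (- (x * \<xi>))))
         \<le> norm (cis (- (x * ?y)) - cis (- (x * \<xi>))) + norm ((?y - \<xi>) *\<^sub>R ((- \<i> * of_real x) * cis (- (x * \<xi>))))"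
        by (rule norm_triangle_ineq4)
      also have "\<dots> \<le> \<bar>x * (?y - \<xi>)\<bar> + \<bar>?y - \<xi>\<bar> * \<bar>x\<bar>"
      proof (rule add_mono)
        have "- (x * ?y) - - (x * \<xi>) = - (x * (?y - \<xi>))" by (simp add: algebra_simps)
        thus "norm (cis (- (x * ?y)) - cis (- (x * \<xi>))) \<le> \<bar>x * (?y - \<xi>)\<bar>"
          using cis_diff_bound[of "- (x * ?y)" "- (x * \<xi>)"] by simp
      qed (simp add: norm_mult)
      also have "\<dots> = \<bar>?y - \<xi>\<bar> * (2 * \<bar>x\<bar>)" by (simp add: abs_mult)
      finally have "(1 / \<bar>?y - \<xi>\<bar>) * norm (cis (- (x * ?y)) - cis (- (x * \<xi>)) - (?y - \<xi>) *\<^sub>R ((- \<i> * of_real x) * cis (- (x * \<xi>)))) \<le> 2 * \<bar>x\<bar>"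
        using ne by (simp add: field_simps)
      from mult_right_mono[OF this, of "norm (f x)"]
      show "norm (Q x ?y) \<le> 2 * norm (of_real x * f x)"
        unfolding Q_def by (simp add: norm_mult)
    qed
  qed auto
  thus "((\<lambda>y. (1 / \<bar>y - \<xi>\<bar>) *\<^sub>R (fourier f y - fourier f \<xi> - (y - \<xi>) *\<^sub>R fourier (\<lambda>x. - \<i> * (of_real x * f x)) \<xi>)) \<circ> X) \<longlonglongrightarrow> 0"
    by (subst filterlim_cong[OF refl refl eventually_sequentiallyI[of 0]]) (use 1 in auto)
qed

lemma schwartz_tendsto_0:
  assumes "\<phi> \<in> schwartz"
  shows "(\<phi> \<longlongrightarrow> 0) at_top" "(\<phi> \<longlongrightarrow> 0) at_bot"
proof -
  obtain B where B: "0 \<le> B" "\<And>x. norm (\<phi> x) \<le> B / (1 + x\<^sup>2) ^ 1"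
    using schwartz_decay[OF assms] by metis
  have "((\<lambda>x::real. B / (1 + x\<^sup>2) ^ 1) \<longlongrightarrow> 0) at_top" by real_asymp
  thus "(\<phi> \<longlongrightarrow> 0) at_top" using B by (rule_tac tendsto_0_le[where K = 1 and f="\<lambda>x. B / (1 + x\<^sup>2) ^ 1"]) (auto)
  have "((\<lambda>x::real. B / (1 + x\<^sup>2) ^ 1) \<longlongrightarrow> 0) at_bot" by real_asymp
  thus "(\<phi> \<longlongrightarrow> 0) at_bot" using B by (rule_tac tendsto_0_le[where K = 1 and f="\<lambda>x. B / (1 + x\<^sup>2) ^ 1"]) (auto)
qed

text \<open>Integration by parts: \<open>f\<close> is the derivative of the decaying function
  \<open>F\<close>, so its integral over the line vanishes.\<close>

lemma fourier_vderiv_schwartz: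
  assumes "\<phi> \<in> schwartz"
  shows "fourier (vderiv \<phi>) \<xi> = \<i> * of_real \<xi> * fourier \<phi> \<xi>"
proof -
  define F where "F = (\<lambda>x. cis (- (\<xi> * x)) * \<phi> x)"
  define f where "f = (\<lambda>x. cis (- (\<xi> * x)) * vderiv \<phi> x + (- \<i> * of_real \<xi>) * cis (- (\<xi> * x)) * \<phi> x)"
  have d: "(F has_vector_derivative f x) (at x)" for x
    unfolding F_def f_def
    by (rule has_vector_derivative_mult[OF cis_has_vderiv schwartz_has_vderiv[OF assms]])
  have i1: "integrable lborel (\<lambda>x. cis (- (\<xi> * x)) * vderiv \<phi> x)"
    and i2: "integrable lborel (\<lambda>x. cis (- (\<xi> * x)) * \<phi> x)"
    by (intro integrable_cis_mult schwartz_integrable schwartz_vderiv assms; simp)+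
  have i3: "integrable lborel (\<lambda>x. (- \<i> * of_real \<xi>) * cis (- (\<xi> * x)) * \<phi> x)"
    using integrable_mult_right[OF i2, of "- \<i> * of_real \<xi>"] by (simp add: mult.assoc)
  have lim: "((\<lambda>x. F x) \<longlongrightarrow> 0) at_top" "((\<lambda>x. F x) \<longlongrightarrow> 0) at_bot"
    using schwartz_tendsto_0[OF assms]
    by (auto simp: F_def norm_mult tendsto_norm_zero intro!: tendsto_norm_zero_cancel[of "\<lambda>x. cis (- (\<xi> * x)) * \<phi> x"])
  have "(LBINT x=-\<infinity>..\<infinity>. f x) = 0 - 0"
  proof (rule interval_integral_FTC_integrable[where F = F])
    have "continuous_on UNIV f" unfolding f_def
      by (intro continuous_intros schwartz_continuous_on schwartz_vderiv assms)
    thus "isCont f x" for x by (simp add: continuous_on_eq_continuous_at)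
    show "set_integrable lborel (einterval (-\<infinity>) \<infinity>) f"
      using i1 i3 by (simp add: set_integrable_def einterval_def f_def)
    show "((F \<circ> real_of_ereal) \<longlongrightarrow> 0) (at_right (-\<infinity>))" "((F \<circ> real_of_ereal) \<longlongrightarrow> 0) (at_left \<infinity>)"
      using lim by (auto simp: ereal_tendsto_simps)
  qed (use d in auto)
  hence "(\<integral>x. f x \<partial>lborel) = 0"
    by (simp add: interval_lebesgue_integral_def set_lebesgue_integral_def einterval_def)
  moreover have "(\<integral>x. f x \<partial>lborel) = fourier (vderiv \<phi>) \<xi> + (- \<i> * of_real \<xi>) * fourier \<phi> \<xi>"
  proof -
    have "(\<integral>x. f x \<partial>lborel) = (\<integral>x. cis (- (\<xi> * x)) * vderiv \<phi> x \<partial>lborel) + (\<integral>x. (- \<i> * of_real \<xi>) * cis (- (\<xi> * x)) * \<phi> x \<partial>lborel)"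
      unfolding f_def by (intro Bochner_Integration.integral_add i1 i3)
    also have "(\<integral>x. (- \<i> * of_real \<xi>) * cis (- (\<xi> * x)) * \<phi> x \<partial>lborel) = (- \<i> * of_real \<xi>) * (\<integral>x. cis (- (\<xi> * x)) * \<phi> x \<partial>lborel)"
      unfolding mult.assoc by simp
    finally show ?thesis by (simp add: fourier_cis mult.commute)
  qed
  ultimately show ?thesis by (simp add: algebra_simps)
qed

text \<open>The image of the Schwartz class is closed under \<open>vderiv\<close>, which becomes
  multiplication by -i x before the transform. Decay follows from the dual rule: \<xi> ^ j times a
  transform is again the transform of a Schwartz function, hence bounded by an L1 norm.\<close>

lemma fourier_schwartz:
  assumes "\<phi> \<in> schwartz" shows "fourier \<phi> \<in> schwartz"
proof (rule schwartz_coinduct[where S = "fourier ` schwartz"])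
  fix \<psi> :: "real \<Rightarrow> complex" assume "\<psi> \<in> fourier ` schwartz"
  then obtain \<phi> where \<phi>: "\<phi> \<in> schwartz" "\<psi> = fourier \<phi>" by auto
  let ?D = "\<lambda>x. - \<i> * (of_real x * \<phi> x)"
  have D: "?D \<in> schwartz" by (intro schwartz_cmult schwartz_mult_id \<phi>)
  have d: "(fourier \<phi> has_vector_derivative fourier ?D x) (at x)" for x
    by (intro fourier_has_vderiv schwartz_integrable schwartz_mult_id \<phi>)
  show "\<psi> differentiable at x" for x
    unfolding \<phi> using d differentiableI_vector by blast
  show "vderiv \<psi> \<in> fourier ` schwartz"
    unfolding \<phi> vderivI[OF d] using D by blast
  show "bounded (range (\<lambda>x. x ^ j *\<^sub>R \<psi> x))" for j
  proof -
    have "\<exists>\<psi>\<in>schwartz. \<forall>\<xi>. \<xi> ^ j *\<^sub>R fourier \<phi> \<xi> = fourier \<psi> \<xi>"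
    proof (induction j)
      case 0 thus ?case using \<phi> by auto
    next
      case (Suc j)
      then obtain \<eta> where \<eta>: "\<eta> \<in> schwartz" "\<And>\<xi>. \<xi> ^ j *\<^sub>R fourier \<phi> \<xi> = fourier \<eta> \<xi>" by auto
      have "\<xi> ^ Suc j *\<^sub>R fourier \<phi> \<xi> = fourier (\<lambda>x. - \<i> * vderiv \<eta> x) \<xi>" for \<xi>
      proof -
        have "\<xi> ^ Suc j *\<^sub>R fourier \<phi> \<xi> = of_real \<xi> * fourier \<eta> \<xi>"
          unfolding \<eta>(2)[symmetric] by (simp add: scaleR_conv_of_real mult_ac)
        also have "\<dots> = - \<i> * fourier (vderiv \<eta>) \<xi>"
          by (simp add: fourier_vderiv_schwartz[OF \<eta>(1)] algebra_simps)
        also have "\<dots> = fourier (\<lambda>x. - \<i> * vderiv \<eta> x) \<xi>"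
          unfolding fourier_cis by (subst integral_mult_right_zero[symmetric]) (simp add: mult_ac)
        finally show ?thesis .
      qed
      thus ?case using schwartz_cmult[OF schwartz_vderiv[OF \<eta>(1)]] by blast
    qed
    then obtain \<eta> where "\<And>\<xi>. \<xi> ^ j *\<^sub>R fourier \<phi> \<xi> = fourier \<eta> \<xi>" by auto
    thus ?thesis unfolding \<phi> using norm_fourier_le[of \<eta>] by (auto simp: bounded_iff)
  qed
qed (use assms in auto)

lemma schwartz_reflect:
  assumes "\<phi> \<in> schwartz" shows "(\<lambda>x. \<phi> (- x)) \<in> schwartz"
proof (rule schwartz_coinduct[where S = "(\<lambda>\<phi> x. \<phi> (- x)) ` schwartz"])
  fix \<psi> :: "real \<Rightarrow> complex" assume "\<psi> \<in> (\<lambda>\<phi> x. \<phi> (- x)) ` schwartz"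
  then obtain \<phi> where \<phi>: "\<phi> \<in> schwartz" "\<psi> = (\<lambda>x. \<phi> (- x))" by auto
  have d: "((\<lambda>x. \<phi> (- x)) has_vector_derivative (- 1 * vderiv \<phi> (- x))) (at x)" for x
    using vector_diff_chain_at[OF _ schwartz_has_vderiv[OF \<phi>(1)], of uminus "-1" x]
    by (simp add: o_def has_vector_derivative_minus[OF has_vector_derivative_id])
  show "\<psi> differentiable at x" for x
    unfolding \<phi> using d differentiableI_vector by blast
  show "vderiv \<psi> \<in> (\<lambda>\<phi> x. \<phi> (- x)) ` schwartz"
    unfolding \<phi> vderivI[OF d]
    by (intro image_eqI[where x = "\<lambda>x. -1 * vderiv \<phi> x"] schwartz_cmult schwartz_vderiv \<phi>) auto
  show "bounded (range (\<lambda>x. x ^ j *\<^sub>R \<psi> x))" for j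
  proof -
    obtain B where "0 \<le> B" and B: "\<And>x. \<bar>x\<bar> ^ j * norm (\<phi> x) \<le> B" using schwartz_bound[OF \<phi>(1)] by metis
    show ?thesis unfolding \<phi> bounded_iff using B[of "- _"] by (auto simp: power_abs)
  qed
qed (use assms in auto)

lemma inv_fourier_schwartz:
  assumes "\<phi> \<in> schwartz" shows "inv_fourier \<phi> \<in> schwartz"
  unfolding inv_fourier_eq[abs_def]
  by (intro schwartz_cmult schwartz_reflect[of "fourier \<phi>"] fourier_schwartz assms)

text \<open>\<open>gau \<sigma>\<close> is the Fourier transform of \<open>gexp \<sigma>\<close>; it has total mass \<open>2 \<pi>\<close> and concentrates at \<open>0\<close>
  as \<open>\<sigma>\<close> tends to infinity.\<close>

definition gau :: "real \<Rightarrow> real \<Rightarrow> real" where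
  "gau \<sigma> y = 2 * pi * normal_density 0 (1 / \<sigma>) y"

lemma gau_nonneg [simp]: "0 \<le> gau \<sigma> y" by (simp add: gau_def)

lemma gau_minus: "gau \<sigma> (- y) = gau \<sigma> y" by (simp add: gau_def normal_density_def)

lemma gau_measurable [measurable]: "gau \<sigma> \<in> borel_measurable borel"
  unfolding gau_def[abs_def] by measurable

lemma integrable_gau: "\<sigma> > 0 \<Longrightarrow> integrable lborel (gau \<sigma>)"
  unfolding gau_def[abs_def] by (intro integrable_mult_right integrable_normal_density) auto

lemma integral_gau: "\<sigma> > 0 \<Longrightarrow> (\<integral>y. gau \<sigma> y \<partial>lborel) = 2 * pi"
  unfolding gau_def[abs_def] by (subst integral_mult_right_zero) (simp add: integral_normal_density)

lemma gau_scale: "\<sigma> > 0 \<Longrightarrow> gau \<sigma> (z / \<sigma>) / \<sigma> = gau 1 z"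
  by (simp add: gau_def normal_density_def real_sqrt_divide power_divide)

lemma nn_integral_gau:
  assumes "\<sigma> > 0" shows "(\<integral>\<^sup>+y. ennreal (gau \<sigma> (x - y)) \<partial>lborel) = ennreal (2 * pi)"
proof -
  have "(\<integral>\<^sup>+y. ennreal (gau \<sigma> y) \<partial>lborel) = ennreal \<bar>-1\<bar> * (\<integral>\<^sup>+y. ennreal (gau \<sigma> (x + (-1) * y)) \<partial>lborel)"
    by (intro nn_integral_real_affine) auto
  moreover have "(\<integral>\<^sup>+y. ennreal (gau \<sigma> y) \<partial>lborel) = ennreal (2 * pi)"
    using assms by (subst nn_integral_eq_integral) (auto simp: integrable_gau integral_gau)
  ultimately show ?thesis by simp
qed

definition gexp :: "real \<Rightarrow> real \<Rightarrow> real" where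
  "gexp \<sigma> \<xi> = exp (- (\<xi>\<^sup>2 / (2 * \<sigma>\<^sup>2)))"

lemma gexp_eq: "\<sigma> > 0 \<Longrightarrow> gexp \<sigma> \<xi> = sqrt (2 * pi) * \<sigma> * normal_density 0 \<sigma> \<xi>"
  by (simp add: gexp_def normal_density_def real_sqrt_mult)

lemma gexp_bounds: "0 < gexp \<sigma> \<xi>" "gexp \<sigma> \<xi> \<le> 1"
  by (auto simp: gexp_def)

lemma gexp_measurable [measurable]: "gexp \<sigma> \<in> borel_measurable borel"
  unfolding gexp_def[abs_def] by measurable

lemma integrable_gexp: "\<sigma> > 0 \<Longrightarrow> integrable lborel (gexp \<sigma>)"
  using gexp_eq[of \<sigma>] by (subst Bochner_Integration.integrable_cong[OF refl])
    (auto intro!: integrable_mult_right integrable_normal_density)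

text \<open>Rescaled by \<sigma>, this is the characteristic function of the standard normal
  distribution.\<close>

lemma gaussian_fourier:
  assumes "\<sigma> > 0"
  shows "(\<integral>\<xi>. cis (\<xi> * y) * of_real (gexp \<sigma> \<xi>) \<partial>lborel) = of_real (gau \<sigma> y)"
proof -
  have "(\<integral>\<xi>. cis (\<xi> * y) * of_real (gexp \<sigma> \<xi>) \<partial>lborel) =
     \<bar>\<sigma>\<bar> *\<^sub>R (\<integral>x. cis ((0 + \<sigma> * x) * y) * of_real (gexp \<sigma> (0 + \<sigma> * x)) \<partial>lborel)"
    using assms by (intro lborel_integral_real_affine) auto
  also have "(\<integral>x. cis ((0 + \<sigma> * x) * y) * of_real (gexp \<sigma> (0 + \<sigma> * x)) \<partial>lborel) =
      (\<integral>x. sqrt (2 * pi) *\<^sub>R (std_normal_density x *\<^sub>R iexp ((\<sigma> * y) * x)) \<partial>lborel)"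
    using assms
    by (intro Bochner_Integration.integral_cong)
      (auto simp: gexp_def std_normal_density_def cis_conv_exp scaleR_conv_of_real power_mult_distrib mult_ac)
  also have "\<dots> = sqrt (2 * pi) *\<^sub>R char std_normal_distribution (\<sigma> * y)"
    unfolding char_def by (subst integral_density) (auto simp del: scaleR_scaleR)
  also have "\<bar>\<sigma>\<bar> *\<^sub>R \<dots> = of_real (gau \<sigma> y)"
  proof -
    have "2 * pi = sqrt (2 * pi) * sqrt (2 * pi)" by simp
    hence "\<sigma> * sqrt (2 * pi) * exp (- ((\<sigma> * y)\<^sup>2) / 2) = gau \<sigma> y"
      using assms
      by (simp add: gau_def normal_density_def power_mult_distrib power_divide real_sqrt_divide real_sqrt_mult field_simps)
    thus ?thesis using assms unfolding char_std_normal_distribution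
      by (simp add: scaleR_conv_of_real flip: of_real_mult)
  qed
  finally show ?thesis .
qed

text \<open>Gaussian summation of the inversion integral: the weight makes the double integral
  converge absolutely, and exchanging the order leaves a convolution with an approximate identity of
  mass 2 \<pi>.\<close>

lemma fourier_gaussian_sum:
  assumes "\<sigma> > 0" and g: "integrable lborel g"
  shows "(\<integral>\<xi>. cis (y * \<xi>) * of_real (gexp \<sigma> \<xi>) * fourier g \<xi> \<partial>lborel) = (\<integral>x. g x * of_real (gau \<sigma> (y - x)) \<partial>lborel)"
proof -
  let ?f = "\<lambda>\<xi>. cis (y * \<xi>) * of_real (gexp \<sigma> \<xi>)"
  have f: "integrable lborel ?f"
    using assms by (intro integrable_cis_mult integrable_of_real integrable_gexp) auto
  have "(\<integral>\<xi>. ?f \<xi> * (\<integral>x. cis (- (x * \<xi>)) * g x \<partial>lborel) \<partial>lborel) =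
     (\<integral>x. g x * (\<integral>\<xi>. cis (- (x * \<xi>)) * ?f \<xi> \<partial>lborel) \<partial>lborel)"
    using f g by (intro Fubini_bounded_kernel[where B = 1] sigma_finite_lborel) auto
  also have "(\<lambda>x. \<integral>\<xi>. cis (- (x * \<xi>)) * ?f \<xi> \<partial>lborel) = (\<lambda>x. of_real (gau \<sigma> (y - x)))"
  proof
    fix x
    have e: "cis (- (x * \<xi>)) * ?f \<xi> = cis (\<xi> * (y - x)) * of_real (gexp \<sigma> \<xi>)" for \<xi>
      by (simp only: mult.assoc[symmetric] cis_mult) (simp add: algebra_simps)
    thus "(\<integral>\<xi>. cis (- (x * \<xi>)) * ?f \<xi> \<partial>lborel) = of_real (gau \<sigma> (y - x))"
      by (simp only: e gaussian_fourier[OF assms(1)])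
  qed
  finally show ?thesis by (simp add: fourier_cis)
qed

lemma gexp_tendsto: "(\<lambda>n. gexp (real n + 1) \<xi>) \<longlonglongrightarrow> 1"
proof -
  have "(\<lambda>n. exp (- (\<xi>\<^sup>2 / (2 * (real n + 1)\<^sup>2)))) \<longlonglongrightarrow> exp (- 0)"
    by (intro tendsto_exp tendsto_minus) real_asymp
  thus ?thesis by (simp add: gexp_def)
qed

lemma fourier_inversion_schwartz:
  assumes g: "g \<in> schwartz"
  shows "inv_fourier (fourier g) = g"
proof
  fix y
  have gi: "integrable lborel g" using g by (rule schwartz_integrable)
  have fi: "integrable lborel (fourier g)" using g by (intro schwartz_integrable fourier_schwartz)
  obtain B where B: "\<And>x. norm (g x) \<le> B" using schwartz_bound[OF g, of 0] by auto
  have [measurable]: "g \<in> borel_measurable borel" using gi by auto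
  have [measurable]: "fourier g \<in> borel_measurable borel" using fi by auto
  \<comment> \<open>The weighted inversion integrals have two limits: on the frequency side the
    weight tends to 1, on the other side the convolution kernel concentrates.\<close>
  let ?L = "\<lambda>n. \<integral>\<xi>. cis (y * \<xi>) * of_real (gexp (real n + 1) \<xi>) * fourier g \<xi> \<partial>lborel"
  have "?L \<longlonglongrightarrow> (\<integral>\<xi>. cis (y * \<xi>) * of_real 1 * fourier g \<xi> \<partial>lborel)"
  proof (rule integral_dominated_convergence[where w = "\<lambda>\<xi>. norm (fourier g \<xi>)"])
    show "AE \<xi> in lborel. (\<lambda>n. cis (y * \<xi>) * of_real (gexp (real n + 1) \<xi>) * fourier g \<xi>) \<longlonglongrightarrow> cis (y * \<xi>) * of_real 1 * fourier g \<xi>"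
      by (intro AE_I2 tendsto_intros gexp_tendsto)
    show "AE \<xi> in lborel. norm (cis (y * \<xi>) * of_real (gexp (real n + 1) \<xi>) * fourier g \<xi>) \<le> norm (fourier g \<xi>)" for n
    proof (rule AE_I2)
      fix \<xi>
      show "norm (cis (y * \<xi>) * of_real (gexp (real n + 1) \<xi>) * fourier g \<xi>) \<le> norm (fourier g \<xi>)"
        using mult_right_mono[OF gexp_bounds(2)[of "real n + 1" \<xi>], of "norm (fourier g \<xi>)"]
          gexp_bounds(1)[of "real n + 1" \<xi>]
        by (simp add: norm_mult)
    qed
  qed (use fi in auto)
  note L1 = this
  have L2: "?L \<longlonglongrightarrow> (\<integral>z. g y * of_real (gau 1 z) \<partial>lborel)"
  proof -
    have "?L n = (\<integral>z. g (y - z / (real n + 1)) * of_real (gau 1 z) \<partial>lborel)" for n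
    proof -
      let ?s = "real n + 1"
      have "?L n = (\<integral>x. g x * of_real (gau ?s (y - x)) \<partial>lborel)"
        by (intro fourier_gaussian_sum gi) auto
      \<comment> \<open>The substitution x = y - z / (n + 1) moves the parameter from the Gaussian
        into the argument of g, so that a multiple of \<open>gau 1\<close> dominates.\<close>
      also have "\<dots> = \<bar>- (1 / ?s)\<bar> *\<^sub>R (\<integral>z. g (y + (- (1 / ?s)) * z) * of_real (gau ?s (y - (y + (- (1 / ?s)) * z))) \<partial>lborel)"
        by (intro lborel_integral_real_affine) auto
      also have "\<dots> = (\<integral>z. \<bar>- (1 / ?s)\<bar> *\<^sub>R (g (y + (- (1 / ?s)) * z) * of_real (gau ?s (y - (y + (- (1 / ?s)) * z)))) \<partial>lborel)"
        by simp
      also have "\<dots> = (\<integral>z. g (y - z / ?s) * of_real (gau 1 z) \<partial>lborel)"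
        by (intro Bochner_Integration.integral_cong)
           (auto simp: gau_scale[of ?s, symmetric] scaleR_conv_of_real mult_ac)
      finally show ?thesis .
    qed
    moreover have "(\<lambda>n. \<integral>z. g (y - z / (real n + 1)) * of_real (gau 1 z) \<partial>lborel) \<longlonglongrightarrow> (\<integral>z. g y * of_real (gau 1 z) \<partial>lborel)"
    proof (rule integral_dominated_convergence[where w = "\<lambda>z. B * gau 1 z"])
      show "AE z in lborel. (\<lambda>n. g (y - z / (real n + 1)) * of_real (gau 1 z)) \<longlonglongrightarrow> g y * of_real (gau 1 z)"
      proof (intro AE_I2 tendsto_intros)
        fix z
        have "(\<lambda>n. y - z / (real n + 1)) \<longlonglongrightarrow> y" by real_asymp
        thus "(\<lambda>n. g (y - z / (real n + 1))) \<longlonglongrightarrow> g y"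
          by (intro continuous_on_tendsto_compose[OF schwartz_continuous_on[OF g, of UNIV]]) auto
      qed
      show "AE z in lborel. norm (g (y - z / (real n + 1)) * of_real (gau 1 z)) \<le> B * gau 1 z" for n
        using B by (intro AE_I2) (auto simp: norm_mult intro!: mult_right_mono)
    qed (use integrable_gau[of 1] in auto)
    ultimately show ?thesis by simp
  qed
  have "(\<integral>z. g y * of_real (gau 1 z) \<partial>lborel) = g y * of_real (2 * pi)"
    using integral_gau[of 1] by simp
  hence "(\<integral>\<xi>. cis (y * \<xi>) * fourier g \<xi> \<partial>lborel) = g y * of_real (2 * pi)"
    using LIMSEQ_unique[OF L1 L2] by simp
  thus "inv_fourier (fourier g) y = g y" by (simp add: inv_fourier_cis)
qed

section \<open>Plancherel's inequality\<close>

lemma norm_double_convolution_le: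
  fixes g :: "real \<Rightarrow> complex"
  assumes "\<sigma> > 0" and [measurable]: "g \<in> borel_measurable borel"
  shows "ennreal (norm (\<integral>x. cnj (g x) * (\<integral>y. g y * of_real (gau \<sigma> (x - y)) \<partial>lborel) \<partial>lborel))
    \<le> ennreal (2 * pi) * (\<integral>\<^sup>+x. ennreal ((norm (g x))\<^sup>2) \<partial>lborel)"
proof -
  have bound: "ennreal (norm (integral\<^sup>L lborel F)) \<le> (\<integral>\<^sup>+x. ennreal (norm (F x)) \<partial>lborel)" for F :: "real \<Rightarrow> complex"
    by (cases "integrable lborel F") (auto simp: integral_norm_bound_ennreal not_integrable_integral_eq)
  have "ennreal (norm (\<integral>x. cnj (g x) * (\<integral>y. g y * of_real (gau \<sigma> (x - y)) \<partial>lborel) \<partial>lborel))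
     \<le> (\<integral>\<^sup>+x. ennreal (norm (g x)) * ennreal (norm (\<integral>y. g y * of_real (gau \<sigma> (x - y)) \<partial>lborel)) \<partial>lborel)"
    by (rule order_trans[OF bound]) (simp add: norm_mult ennreal_mult)
  also have "\<dots> \<le> (\<integral>\<^sup>+x. ennreal (norm (g x)) * (\<integral>\<^sup>+y. ennreal (norm (g y) * gau \<sigma> (x - y)) \<partial>lborel) \<partial>lborel)"
    by (intro nn_integral_mono mult_left_mono order_trans[OF bound]) (auto simp: norm_mult)
  also have "\<dots> = (\<integral>\<^sup>+x. (\<integral>\<^sup>+y. ennreal (norm (g x) * norm (g y) * gau \<sigma> (x - y)) \<partial>lborel) \<partial>lborel)"
    by (subst nn_integral_cmult[symmetric]) (auto simp: ennreal_mult[symmetric] mult.assoc)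
  \<comment> \<open>Schur's test: AM-GM separates x from y, the kernel is even, and each of the two
    terms contributes half of its mass 2 \<pi>.\<close>
  also have "\<dots> \<le> (\<integral>\<^sup>+x. (\<integral>\<^sup>+y. ennreal ((norm (g x))\<^sup>2 / 2) * ennreal (gau \<sigma> (x - y)) + ennreal ((norm (g y))\<^sup>2 / 2) * ennreal (gau \<sigma> (y - x)) \<partial>lborel) \<partial>lborel)"
  proof (intro nn_integral_mono)
    fix x y
    have "norm (g x) * norm (g y) \<le> (norm (g x))\<^sup>2 / 2 + (norm (g y))\<^sup>2 / 2"
      using sum_squares_bound[of "norm (g x)" "norm (g y)"] by simp
    hence "norm (g x) * norm (g y) * gau \<sigma> (x - y) \<le> ((norm (g x))\<^sup>2 / 2 + (norm (g y))\<^sup>2 / 2) * gau \<sigma> (x - y)"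
      by (intro mult_right_mono) auto
    also have "\<dots> = (norm (g x))\<^sup>2 / 2 * gau \<sigma> (x - y) + (norm (g y))\<^sup>2 / 2 * gau \<sigma> (y - x)"
      using gau_minus[of \<sigma> "x - y"] by (simp add: distrib_right)
    finally show "ennreal (norm (g x) * norm (g y) * gau \<sigma> (x - y)) \<le> ennreal ((norm (g x))\<^sup>2 / 2) * ennreal (gau \<sigma> (x - y)) + ennreal ((norm (g y))\<^sup>2 / 2) * ennreal (gau \<sigma> (y - x))"
      by (subst (1 2) ennreal_mult[symmetric]) (auto simp: ennreal_plus[symmetric] simp del: ennreal_plus intro!: ennreal_leI)
  qed
  also have "\<dots> = (\<integral>\<^sup>+x. (\<integral>\<^sup>+y. ennreal ((norm (g x))\<^sup>2 / 2) * ennreal (gau \<sigma> (x - y)) \<partial>lborel) \<partial>lborel)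
      + (\<integral>\<^sup>+x. (\<integral>\<^sup>+y. ennreal ((norm (g y))\<^sup>2 / 2) * ennreal (gau \<sigma> (y - x)) \<partial>lborel) \<partial>lborel)"
    by (subst nn_integral_add[symmetric]) (auto simp: nn_integral_add intro!: nn_integral_cong)
  also have "(\<integral>\<^sup>+x. (\<integral>\<^sup>+y. ennreal ((norm (g y))\<^sup>2 / 2) * ennreal (gau \<sigma> (y - x)) \<partial>lborel) \<partial>lborel)
     = (\<integral>\<^sup>+x. (\<integral>\<^sup>+y. ennreal ((norm (g x))\<^sup>2 / 2) * ennreal (gau \<sigma> (x - y)) \<partial>lborel) \<partial>lborel)"
    by (rule lborel_pair.Fubini') measurable
  also have "(\<integral>\<^sup>+x. (\<integral>\<^sup>+y. ennreal ((norm (g x))\<^sup>2 / 2) * ennreal (gau \<sigma> (x - y)) \<partial>lborel) \<partial>lborel)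
     = (\<integral>\<^sup>+x. ennreal (2 * pi / 2) * ennreal ((norm (g x))\<^sup>2) \<partial>lborel)"
    by (subst nn_integral_cmult)
       (auto simp: nn_integral_gau[OF assms(1)] ennreal_mult[symmetric] mult_ac intro!: nn_integral_cong)
  also have "\<dots> = ennreal (2 * pi / 2) * (\<integral>\<^sup>+x. ennreal ((norm (g x))\<^sup>2) \<partial>lborel)"
    by (subst nn_integral_cmult) auto
  also have "\<dots> + \<dots> = ennreal (2 * pi) * (\<integral>\<^sup>+x. ennreal ((norm (g x))\<^sup>2) \<partial>lborel)"
    by (simp add: distrib_right[symmetric] ennreal_plus[symmetric] del: ennreal_plus)
  finally show ?thesis .
qed

text \<open>Only this half of Plancherel's theorem is needed. Inserting the weight \<open>gexp \<sigma>\<close> turns the left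
  side into a convolution with \<open>gau \<sigma>\<close>, to which Schur's test applies.\<close>

lemma Plancherel_le:
  assumes g: "integrable lborel g"
  shows "(\<integral>\<^sup>+\<xi>. ennreal ((norm (fourier g \<xi>))\<^sup>2) \<partial>lborel) \<le> ennreal (2 * pi) * (\<integral>\<^sup>+x. ennreal ((norm (g x))\<^sup>2) \<partial>lborel)"
proof -
  have [measurable]: "g \<in> borel_measurable borel" using g by auto
  note [measurable] = fourier_measurable[OF g]
  define B where "B = (\<integral>x. norm (g x) \<partial>lborel)"
  have B: "norm (fourier g \<xi>) \<le> B" for \<xi> unfolding B_def by (rule norm_fourier_le)
  have main: "(\<integral>\<^sup>+\<xi>. ennreal (gexp \<sigma> \<xi> * (norm (fourier g \<xi>))\<^sup>2) \<partial>lborel) \<le> ennreal (2 * pi) * (\<integral>\<^sup>+x. ennreal ((norm (g x))\<^sup>2) \<partial>lborel)"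
    if \<sigma>: "\<sigma> > 0" for \<sigma>
  proof -
    have ei: "integrable lborel (\<lambda>\<xi>. of_real (gexp \<sigma> \<xi>) :: complex)"
      using integrable_gexp[OF \<sigma>] by simp
    have i1: "integrable lborel (\<lambda>\<xi>. fourier g \<xi> * of_real (gexp \<sigma> \<xi>))"
      using B by (intro integrable_bounded_mult[OF ei]) auto
    have i2: "integrable lborel (\<lambda>\<xi>. gexp \<sigma> \<xi> * (norm (fourier g \<xi>))\<^sup>2)"
    proof (rule Bochner_Integration.integrable_bound)
      show "integrable lborel (\<lambda>\<xi>. B\<^sup>2 * gexp \<sigma> \<xi>)" using integrable_gexp[OF \<sigma>] by auto
      show "AE \<xi> in lborel. norm (gexp \<sigma> \<xi> * (norm (fourier g \<xi>))\<^sup>2) \<le> norm (B\<^sup>2 * gexp \<sigma> \<xi>)"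
        using B gexp_bounds(1)[of \<sigma>]
        by (intro AE_I2) (auto simp: abs_mult power_mono less_imp_le mult.commute intro!: mult_right_mono)
    qed auto
    have c: "cnj (fourier g \<xi>) = (\<integral>x. cis (x * \<xi>) * cnj (g x) \<partial>lborel)" for \<xi>
      using Bochner_Integration.integral_cnj[of lborel "\<lambda>x. cis (- (x * \<xi>)) * g x"] by (simp add: fourier_cis cis_cnj)
    have "of_real (\<integral>\<xi>. gexp \<sigma> \<xi> * (norm (fourier g \<xi>))\<^sup>2 \<partial>lborel) =
       (\<integral>\<xi>. (fourier g \<xi> * of_real (gexp \<sigma> \<xi>)) * cnj (fourier g \<xi>) \<partial>lborel)"
      unfolding integral_complex_of_real[symmetric] of_real_mult complex_norm_square
      by (simp only: mult_ac)
    also have "\<dots> = (\<integral>x. cnj (g x) * (\<integral>\<xi>. cis (x * \<xi>) * (fourier g \<xi> * of_real (gexp \<sigma> \<xi>)) \<partial>lborel) \<partial>lborel)"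
      unfolding c using g i1
      by (intro Fubini_bounded_kernel[where B = 1] sigma_finite_lborel) auto
    also have "\<dots> = (\<integral>x. cnj (g x) * (\<integral>y. g y * of_real (gau \<sigma> (x - y)) \<partial>lborel) \<partial>lborel)"
      using fourier_gaussian_sum[OF \<sigma> g] by (simp add: mult_ac)
    finally have eq: "of_real (\<integral>\<xi>. gexp \<sigma> \<xi> * (norm (fourier g \<xi>))\<^sup>2 \<partial>lborel) = \<dots>" .
    have "(\<integral>\<^sup>+\<xi>. ennreal (gexp \<sigma> \<xi> * (norm (fourier g \<xi>))\<^sup>2) \<partial>lborel) = ennreal (\<integral>\<xi>. gexp \<sigma> \<xi> * (norm (fourier g \<xi>))\<^sup>2 \<partial>lborel)"
      using i2 gexp_bounds(1)[of \<sigma>] by (intro nn_integral_eq_integral) (auto simp: less_imp_le)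
    also have "\<dots> \<le> ennreal (norm (complex_of_real (\<integral>\<xi>. gexp \<sigma> \<xi> * (norm (fourier g \<xi>))\<^sup>2 \<partial>lborel)))"
      by (intro ennreal_leI) simp
    also have "\<dots> \<le> ennreal (2 * pi) * (\<integral>\<^sup>+x. ennreal ((norm (g x))\<^sup>2) \<partial>lborel)"
      unfolding eq using \<sigma> by (intro norm_double_convolution_le) auto
    finally show ?thesis .
  qed
  \<comment> \<open>Fatou's lemma removes the weight.\<close>
  have "(\<integral>\<^sup>+\<xi>. ennreal ((norm (fourier g \<xi>))\<^sup>2) \<partial>lborel) =
     (\<integral>\<^sup>+\<xi>. liminf (\<lambda>n. ennreal (gexp (real n + 1) \<xi> * (norm (fourier g \<xi>))\<^sup>2)) \<partial>lborel)"
  proof (intro nn_integral_cong)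
    fix \<xi>
    have "(\<lambda>n. ennreal (gexp (real n + 1) \<xi> * (norm (fourier g \<xi>))\<^sup>2)) \<longlonglongrightarrow> ennreal (1 * (norm (fourier g \<xi>))\<^sup>2)"
      by (intro tendsto_ennrealI tendsto_intros gexp_tendsto)
    thus "ennreal ((norm (fourier g \<xi>))\<^sup>2) = liminf (\<lambda>n. ennreal (gexp (real n + 1) \<xi> * (norm (fourier g \<xi>))\<^sup>2))"
      by (simp add: lim_imp_Liminf)
  qed
  also have "\<dots> \<le> liminf (\<lambda>n. \<integral>\<^sup>+\<xi>. ennreal (gexp (real n + 1) \<xi> * (norm (fourier g \<xi>))\<^sup>2) \<partial>lborel)"
    by (intro nn_integral_liminf) auto
  also have "\<dots> \<le> limsup (\<lambda>n. \<integral>\<^sup>+\<xi>. ennreal (gexp (real n + 1) \<xi> * (norm (fourier g \<xi>))\<^sup>2) \<partial>lborel)"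
    by (intro Liminf_le_Limsup) auto
  also have "\<dots> \<le> ennreal (2 * pi) * (\<integral>\<^sup>+x. ennreal ((norm (g x))\<^sup>2) \<partial>lborel)"
    by (intro Limsup_bounded always_eventually allI main) auto
  finally show ?thesis .
qed

section \<open>The Fourier transform on L2\<close>

lemma in_L2_nn: "in_L2 g \<longleftrightarrow> g \<in> borel_measurable borel \<and> (\<integral>\<^sup>+x. ennreal ((norm (g x))\<^sup>2) \<partial>lborel) < \<infinity>"
  unfolding in_L2_def by (auto simp: integrable_iff_bounded)

lemma in_L2_nn_eq: "in_L2 g \<Longrightarrow> (\<integral>\<^sup>+x. ennreal ((norm (g x))\<^sup>2) \<partial>lborel) = ennreal (\<integral>x. (norm (g x))\<^sup>2 \<partial>lborel)"
  unfolding in_L2_def by (intro nn_integral_eq_integral) auto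

lemma L2_norm_fun_square: "(L2_norm_fun g)\<^sup>2 = (\<integral>x. (norm (g x))\<^sup>2 \<partial>lborel)"
  by (simp add: L2_norm_fun_def)

text \<open>The side condition \<open>n \<le> N\<close> makes a sequence of cut-offs chosen by this
  lemma tend to infinity.\<close>

lemma L2_tail:
  assumes h: "in_L2 h" and "e > 0"
  obtains N :: nat where "n \<le> N" "(\<integral>\<^sup>+x. ennreal ((norm (h x))\<^sup>2) * indicator {x. real N < \<bar>x\<bar>} x \<partial>lborel) \<le> ennreal e"
proof -
  have [measurable]: "h \<in> borel_measurable borel" using h by (simp add: in_L2_def)
  have "(\<lambda>N. \<integral>x. (norm (h x))\<^sup>2 * indicator {x. real N < \<bar>x\<bar>} x \<partial>lborel) \<longlonglongrightarrow> integral\<^sup>L lborel (\<lambda>x::real. 0)"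
  proof (rule integral_dominated_convergence[where w = "\<lambda>x. (norm (h x))\<^sup>2"])
    show "AE x in lborel. (\<lambda>N. (norm (h x))\<^sup>2 * indicator {x. real N < \<bar>x\<bar>} x) \<longlonglongrightarrow> 0"
    proof (rule AE_I2)
      fix x
      obtain M where M: "\<bar>x\<bar> \<le> real M" using real_arch_simple by blast
      have "\<forall>\<^sub>F N in sequentially. (norm (h x))\<^sup>2 * indicator {x. real N < \<bar>x\<bar>} x = 0"
        using eventually_ge_at_top[of M] by eventually_elim (use M in auto)
      thus "(\<lambda>N. (norm (h x))\<^sup>2 * indicator {x. real N < \<bar>x\<bar>} x) \<longlonglongrightarrow> 0"
        by (rule tendsto_eventually)
    qed
  qed (use h in \<open>auto simp: in_L2_def split: split_indicator\<close>)
  hence "\<forall>\<^sub>F N in sequentially. (\<integral>x. (norm (h x))\<^sup>2 * indicator {x. real N < \<bar>x\<bar>} x \<partial>lborel) < e"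
    using assms(2) by (intro order_tendstoD(2)) auto
  hence "\<forall>\<^sub>F N in sequentially. (\<integral>x. (norm (h x))\<^sup>2 * indicator {x. real N < \<bar>x\<bar>} x \<partial>lborel) < e \<and> n \<le> N"
    using eventually_ge_at_top[of n] by eventually_elim auto
  then obtain N where N: "(\<integral>x. (norm (h x))\<^sup>2 * indicator {x. real N < \<bar>x\<bar>} x \<partial>lborel) < e" "n \<le> N"
    using eventually_happens'[OF sequentially_bot] by blast
  have "(\<integral>\<^sup>+x. ennreal ((norm (h x))\<^sup>2) * indicator {x. real N < \<bar>x\<bar>} x \<partial>lborel)
      = (\<integral>\<^sup>+x. ennreal ((norm (h x))\<^sup>2 * indicator {x. real N < \<bar>x\<bar>} x) \<partial>lborel)"
    by (intro nn_integral_cong) (auto split: split_indicator)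
  also have "\<dots> = ennreal (\<integral>x. (norm (h x))\<^sup>2 * indicator {x. real N < \<bar>x\<bar>} x \<partial>lborel)"
  proof (rule nn_integral_eq_integral)
    have "{x. real N < \<bar>x\<bar>} \<in> sets lborel" by measurable
    thus "integrable lborel (\<lambda>x. (norm (h x))\<^sup>2 * indicator {x. real N < \<bar>x\<bar>} x)"
      using h by (intro integrable_real_mult_indicator) (auto simp: in_L2_def)
  qed auto
  also have "\<dots> \<le> ennreal e" using N by (intro ennreal_leI) auto
  finally show ?thesis using N(2) that by blast
qed

lemma integrable_L2_truncation:
  assumes h: "in_L2 h"
  shows "integrable lborel (\<lambda>x. indicator {- r..r} x * h x)"
proof (rule Bochner_Integration.integrable_bound)
  have [measurable]: "h \<in> borel_measurable borel" using h by (simp add: in_L2_def)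
  show "integrable lborel (\<lambda>x. indicator {- r..r} x + (norm (h x))\<^sup>2)"
    using h unfolding in_L2_def
    by (intro Bochner_Integration.integrable_add integrable_real_indicator) (auto simp: emeasure_lborel_Icc_eq)
  show "AE x in lborel. norm (indicator {- r..r} x * h x) \<le> norm (indicat_real {- r..r} x + (norm (h x))\<^sup>2)"
  proof (rule AE_I2)
    fix x
    have "norm (h x) \<le> 1 + (norm (h x))\<^sup>2"
      using sum_squares_bound[of "norm (h x)" 1] by (simp add: power2_eq_square) (smt (verit) norm_ge_zero)
    thus "norm (indicator {- r..r} x * h x) \<le> norm (indicat_real {- r..r} x + (norm (h x))\<^sup>2)"
      by (auto split: split_indicator)
  qed
  show "(\<lambda>x. indicator {- r..r} x * h x) \<in> borel_measurable lborel" by measurable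
qed

text \<open>The Fourier transforms of the truncations of \<open>h\<close> to \<open>[-N\<^sub>k, N\<^sub>k]\<close> are an \<open>L\<^sup>2\<close> Cauchy
  sequence that, for quickly growing \<open>N\<^sub>k\<close>, converges almost everywhere.\<close>

lemma L2_fourier_transform_exists:
  assumes h: "in_L2 h"
  obtains H where "in_L2 H" "(\<integral>x. (norm (H x))\<^sup>2 \<partial>lborel) \<le> 2 * pi * (\<integral>x. (norm (h x))\<^sup>2 \<partial>lborel)"
    "\<And>\<phi>. \<phi> \<in> schwartz \<Longrightarrow> (\<integral>x. h x * fourier \<phi> x \<partial>lborel) = (\<integral>x. H x * \<phi> x \<partial>lborel)"
proof -
  have [measurable]: "h \<in> borel_measurable borel" using h by (simp add: in_L2_def)
  \<comment> \<open>The rate (1/8) ^ k leaves room for weights 2 ^ k: the weighted squares of the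
    increments still sum like (1/4) ^ k.\<close>
  have "\<exists>N\<ge>k. (\<integral>\<^sup>+x. ennreal ((norm (h x))\<^sup>2) * indicator {x. real N < \<bar>x\<bar>} x \<partial>lborel) \<le> ennreal ((1/8)^k)" for k
    by (rule L2_tail[OF h, of "(1/8)^k" k]) auto
  then obtain N where N: "\<And>k. N k \<ge> k"
    "\<And>k. (\<integral>\<^sup>+x. ennreal ((norm (h x))\<^sup>2) * indicator {x. real (N k) < \<bar>x\<bar>} x \<partial>lborel) \<le> ennreal ((1/8)^k)"
    by metis
  define r where "r = (\<lambda>k x. indicator {- real (N k)..real (N k)} x * h x)"
  define R where "R = (\<lambda>k. fourier (r k))"
  have ri: "integrable lborel (r k)" for k unfolding r_def by (rule integrable_L2_truncation[OF h])
  have [measurable]: "r k \<in> borel_measurable borel" for k using ri[of k] by auto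
  have [measurable]: "R k \<in> borel_measurable borel" for k unfolding R_def using ri by measurable
  have dist: "(\<integral>\<^sup>+\<xi>. ennreal ((norm (R l \<xi> - R k \<xi>))\<^sup>2) \<partial>lborel) \<le> ennreal (4 * pi * (1/8)^k)" if "k \<le> l" for k l
  proof -
    have "R l \<xi> - R k \<xi> = fourier (\<lambda>x. r l x - r k x) \<xi>" for \<xi>
      unfolding R_def fourier_cis using ri
      by (subst Bochner_Integration.integral_diff[symmetric]) (auto intro!: integrable_cis_mult simp: right_diff_distrib)
    hence A: "(\<integral>\<^sup>+\<xi>. ennreal ((norm (R l \<xi> - R k \<xi>))\<^sup>2) \<partial>lborel) \<le> ennreal (2 * pi) * (\<integral>\<^sup>+x. ennreal ((norm (r l x - r k x))\<^sup>2) \<partial>lborel)"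
      using Plancherel_le[of "\<lambda>x. r l x - r k x"] ri by simp
    have "(\<integral>\<^sup>+x. ennreal ((norm (r l x - r k x))\<^sup>2) \<partial>lborel) \<le>
       (\<integral>\<^sup>+x. ennreal ((norm (h x))\<^sup>2) * indicator {x. real (N l) < \<bar>x\<bar>} x + ennreal ((norm (h x))\<^sup>2) * indicator {x. real (N k) < \<bar>x\<bar>} x \<partial>lborel)"
      by (intro nn_integral_mono) (auto simp: r_def split: split_indicator)
    also have "\<dots> = (\<integral>\<^sup>+x. ennreal ((norm (h x))\<^sup>2) * indicator {x. real (N l) < \<bar>x\<bar>} x \<partial>lborel)
        + (\<integral>\<^sup>+x. ennreal ((norm (h x))\<^sup>2) * indicator {x. real (N k) < \<bar>x\<bar>} x \<partial>lborel)"
      by (intro nn_integral_add) auto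
    also have "\<dots> \<le> ennreal ((1/8)^l) + ennreal ((1/8)^k)" by (intro add_mono N)
    also have "\<dots> \<le> ennreal (2 * (1/8)^k)"
      using power_decreasing[OF that, of "1/8::real"]
      by (subst ennreal_plus[symmetric]) (simp_all del: ennreal_plus power_one_over add: ennreal_leI)
    finally have B: "(\<integral>\<^sup>+x. ennreal ((norm (r l x - r k x))\<^sup>2) \<partial>lborel) \<le> ennreal (2 * (1/8)^k)" .
    have C: "ennreal (2 * pi) * ennreal (2 * (1/8)^k) = ennreal (4 * pi * (1/8)^k)"
      by (subst ennreal_mult[symmetric]) (auto simp: mult_ac)
    show ?thesis using order_trans[OF A mult_left_mono[OF B]] unfolding C by simp
  qed
  have "AE \<xi> in lborel. convergent (\<lambda>k. R k \<xi>)"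
  proof -
    have "(\<integral>\<^sup>+\<xi>. (\<Sum>k. ennreal (2^k * (norm (R (Suc k) \<xi> - R k \<xi>))\<^sup>2)) \<partial>lborel)
        = (\<Sum>k. \<integral>\<^sup>+\<xi>. ennreal (2^k) * ennreal ((norm (R (Suc k) \<xi> - R k \<xi>))\<^sup>2) \<partial>lborel)"
      by (subst nn_integral_suminf) (auto simp: ennreal_mult)
    also have "\<dots> = (\<Sum>k. ennreal (2^k) * (\<integral>\<^sup>+\<xi>. ennreal ((norm (R (Suc k) \<xi> - R k \<xi>))\<^sup>2) \<partial>lborel))"
      by (intro suminf_cong nn_integral_cmult) auto
    also have "\<dots> \<le> (\<Sum>k. ennreal (4 * pi * (1/4)^k))"
    proof (intro suminf_le summableI)
      fix k :: nat
      have "ennreal (2^k) * (\<integral>\<^sup>+\<xi>. ennreal ((norm (R (Suc k) \<xi> - R k \<xi>))\<^sup>2) \<partial>lborel) \<le> ennreal (2^k) * ennreal (4 * pi * (1/8)^k)"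
        by (intro mult_left_mono dist) auto
      also have "\<dots> = ennreal (4 * pi * (1/4)^k)"
        by (subst ennreal_mult[symmetric]) (auto simp: power_mult_distrib[symmetric])
      finally show "ennreal (2^k) * (\<integral>\<^sup>+\<xi>. ennreal ((norm (R (Suc k) \<xi> - R k \<xi>))\<^sup>2) \<partial>lborel) \<le> ennreal (4 * pi * (1/4)^k)" .
    qed
    also have "\<dots> < \<infinity>"
      by (subst suminf_ennreal2) (auto intro!: summable_mult summable_geometric)
    finally have "AE \<xi> in lborel. (\<Sum>k. ennreal (2^k * (norm (R (Suc k) \<xi> - R k \<xi>))\<^sup>2)) \<noteq> \<infinity>"
      by (intro nn_integral_PInf_AE) auto
    thus ?thesis
    proof eventually_elim
      case (elim \<xi>)
      have s: "summable (\<lambda>k. 2^k * (norm (R (Suc k) \<xi> - R k \<xi>))\<^sup>2)"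
        using elim by (intro summable_suminf_not_top) auto
      have "summable (\<lambda>k. R (Suc k) \<xi> - R k \<xi>)"
      proof (rule summable_comparison_test)
        show "summable (\<lambda>k. (1/2::real)^k + 2^k * (norm (R (Suc k) \<xi> - R k \<xi>))\<^sup>2)"
          using s by (intro summable_add) auto
        \<comment> \<open>AM-GM with the weight 2 ^ k: summability of the weighted squares becomes
          summability of the increments themselves.\<close>
        have "norm (R (Suc k) \<xi> - R k \<xi>) \<le> (1/2)^k + 2^k * (norm (R (Suc k) \<xi> - R k \<xi>))\<^sup>2" for k
        proof -
          let ?d = "norm (R (Suc k) \<xi> - R k \<xi>)"
          have "0 \<le> (1/2)^k * (2^k * ?d - 1)\<^sup>2" by simp
          also have "\<dots> = (1/2)^k * (2^k * 2^k * ?d\<^sup>2 - 2 * 2^k * ?d + 1)"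
            by (simp add: power2_eq_square algebra_simps)
          also have "\<dots> = ((1/2)^k * 2^k) * (2^k * ?d\<^sup>2) - 2 * ((1/2)^k * 2^k) * ?d + (1/2)^k"
            by (simp add: algebra_simps)
          also have "(1/2)^k * 2^k = (1::real)" by (simp add: power_mult_distrib[symmetric])
          finally have "2 * ?d \<le> 2^k * ?d\<^sup>2 + (1/2)^k" by simp
          moreover have "?d \<ge> 0" by simp
          ultimately show ?thesis by linarith
        qed
        thus "\<exists>N. \<forall>n\<ge>N. norm (R (Suc n) \<xi> - R n \<xi>) \<le> (1/2)^n + 2^n * (norm (R (Suc n) \<xi> - R n \<xi>))\<^sup>2"
          by blast
      qed
      from summable_LIMSEQ[OF this] have "(\<lambda>n. R n \<xi> - R 0 \<xi>) \<longlonglongrightarrow> (\<Sum>k. R (Suc k) \<xi> - R k \<xi>)"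
        unfolding sum_lessThan_telescope[of "\<lambda>n. R n \<xi>"] .
      from tendsto_add[OF this tendsto_const[of "R 0 \<xi>"]] show ?case by (auto simp: convergent_def)
    qed
  qed
  define H where "H = (\<lambda>\<xi>. lim (\<lambda>k. R k \<xi>))"
  have [measurable]: "H \<in> borel_measurable borel" unfolding H_def by measurable
  have conv: "AE \<xi> in lborel. (\<lambda>k. R k \<xi>) \<longlonglongrightarrow> H \<xi>"
    using \<open>AE \<xi> in lborel. convergent (\<lambda>k. R k \<xi>)\<close>
    by eventually_elim (simp add: H_def convergent_LIMSEQ_iff)
  \<comment> \<open>Used with \<open>G = R k\<close> for the distance of \<open>H\<close> from the
    truncated transforms, and with \<open>G = 0\<close> for the norm of \<open>H\<close>.\<close>
  have fatou: "(\<integral>\<^sup>+\<xi>. ennreal ((norm (H \<xi> - G \<xi>))\<^sup>2) \<partial>lborel) \<le> B"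
    if "\<And>l. l \<ge> k \<Longrightarrow> (\<integral>\<^sup>+\<xi>. ennreal ((norm (R l \<xi> - G \<xi>))\<^sup>2) \<partial>lborel) \<le> B" and [measurable]: "G \<in> borel_measurable borel" for G B k
  proof -
    have "(\<integral>\<^sup>+\<xi>. ennreal ((norm (H \<xi> - G \<xi>))\<^sup>2) \<partial>lborel) = (\<integral>\<^sup>+\<xi>. liminf (\<lambda>l. ennreal ((norm (R l \<xi> - G \<xi>))\<^sup>2)) \<partial>lborel)"
    proof (rule nn_integral_cong_AE, use conv in eventually_elim)
      case (elim \<xi>)
      have "(\<lambda>l. ennreal ((norm (R l \<xi> - G \<xi>))\<^sup>2)) \<longlonglongrightarrow> ennreal ((norm (H \<xi> - G \<xi>))\<^sup>2)"
        by (intro tendsto_ennrealI tendsto_intros elim)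
      thus ?case by (rule lim_imp_Liminf[OF sequentially_bot, symmetric])
    qed
    also have "\<dots> \<le> liminf (\<lambda>l. \<integral>\<^sup>+\<xi>. ennreal ((norm (R l \<xi> - G \<xi>))\<^sup>2) \<partial>lborel)"
      by (intro nn_integral_liminf) auto
    also have "\<dots> \<le> limsup (\<lambda>l. \<integral>\<^sup>+\<xi>. ennreal ((norm (R l \<xi> - G \<xi>))\<^sup>2) \<partial>lborel)"
      by (intro Liminf_le_Limsup) auto
    also have "\<dots> \<le> B"
      by (intro Limsup_bounded eventually_mono[OF eventually_ge_at_top[of k]] that(1)) auto
    finally show ?thesis .
  qed
  have HR: "(\<integral>\<^sup>+\<xi>. ennreal ((norm (H \<xi> - R k \<xi>))\<^sup>2) \<partial>lborel) \<le> ennreal (4 * pi * (1/8)^k)" for k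
    by (rule fatou[of k]) (auto intro: dist)
  have H_le: "(\<integral>\<^sup>+\<xi>. ennreal ((norm (H \<xi>))\<^sup>2) \<partial>lborel) \<le> ennreal (2 * pi * (\<integral>x. (norm (h x))\<^sup>2 \<partial>lborel))"
  proof -
    have "(\<integral>\<^sup>+\<xi>. ennreal ((norm (R l \<xi>))\<^sup>2) \<partial>lborel) \<le> ennreal (2 * pi * (\<integral>x. (norm (h x))\<^sup>2 \<partial>lborel))" for l
    proof -
      have "(\<integral>\<^sup>+\<xi>. ennreal ((norm (R l \<xi>))\<^sup>2) \<partial>lborel) \<le> ennreal (2 * pi) * (\<integral>\<^sup>+x. ennreal ((norm (r l x))\<^sup>2) \<partial>lborel)"
        unfolding R_def by (intro Plancherel_le ri)
      also have "\<dots> \<le> ennreal (2 * pi) * (\<integral>\<^sup>+x. ennreal ((norm (h x))\<^sup>2) \<partial>lborel)"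
        by (intro mult_left_mono nn_integral_mono) (auto simp: r_def split: split_indicator)
      also have "\<dots> = ennreal (2 * pi * (\<integral>x. (norm (h x))\<^sup>2 \<partial>lborel))"
        by (simp add: in_L2_nn_eq[OF h] ennreal_mult)
      finally show ?thesis .
    qed
    thus ?thesis using fatou[of 0 "\<lambda>_. 0"] by simp
  qed
  have H: "in_L2 H" unfolding in_L2_nn using H_le by (auto intro: le_less_trans)
  have "(\<integral>x. (norm (H x))\<^sup>2 \<partial>lborel) \<le> 2 * pi * (\<integral>x. (norm (h x))\<^sup>2 \<partial>lborel)"
    using H_le unfolding in_L2_nn_eq[OF H] by (subst (asm) ennreal_le_iff) auto
  moreover have "(\<integral>x. h x * fourier \<phi> x \<partial>lborel) = (\<integral>x. H x * \<phi> x \<partial>lborel)" if \<phi>: "\<phi> \<in> schwartz" for \<phi>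
  proof -
    have [measurable]: "\<phi> \<in> borel_measurable borel" using \<phi> by (rule schwartz_measurable)
    have f\<phi>: "fourier \<phi> \<in> schwartz" using \<phi> by (rule fourier_schwartz)
    hence [measurable]: "fourier \<phi> \<in> borel_measurable borel" by (rule schwartz_measurable)
    have one: "in_L2 (\<lambda>x. \<phi> x)"
    proof -
      obtain B where "\<And>x. norm (\<phi> x) \<le> B" using schwartz_bound[OF \<phi>, of 0] by auto
      hence "integrable lborel (\<lambda>x. norm (\<phi> x * \<phi> x))"
        by (intro integrable_norm integrable_bounded_mult[OF schwartz_integrable[OF \<phi>]]) auto
      thus ?thesis by (simp add: in_L2_def norm_mult power2_eq_square)
    qed
    define S where "S = (\<integral>x. (norm (\<phi> x))\<^sup>2 \<partial>lborel)"
    have RL2: "in_L2 (R k)" for k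
    proof -
      have "(\<integral>\<^sup>+\<xi>. ennreal ((norm (R k \<xi>))\<^sup>2) \<partial>lborel) \<le> ennreal (2 * pi) * (\<integral>\<^sup>+x. ennreal ((norm (r k x))\<^sup>2) \<partial>lborel)"
        unfolding R_def by (intro Plancherel_le ri)
      also have "\<dots> \<le> ennreal (2 * pi) * (\<integral>\<^sup>+x. ennreal ((norm (h x))\<^sup>2) \<partial>lborel)"
        by (intro mult_left_mono nn_integral_mono) (auto simp: r_def split: split_indicator)
      also have "\<dots> < \<infinity>" by (simp add: in_L2_nn_eq[OF h] flip: ennreal_mult')
      finally show ?thesis unfolding in_L2_nn by simp
    qed
    \<comment> \<open>The pairing converges by AM-GM with weight 2 ^ k, which turns the squared
      distance of order (1/8) ^ k into (1/4) ^ k and costs (1/2) ^ k times the squared norm of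
      \<open>\<phi>\<close>.\<close>
    have A: "(\<lambda>k. \<integral>\<xi>. R k \<xi> * \<phi> \<xi> \<partial>lborel) \<longlonglongrightarrow> (\<integral>\<xi>. H \<xi> * \<phi> \<xi> \<partial>lborel)"
    proof (rule LIM_zero_cancel, rule Lim_null_comparison)
      have "norm ((\<integral>\<xi>. R k \<xi> * \<phi> \<xi> \<partial>lborel) - (\<integral>\<xi>. H \<xi> * \<phi> \<xi> \<partial>lborel)) \<le> 4 * pi * (1/4)^k + S * (1/2)^k" for k
      proof -
        have "(\<integral>\<xi>. R k \<xi> * \<phi> \<xi> \<partial>lborel) - (\<integral>\<xi>. H \<xi> * \<phi> \<xi> \<partial>lborel) = (\<integral>\<xi>. (R k \<xi> - H \<xi>) * \<phi> \<xi> \<partial>lborel)"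
          by (subst Bochner_Integration.integral_diff[symmetric])
             (auto intro!: schwartz_integrable_mult_L2 \<phi> H RL2 simp: left_diff_distrib)
        hence "ennreal (norm ((\<integral>\<xi>. R k \<xi> * \<phi> \<xi> \<partial>lborel) - (\<integral>\<xi>. H \<xi> * \<phi> \<xi> \<partial>lborel)))
           \<le> (\<integral>\<^sup>+\<xi>. ennreal (norm ((R k \<xi> - H \<xi>) * \<phi> \<xi>)) \<partial>lborel)"
          by (cases "integrable lborel (\<lambda>\<xi>. (R k \<xi> - H \<xi>) * \<phi> \<xi>)")
             (auto simp: integral_norm_bound_ennreal not_integrable_integral_eq)
        also have "\<dots> \<le> (\<integral>\<^sup>+\<xi>. ennreal (2^k) * ennreal ((norm (H \<xi> - R k \<xi>))\<^sup>2) + ennreal ((1/2)^k) * ennreal ((norm (\<phi> \<xi>))\<^sup>2) \<partial>lborel)"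
        proof (intro nn_integral_mono)
          fix \<xi>
          let ?a = "norm (H \<xi> - R k \<xi>)" and ?b = "norm (\<phi> \<xi>)"
          have "0 \<le> (1/2)^k * (2^k * ?a - ?b)\<^sup>2" by simp
          also have "\<dots> = ((1/2)^k * 2^k) * (2^k * ?a\<^sup>2) - 2 * ((1/2)^k * 2^k) * (?a * ?b) + (1/2)^k * ?b\<^sup>2"
            by (simp add: power2_eq_square algebra_simps)
          also have "(1/2)^k * 2^k = (1::real)" by (simp add: power_mult_distrib[symmetric])
          finally have "2 * (?a * ?b) \<le> 2^k * ?a\<^sup>2 + (1/2)^k * ?b\<^sup>2" by simp
          moreover have "?a * ?b \<ge> 0" by simp
          ultimately have *: "?a * ?b \<le> 2^k * ?a\<^sup>2 + (1/2)^k * ?b\<^sup>2" by linarith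
          have "ennreal (norm ((R k \<xi> - H \<xi>) * \<phi> \<xi>)) = ennreal (?a * ?b)"
            by (simp add: norm_mult norm_minus_commute)
          also have "\<dots> \<le> ennreal (2^k * ?a\<^sup>2 + (1/2)^k * ?b\<^sup>2)" using * by (rule ennreal_leI)
          also have "\<dots> = ennreal (2^k) * ennreal (?a\<^sup>2) + ennreal ((1/2)^k) * ennreal (?b\<^sup>2)"
            by (simp only: ennreal_mult[symmetric] ennreal_plus[symmetric] zero_le_power2 zero_le_power zero_le_numeral mult_nonneg_nonneg zero_le_divide_1_iff)
          finally show "ennreal (norm ((R k \<xi> - H \<xi>) * \<phi> \<xi>)) \<le> \<dots>" .
        qed
        also have "\<dots> = ennreal (2^k) * (\<integral>\<^sup>+\<xi>. ennreal ((norm (H \<xi> - R k \<xi>))\<^sup>2) \<partial>lborel) + ennreal ((1/2)^k) * (\<integral>\<^sup>+\<xi>. ennreal ((norm (\<phi> \<xi>))\<^sup>2) \<partial>lborel)"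
          by (subst nn_integral_add) (auto simp: nn_integral_cmult)
        also have "\<dots> \<le> ennreal (2^k) * ennreal (4 * pi * (1/8)^k) + ennreal ((1/2)^k) * ennreal S"
          unfolding S_def in_L2_nn_eq[OF one] by (intro add_mono mult_left_mono HR) auto
        also have "\<dots> = ennreal (2^k * (4 * pi * (1/8)^k) + (1/2)^k * S)"
          by (simp add: ennreal_mult ennreal_plus S_def)
        also have "2^k * (4 * pi * (1/8)^k) + (1/2)^k * S = 4 * pi * (1/4)^k + S * (1/2)^k"
        proof -
          have "2^k * (1/8)^k = (1/4::real)^k" by (simp add: power_mult_distrib[symmetric])
          hence "2^k * (4 * pi * (1/8)^k) = 4 * pi * (1/4)^k" by (metis mult.left_commute)
          thus ?thesis by simp
        qed
        finally show ?thesis by (subst (asm) ennreal_le_iff) (auto simp: S_def)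
      qed
      thus "\<forall>\<^sub>F k in sequentially. norm ((\<integral>\<xi>. R k \<xi> * \<phi> \<xi> \<partial>lborel) - (\<integral>\<xi>. H \<xi> * \<phi> \<xi> \<partial>lborel)) \<le> 4 * pi * (1/4)^k + S * (1/2)^k"
        by simp
      have "(\<lambda>k. 4 * pi * (1/4)^k + S * (1/2)^k) \<longlonglongrightarrow> 4 * pi * 0 + S * 0"
        by (intro tendsto_intros LIMSEQ_power_zero) auto
      thus "(\<lambda>k. 4 * pi * (1/4)^k + S * (1/2)^k) \<longlonglongrightarrow> 0" by simp
    qed
    have B: "(\<lambda>k. \<integral>x. r k x * fourier \<phi> x \<partial>lborel) \<longlonglongrightarrow> (\<integral>x. h x * fourier \<phi> x \<partial>lborel)"
    proof (rule integral_dominated_convergence[where w = "\<lambda>x. norm (h x * fourier \<phi> x)"])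
      show "AE x in lborel. (\<lambda>k. r k x * fourier \<phi> x) \<longlonglongrightarrow> h x * fourier \<phi> x"
      proof (intro AE_I2 tendsto_intros)
        fix x
        obtain M where M: "\<bar>x\<bar> \<le> real M" using real_arch_simple by blast
        have "\<forall>\<^sub>F k in sequentially. r k x = h x"
          using eventually_ge_at_top[of M]
        proof eventually_elim
          case (elim k)
          hence "\<bar>x\<bar> \<le> real (N k)" using M N(1)[of k] by linarith
          thus ?case by (simp add: r_def abs_le_iff)
        qed
        thus "(\<lambda>k. r k x) \<longlonglongrightarrow> h x" by (rule tendsto_eventually)
      qed
      show "integrable lborel (\<lambda>x. norm (h x * fourier \<phi> x))"
        by (intro integrable_norm schwartz_integrable_mult_L2 h f\<phi>)
    qed (auto simp: r_def norm_mult split: split_indicator)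
    have "(\<integral>x. r k x * fourier \<phi> x \<partial>lborel) = (\<integral>\<xi>. R k \<xi> * \<phi> \<xi> \<partial>lborel)" for k
      using fourier_multiplication_formula[OF ri schwartz_integrable[OF \<phi>], of k]
      by (simp add: R_def mult.commute)
    thus ?thesis using LIMSEQ_unique[OF B] A by simp
  qed
  ultimately show ?thesis using H that by blast
qed

section \<open>Fourier transforms of Sobolev functions\<close>

lemma bessel_symbol_cancel: "(1 + \<xi>\<^sup>2) powr a * ((1 + \<xi>\<^sup>2) powr (- a) * x) = (x :: real)"
proof -
  have "1 + \<xi>\<^sup>2 > 0" by (simp add: add_pos_nonneg)
  hence "(1 + \<xi>\<^sup>2) powr a * (1 + \<xi>\<^sup>2) powr (- a) = 1" by (simp add: powr_add[symmetric])
  thus ?thesis by (simp add: mult.assoc[symmetric])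
qed

text \<open>Testing \<open>bessel s f\<close> with the Fourier transform of \<open>\<eta>\<close>,
  where \<open>\<eta>\<close> is \<open>\<phi>\<close> divided by the symbol, undoes the inverse
  transform and the multiplier. Hence the transform of \<open>f\<close> is represented by the L2
  transform of \<open>h\<close> divided by the symbol, and the choice in \<open>fhat\<close> can
  alter this on a null set only.\<close>

lemma sobolev_fhat:
  assumes f: "f \<in> sobolev s"
  shows "fhat f \<in> borel_measurable borel"
    and "integrable lborel (\<lambda>\<xi>. (1 + \<xi>\<^sup>2) powr s * (norm (fhat f \<xi>))\<^sup>2)"
    and "(\<integral>\<xi>. (1 + \<xi>\<^sup>2) powr s * (norm (fhat f \<xi>))\<^sup>2 \<partial>lborel) \<le> 2 * pi * (sobolev_norm s f)\<^sup>2"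
proof -
  obtain h where h: "in_L2 h" "represents h (bessel s f)" using f by (auto simp: sobolev_def)
  obtain H where H: "in_L2 H" "(\<integral>x. (norm (H x))\<^sup>2 \<partial>lborel) \<le> 2 * pi * (\<integral>x. (norm (h x))\<^sup>2 \<partial>lborel)"
    "\<And>\<phi>. \<phi> \<in> schwartz \<Longrightarrow> (\<integral>x. h x * fourier \<phi> x \<partial>lborel) = (\<integral>x. H x * \<phi> x \<partial>lborel)"
    by (rule L2_fourier_transform_exists[OF h(1)]) blast
  have [measurable]: "H \<in> borel_measurable borel" "h \<in> borel_measurable borel"
    using H(1) h(1) by (auto simp: in_L2_def)
  define g where "g = (\<lambda>\<xi>. of_real ((1 + \<xi>\<^sup>2) powr (- (s/2))) * H \<xi>)"
  have [measurable]: "g \<in> borel_measurable borel" unfolding g_def by measurable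
  have "represents g (distr_fourier f)"
    unfolding represents_def
  proof (intro conjI ballI)
    fix \<phi> assume \<phi>: "\<phi> \<in> schwartz"
    let ?\<eta> = "\<lambda>\<xi>. of_real ((1 + \<xi>\<^sup>2) powr (- (s/2))) * \<phi> \<xi>"
    have \<eta>: "?\<eta> \<in> schwartz" by (intro schwartz_mult_symbol \<phi>)
    have eq: "g \<xi> * \<phi> \<xi> = H \<xi> * ?\<eta> \<xi>" for \<xi> by (simp add: g_def)
    show "integrable lborel (\<lambda>\<xi>. g \<xi> * \<phi> \<xi>)"
      unfolding eq by (intro schwartz_integrable_mult_L2 H \<eta>)
    have "bessel s f (fourier ?\<eta>) = f (fourier (\<lambda>\<xi>. of_real ((1 + \<xi>\<^sup>2) powr (s / 2)) * ?\<eta> \<xi>))"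
      unfolding bessel_def distr_inv_fourier_def distr_mult_def distr_fourier_def
        fourier_inversion_schwartz[OF \<eta>] ..
    also have "(\<lambda>\<xi>. of_real ((1 + \<xi>\<^sup>2) powr (s / 2)) * ?\<eta> \<xi>) = \<phi>"
    proof
      fix \<xi>
      have "(1 + \<xi>\<^sup>2) powr (s / 2) * (1 + \<xi>\<^sup>2) powr (- (s / 2)) = 1"
        using bessel_symbol_cancel[of \<xi> "s/2" 1] by simp
      thus "of_real ((1 + \<xi>\<^sup>2) powr (s / 2)) * ?\<eta> \<xi> = \<phi> \<xi>"
        by (metis mult.assoc mult_1 of_real_1 of_real_mult)
    qed
    finally have "distr_fourier f \<phi> = bessel s f (fourier ?\<eta>)" by (simp add: distr_fourier_def)
    also have "\<dots> = (\<integral>x. h x * fourier ?\<eta> x \<partial>lborel)"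
      using h(2) fourier_schwartz[OF \<eta>] unfolding represents_def by blast
    also have "\<dots> = (\<integral>x. g x * \<phi> x \<partial>lborel)" unfolding H(3)[OF \<eta>] eq ..
    finally show "distr_fourier f \<phi> = (\<integral>x. g x * \<phi> x \<partial>lborel)" .
  qed measurable
  from function_of_AE[OF this] have fh: "represents (fhat f) (distr_fourier f)" "AE \<xi> in lborel. fhat f \<xi> = g \<xi>"
    by (auto simp: fhat_def)
  show m[measurable]: "fhat f \<in> borel_measurable borel" using fh(1) by (simp add: represents_def)
  have ae: "AE \<xi> in lborel. (norm (H \<xi>))\<^sup>2 = (1 + \<xi>\<^sup>2) powr s * (norm (fhat f \<xi>))\<^sup>2"
    using fh(2)
  proof eventually_elim
    case (elim \<xi>)
    have "(norm (fhat f \<xi>))\<^sup>2 = ((1 + \<xi>\<^sup>2) powr (- (s/2)))\<^sup>2 * (norm (H \<xi>))\<^sup>2"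
      by (simp add: elim g_def norm_mult power_mult_distrib)
    also have "((1 + \<xi>\<^sup>2) powr (- (s/2)))\<^sup>2 = (1 + \<xi>\<^sup>2) powr (- s)"
      by (simp add: power2_eq_square powr_add[symmetric])
    finally have e: "(norm (fhat f \<xi>))\<^sup>2 = (1 + \<xi>\<^sup>2) powr (- s) * (norm (H \<xi>))\<^sup>2" .
    show ?case by (simp only: e bessel_symbol_cancel)
  qed
  show "integrable lborel (\<lambda>\<xi>. (1 + \<xi>\<^sup>2) powr s * (norm (fhat f \<xi>))\<^sup>2)"
    by (rule integrable_cong_AE_imp[OF _ _ ae]) (use H(1) in \<open>auto simp: in_L2_def\<close>)
  have "(\<integral>\<xi>. (1 + \<xi>\<^sup>2) powr s * (norm (fhat f \<xi>))\<^sup>2 \<partial>lborel) = (\<integral>\<xi>. (norm (H \<xi>))\<^sup>2 \<partial>lborel)"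
    by (rule integral_cong_AE) (use ae in auto)
  also have "\<dots> \<le> 2 * pi * (\<integral>x. (norm (h x))\<^sup>2 \<partial>lborel)" by (rule H(2))
  also have "(\<integral>x. (norm (h x))\<^sup>2 \<partial>lborel) = (\<integral>x. (norm (function_of (bessel s f) x))\<^sup>2 \<partial>lborel)"
  proof (rule integral_cong_AE)
    show "AE x in lborel. (norm (h x))\<^sup>2 = (norm (function_of (bessel s f) x))\<^sup>2"
      using function_of_AE(2)[OF h(2)] by eventually_elim simp
  qed (use function_of_AE(1)[OF h(2)] in \<open>auto simp: represents_def\<close>)
  also have "\<dots> = (sobolev_norm s f)\<^sup>2" by (simp add: sobolev_norm_def L2_norm_fun_square)
  finally show "(\<integral>\<xi>. (1 + \<xi>\<^sup>2) powr s * (norm (fhat f \<xi>))\<^sup>2 \<partial>lborel) \<le> 2 * pi * (sobolev_norm s f)\<^sup>2" .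
qed

section \<open>Oscillatory integrals\<close>

lemma has_vector_derivative_cis_comp:
  assumes "(\<phi> has_real_derivative d) (at x within S)"
  shows "((\<lambda>x. cis (\<phi> x)) has_vector_derivative of_real d * (\<i> * cis (\<phi> x))) (at x within S)"
proof -
  have "(cis has_vector_derivative (\<i> * cis (\<phi> x))) (at (\<phi> x) within \<phi> ` S)"
    using cis_has_vderiv[of "-1" "\<phi> x"] by (simp add: has_vector_derivative_at_within)
  from vector_diff_chain_within[OF _ this, of d]
  show ?thesis using assms
    by (simp add: o_def scaleR_conv_of_real has_real_derivative_iff_has_vector_derivative)
qed

lemma van_der_Corput_first:
  fixes \<phi> :: "real \<Rightarrow> real"
  assumes "l \<le> r" "\<rho> > 0"
    and d\<phi>: "\<And>x. x \<in> {l..r} \<Longrightarrow> (\<phi> has_real_derivative \<phi>' x) (at x within {l..r})"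
    and d\<phi>': "\<And>x. x \<in> {l..r} \<Longrightarrow> (\<phi>' has_real_derivative \<phi>'' x) (at x within {l..r})"
    and da: "\<And>x. x \<in> {l..r} \<Longrightarrow> (a has_real_derivative a' x) (at x within {l..r})"
    and conv: "\<And>x. x \<in> {l..r} \<Longrightarrow> \<phi>'' x \<ge> 0"
    and low: "\<And>x. x \<in> {l..r} \<Longrightarrow> \<bar>\<phi>' x\<bar> \<ge> \<rho>"
    and a: "\<And>x. x \<in> {l..r} \<Longrightarrow> 0 \<le> a x \<and> a x \<le> 1 \<and> a' x \<le> 0"
  shows "norm (integral {l..r} (\<lambda>x. cis (\<phi> x) * of_real (a x))) \<le> 5 / \<rho>"
proof -
  define F where "F = (\<lambda>x. (- \<i>) * (cis (\<phi> x) * of_real (a x / \<phi>' x)))"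
  define E where "E = (\<lambda>x. (- \<i>) * (cis (\<phi> x) * of_real ((a' x * \<phi>' x - a x * \<phi>'' x) / (\<phi>' x * \<phi>' x))))"
  \<comment> \<open>Integration by parts produces the error \<open>E\<close>. As \<open>a\<close>
    decreases and \<open>\<phi>'\<close> increases, \<open>norm (E x)\<close> is at most the
    derivative of \<open>G\<close>, so the error telescopes; the constant 5 counts two boundary
    terms of \<open>F\<close> and three of \<open>G\<close>.\<close>
  define G where "G = (\<lambda>x. - (a x / \<rho>) - 1 / \<phi>' x)"
  define G' where "G' = (\<lambda>x. - (a' x / \<rho>) + \<phi>'' x / (\<phi>' x * \<phi>' x))"
  let ?f = "\<lambda>x. cis (\<phi> x) * of_real (a x) :: complex"
  have nz: "\<phi>' x \<noteq> 0" if "x \<in> {l..r}" for x using low[OF that] assms(2) by auto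
  have dF: "(F has_vector_derivative (?f x + E x)) (at x within {l..r})" if x: "x \<in> {l..r}" for x
  proof -
    have 1: "((\<lambda>x. complex_of_real (a x / \<phi>' x)) has_vector_derivative
       of_real ((a' x * \<phi>' x - a x * \<phi>'' x) / (\<phi>' x * \<phi>' x))) (at x within {l..r})"
      unfolding has_real_derivative_iff_has_vector_derivative[symmetric]
      using DERIV_divide[OF da[OF x] d\<phi>'[OF x] nz[OF x]]
      by (intro has_vector_derivative_of_real) (simp add: has_real_derivative_iff_has_vector_derivative)
    from has_vector_derivative_mult[OF has_vector_derivative_const[of "-\<i>"]
        has_vector_derivative_mult[OF has_vector_derivative_cis_comp[OF d\<phi>[OF x]] 1]]
    show ?thesis unfolding F_def E_def
      by (rule has_vector_derivative_eq_rhs) (use nz[OF x] in \<open>simp add: field_simps\<close>)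
  qed
  have dG: "(G has_vector_derivative G' x) (at x within {l..r})" if x: "x \<in> {l..r}" for x
    unfolding has_real_derivative_iff_has_vector_derivative[symmetric] G_def G'_def
    using nz[OF x] assms(2) by (auto intro!: derivative_eq_intros da d\<phi>' x simp: field_simps)
  have iF: "((\<lambda>x. ?f x + E x) has_integral (F r - F l)) {l..r}"
    by (intro fundamental_theorem_of_calculus assms(1) dF)
  have iG: "(G' has_integral (G r - G l)) {l..r}"
    by (intro fundamental_theorem_of_calculus assms(1) dG)
  have "continuous_on {l..r} \<phi>" "continuous_on {l..r} a"
    using d\<phi> da by (meson DERIV_continuous continuous_on_eq_continuous_within)+
  hence if': "?f integrable_on {l..r}"
    by (intro integrable_continuous_interval continuous_intros)
  have iE: "E integrable_on {l..r}"
    using integrable_diff[OF has_integral_integrable[OF iF] if'] by simp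
  have EG: "norm (E x) \<le> G' x" if x: "x \<in> {l..r}" for x
  proof -
    let ?p = "\<bar>\<phi>' x\<bar>"
    have pp: "\<phi>' x * \<phi>' x = ?p * ?p" by simp
    have p: "?p > 0" using nz[OF x] by simp
    have "norm (E x) = \<bar>a' x * \<phi>' x - a x * \<phi>'' x\<bar> / (?p * ?p)"
      by (simp add: E_def norm_mult abs_mult del: of_real_mult of_real_diff of_real_divide)
    also have "\<dots> \<le> (- a' x * ?p + \<phi>'' x) / (?p * ?p)"
    proof (rule divide_right_mono)
      have "\<bar>a' x * \<phi>' x - a x * \<phi>'' x\<bar> \<le> \<bar>a' x * \<phi>' x\<bar> + \<bar>a x * \<phi>'' x\<bar>" by (rule abs_triangle_ineq4)
      also have "\<dots> = - a' x * ?p + a x * \<phi>'' x" using a[OF x] conv[OF x] by (simp add: abs_mult)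
      also have "\<dots> \<le> - a' x * ?p + \<phi>'' x" using a[OF x] conv[OF x] by (simp add: mult_left_le_one_le)
      finally show "\<bar>a' x * \<phi>' x - a x * \<phi>'' x\<bar> \<le> - a' x * ?p + \<phi>'' x" .
    qed auto
    also have "\<dots> = - a' x / ?p + \<phi>'' x / (\<phi>' x * \<phi>' x)"
    proof -
      have gen: "(A * P + B) / (P * P) = A / P + B / (P * P)" if "P > 0" for A B P :: real
        using that by (simp add: field_simps)
      show ?thesis unfolding pp by (rule gen[OF p])
    qed
    also have "- a' x / ?p \<le> - a' x / \<rho>"
      using a[OF x] low[OF x] assms(2) by (intro divide_left_mono) auto
    finally show ?thesis by (simp add: G'_def)
  qed
  have ends: "norm (F x) \<le> 1 / \<rho>" "\<bar>1 / \<phi>' x\<bar> \<le> 1 / \<rho>" if x: "x \<in> {l..r}" for x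
  proof -
    show "\<bar>1 / \<phi>' x\<bar> \<le> 1 / \<rho>" using low[OF x] assms(2) by (simp add: divide_left_mono)
    have "norm (F x) = a x / \<bar>\<phi>' x\<bar>" using a[OF x] by (simp add: F_def norm_mult norm_divide)
    also have "\<dots> \<le> 1 / \<rho>" using low[OF x] assms(2) a[OF x] by (intro frac_le) auto
    finally show "norm (F x) \<le> 1 / \<rho>" .
  qed
  have "integral {l..r} (\<lambda>x. ?f x + E x) = F r - F l" using iF by blast
  hence "integral {l..r} ?f = F r - F l - integral {l..r} E"
    using Henstock_Kurzweil_Integration.integral_add[OF if' iE] by (simp add: algebra_simps)
  hence "norm (integral {l..r} ?f) \<le> norm (F r) + norm (F l) + norm (integral {l..r} E)"
    using norm_triangle_ineq4[of "F r - F l" "integral {l..r} E"] norm_triangle_ineq4[of "F r" "F l"] by simp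
  also have "norm (integral {l..r} E) \<le> integral {l..r} G'"
    using EG iE iG by (intro Henstock_Kurzweil_Integration.integral_norm_bound_integral) auto
  also have "integral {l..r} G' = G r - G l" using iG by blast
  also have "G r - G l \<le> 3 / \<rho>"
  proof -
    have m: "l \<in> {l..r}" "r \<in> {l..r}" using assms(1) by auto
    have "a l / \<rho> \<le> 1 / \<rho>" "a r / \<rho> \<ge> 0" using a[OF m(1)] a[OF m(2)] assms(2) by (auto simp: divide_right_mono)
    moreover have "1 / \<phi>' l \<le> 1 / \<rho>" "- (1 / \<phi>' r) \<le> 1 / \<rho>"
      using ends(2)[OF m(1)] ends(2)[OF m(2)] unfolding abs_le_iff by blast+
    moreover have "3 / \<rho> = 1 / \<rho> + 1 / \<rho> + 1 / \<rho>" by simp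
    ultimately show ?thesis unfolding G_def by linarith
  qed
  finally show ?thesis using ends(1)[of l] ends(1)[of r] assms(1) by simp
qed

text \<open>\<open>\<phi>'\<close> grows at rate at least \<open>\<sigma>\<close>, so outside the
  \<open>h\<close>-neighbourhood of \<open>c\<close> it is at least \<open>sqrt \<sigma>\<close> in
  absolute value. With h = 1 / sqrt \<sigma> the middle piece costs its length, at most 2 h, and the
  two outer ones 5 / sqrt \<sigma> each, whence 12.\<close>

lemma van_der_Corput_second:
  fixes \<phi> :: "real \<Rightarrow> real"
  assumes "l \<le> r" "\<sigma> > 0"
    and d\<phi>: "\<And>x. x \<in> {l..r} \<Longrightarrow> (\<phi> has_real_derivative \<phi>' x) (at x within {l..r})"
    and d\<phi>': "\<And>x. x \<in> {l..r} \<Longrightarrow> (\<phi>' has_real_derivative \<phi>'' x) (at x within {l..r})"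
    and da: "\<And>x. x \<in> {l..r} \<Longrightarrow> (a has_real_derivative a' x) (at x within {l..r})"
    and conv: "\<And>x. x \<in> {l..r} \<Longrightarrow> \<phi>'' x \<ge> \<sigma>"
    and a: "\<And>x. x \<in> {l..r} \<Longrightarrow> 0 \<le> a x \<and> a x \<le> 1 \<and> a' x \<le> 0"
  shows "norm (integral {l..r} (\<lambda>x. cis (\<phi> x) * of_real (a x))) \<le> 12 / sqrt \<sigma>"
proof -
  let ?f = "\<lambda>x. cis (\<phi> x) * of_real (a x) :: complex"
  define h where "h = 1 / sqrt \<sigma>"
  have h: "h > 0" "\<sigma> * h = sqrt \<sigma>" "1 / h = sqrt \<sigma>"
    using assms(2) by (auto simp: h_def real_div_sqrt)
  have c1: "continuous_on {l..r} \<phi>'"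
    using d\<phi>' by (meson DERIV_continuous continuous_on_eq_continuous_within)
  have "continuous_on {l..r} \<phi>" "continuous_on {l..r} a"
    using d\<phi> da by (meson DERIV_continuous continuous_on_eq_continuous_within)+
  hence fc: "continuous_on {l..r} ?f" by (intro continuous_intros)
  have incr: "\<phi>' y - \<phi>' x \<ge> \<sigma> * (y - x)" if "l \<le> x" "x \<le> y" "y \<le> r" for x y
  proof -
    have "\<phi>' x - \<sigma> * x \<le> \<phi>' y - \<sigma> * y"
    proof (rule DERIV_nonneg_imp_increasing_open[OF that(2)])
      fix z assume z: "x < z" "z < y"
      hence "z \<in> interior {l..r}" "z \<in> {l..r}" using that by auto
      hence "(\<phi>' has_real_derivative \<phi>'' z) (at z)" using d\<phi>'[of z] by (metis at_within_interior)
      thus "\<exists>d. ((\<lambda>x. \<phi>' x - \<sigma> * x) has_real_derivative d) (at z) \<and> 0 \<le> d"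
        using conv[OF \<open>z \<in> {l..r}\<close>] by (intro exI[of _ "\<phi>'' z - \<sigma>"]) (auto intro!: derivative_eq_intros)
    next
      show "continuous_on {x..y} (\<lambda>x. \<phi>' x - \<sigma> * x)"
        using that by (intro continuous_intros continuous_on_subset[OF c1]) auto
    qed
    thus ?thesis by (simp add: algebra_simps)
  qed
  \<comment> \<open>A zero of \<open>\<phi>'\<close>, or the end of the interval nearest to where
    one would be; the disjunctions keep the sign required on each side of \<open>c\<close> that is
    not empty.\<close>
  obtain c where c: "c \<in> {l..r}" "c = l \<or> \<phi>' c \<le> 0" "c = r \<or> \<phi>' c \<ge> 0"
  proof -
    consider "\<phi>' l \<ge> 0" | "\<phi>' r \<le> 0" | "\<phi>' l \<le> 0" "0 \<le> \<phi>' r" by linarith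
    thus ?thesis
    proof cases
      case 3
      from IVT'[OF 3 assms(1) c1] show ?thesis using that by (metis atLeastAtMost_iff order_refl)
    qed (use that[of l] that[of r] assms(1) in auto)
  qed
  define p where "p = max l (c - h)"
  define q where "q = min r (c + h)"
  have pq: "l \<le> p" "p \<le> q" "q \<le> r" "q - p \<le> 2 * h"
    using c h by (auto simp: p_def q_def)
  have low1: "\<bar>\<phi>' x\<bar> \<ge> sqrt \<sigma>" if "x \<in> {l..p}" "l < p" for x
  proof -
    have pc: "p = c - h" "c \<noteq> l" using that(2) h(1) by (auto simp: p_def max_def split: if_splits)
    have "\<phi>' c - \<phi>' x \<ge> \<sigma> * (c - x)" using that c pc h by (intro incr) auto
    moreover have "\<sigma> * (c - x) \<ge> \<sigma> * h" using that pc assms(2) by (intro mult_left_mono) auto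
    ultimately show ?thesis using c(2) pc(2) h(2) by linarith
  qed
  have low2: "\<bar>\<phi>' x\<bar> \<ge> sqrt \<sigma>" if "x \<in> {q..r}" "q < r" for x
  proof -
    have qc: "q = c + h" "c \<noteq> r" using that(2) h(1) by (auto simp: q_def min_def split: if_splits)
    have "\<phi>' x - \<phi>' c \<ge> \<sigma> * (x - c)" using that c qc h by (intro incr) auto
    moreover have "\<sigma> * (x - c) \<ge> \<sigma> * h" using that qc assms(2) by (intro mult_left_mono) auto
    ultimately show ?thesis using c(3) qc(2) h(2) by linarith
  qed
  have first: "norm (integral {u..v} ?f) \<le> 5 / sqrt \<sigma>"
    if "l \<le> u" "u \<le> v" "v \<le> r" "\<And>x. x \<in> {u..v} \<Longrightarrow> \<bar>\<phi>' x\<bar> \<ge> sqrt \<sigma>" for u v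
  proof (rule van_der_Corput_first[where \<phi>' = \<phi>' and \<phi>'' = \<phi>'' and a' = a'])
    fix x assume x: "x \<in> {u..v}"
    hence xl: "x \<in> {l..r}" and sub: "{u..v} \<subseteq> {l..r}" using that by auto
    show "(\<phi> has_real_derivative \<phi>' x) (at x within {u..v})" by (rule DERIV_subset[OF d\<phi>[OF xl] sub])
    show "(\<phi>' has_real_derivative \<phi>'' x) (at x within {u..v})" by (rule DERIV_subset[OF d\<phi>'[OF xl] sub])
    show "(a has_real_derivative a' x) (at x within {u..v})" by (rule DERIV_subset[OF da[OF xl] sub])
    show "0 \<le> \<phi>'' x" using conv[OF xl] assms(2) by linarith
    show "0 \<le> a x \<and> a x \<le> 1 \<and> a' x \<le> 0" by (rule a[OF xl])
  qed (use that assms in auto)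
  have ints: "?f integrable_on {u..v}" if "l \<le> u" "v \<le> r" for u v
    using that by (intro integrable_continuous_interval continuous_on_subset[OF fc]) auto
  have "integral {l..r} ?f = integral {l..p} ?f + integral {p..q} ?f + integral {q..r} ?f"
    using Henstock_Kurzweil_Integration.integral_combine[of l p q ?f]
      Henstock_Kurzweil_Integration.integral_combine[of l q r ?f] pq ints
    by simp
  hence "norm (integral {l..r} ?f) \<le> norm (integral {l..p} ?f) + norm (integral {p..q} ?f) + norm (integral {q..r} ?f)"
    by (simp add: norm_triangle_le norm_triangle_mono)
  moreover have "norm (integral {l..p} ?f) \<le> 5 / sqrt \<sigma>"
  proof (cases "l < p")
    case True
    thus ?thesis using first[of l p] low1 pq by auto
  next
    case False
    hence "l = p" using pq by simp
    thus ?thesis using assms(2) by simp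
  qed
  moreover have "norm (integral {q..r} ?f) \<le> 5 / sqrt \<sigma>"
  proof (cases "q < r")
    case True
    thus ?thesis using first[of q r] low2 pq by auto
  next
    case False
    hence "q = r" using pq by simp
    thus ?thesis using assms(2) by simp
  qed
  moreover have "norm (integral {p..q} ?f) \<le> 1 * (q - p)"
  proof (rule integral_bound)
    show "continuous_on {p..q} ?f" using pq by (intro continuous_on_subset[OF fc]) auto
    show "norm (?f x) \<le> 1" if "x \<in> {p..q}" for x using a[of x] that pq by (auto simp: norm_mult)
  qed (use pq in auto)
  ultimately show ?thesis using pq(4) by (simp add: h_def)
qed

section \<open>Kernels of dyadic frequency intervals\<close>

lemma dyadic_kernel_neg:
  fixes m x t c L :: real
  assumes m: "0 < m" "m < 1" and L: "1 \<le> L" and t: "t \<le> 0" "-1 \<le> t" and x: "x \<noteq> 0" and c: "c \<ge> 0"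
  defines "K \<equiv> integral {L..2*L} (\<lambda>\<xi>. cis (x * \<xi> + t * \<xi> powr m) * of_real (exp (- c * \<xi>\<^sup>2)))"
  shows "norm K \<le> 10 / \<bar>x\<bar> \<or> (\<bar>x\<bar> \<le> 2 * L powr (m - 1) \<and> norm K \<le> 12 * sqrt (8 * L / ((1 - m) * \<bar>x\<bar>)))"
proof -
  let ?\<phi> = "\<lambda>\<xi>. x * \<xi> + t * \<xi> powr m"
  let ?\<phi>' = "\<lambda>\<xi>. x + t * (m * \<xi> powr (m - 1))"
  let ?\<phi>'' = "\<lambda>\<xi>. t * (m * ((m - 1) * \<xi> powr (m - 1 - 1)))"
  let ?a = "\<lambda>\<xi>. exp (- c * \<xi>\<^sup>2)"
  let ?a' = "\<lambda>\<xi>. - (2 * c * \<xi> * exp (- c * \<xi>\<^sup>2))"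
  have d1: "(?\<phi> has_real_derivative ?\<phi>' \<xi>) (at \<xi> within {L..2*L})" if "\<xi> \<in> {L..2*L}" for \<xi>
    using that L by (auto intro!: derivative_eq_intros)
  have d2: "(?\<phi>' has_real_derivative ?\<phi>'' \<xi>) (at \<xi> within {L..2*L})" if "\<xi> \<in> {L..2*L}" for \<xi>
    using that L by (auto intro!: derivative_eq_intros)
  have d3: "(?a has_real_derivative ?a' \<xi>) (at \<xi> within {L..2*L})" for \<xi>
    by (auto intro!: derivative_eq_intros)
  have a: "0 \<le> ?a \<xi> \<and> ?a \<xi> \<le> 1 \<and> ?a' \<xi> \<le> 0" if "\<xi> \<in> {L..2*L}" for \<xi>
    using that L c by auto
  have pos'': "?\<phi>'' \<xi> = (- t) * m * (1 - m) * \<xi> powr (m - 2)" for \<xi>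
    by (simp add: algebra_simps)
  show ?thesis
  \<comment> \<open>The sign of t makes the phase convex. If the t-part of its derivative is at most
    |x| / 2 there is no stationary point and the first derivative test applies; otherwise |t| is so
    large that the second derivative is bounded below by a multiple of |x| / L, and |t| \<le> 1
    limits |x|.\<close>
  proof (cases "\<bar>t\<bar> * (m * L powr (m - 1)) \<le> \<bar>x\<bar> / 2")
    case True
    have "norm K \<le> 5 / (\<bar>x\<bar> / 2)"
      unfolding K_def
    proof (rule van_der_Corput_first[where \<phi>' = ?\<phi>' and \<phi>'' = ?\<phi>'' and a' = ?a'])
      fix \<xi> assume \<xi>: "\<xi> \<in> {L..2*L}"
      show "?\<phi>'' \<xi> \<ge> 0" unfolding pos'' using m t by (intro mult_nonneg_nonneg) auto
      have "\<xi> powr (m - 1) \<le> L powr (m - 1)" using \<xi> m L by (intro powr_mono2') auto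
      hence "\<bar>t\<bar> * (m * \<xi> powr (m - 1)) \<le> \<bar>t\<bar> * (m * L powr (m - 1))"
        using m by (intro mult_left_mono) auto
      hence "\<bar>t * (m * \<xi> powr (m - 1))\<bar> \<le> \<bar>x\<bar> / 2" using True m by (simp add: abs_mult)
      thus "\<bar>?\<phi>' \<xi>\<bar> \<ge> \<bar>x\<bar> / 2" by linarith
    qed (use L x d1 d2 d3 a in auto)
    thus ?thesis by simp
  next
    case False
    have tl: "\<bar>t\<bar> * (m * L powr (m - 1)) \<le> L powr (m - 1)"
    proof -
      have "\<bar>t\<bar> * m \<le> 1 * 1" using t m by (intro mult_mono) auto
      thus ?thesis using mult_right_mono[of "\<bar>t\<bar> * m" 1 "L powr (m - 1)"] by (simp add: mult.assoc)
    qed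
    \<comment> \<open>Here 8 is the factor 2 of the case distinction times 4, the most that
      \<open>\<xi> powr (m - 2)\<close> can lose between L and 2 L.\<close>
    define \<sigma> where "\<sigma> = (1 - m) * \<bar>x\<bar> / (8 * L)"
    have \<sigma>: "\<sigma> > 0" using m x L by (simp add: \<sigma>_def)
    have "norm K \<le> 12 / sqrt \<sigma>"
      unfolding K_def
    proof (rule van_der_Corput_second[where \<phi>' = ?\<phi>' and \<phi>'' = ?\<phi>'' and a' = ?a'])
      fix \<xi> assume \<xi>: "\<xi> \<in> {L..2*L}"
      have "(1/4) * L powr (m - 2) \<le> 2 powr (m - 2) * L powr (m - 2)"
      proof (rule mult_right_mono)
        have "2 powr (-2) \<le> (2::real) powr (m - 2)" using m by (intro powr_mono) auto
        thus "1/4 \<le> (2::real) powr (m - 2)" by (simp add: powr_minus)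
      qed auto
      also have "\<dots> = (2 * L) powr (m - 2)" using L by (simp add: powr_mult)
      also have "\<dots> \<le> \<xi> powr (m - 2)" using \<xi> m L by (intro powr_mono2') auto
      finally have p: "(1/4) * L powr (m - 2) \<le> \<xi> powr (m - 2)" .
      have "L powr (m - 1) = L powr (m - 2) * L"
        using L powr_add[of L "m - 2" 1] by simp
      hence "\<bar>x\<bar> / 2 \<le> (- t) * m * L powr (m - 2) * L"
        using False t by (simp add: mult_ac)
      hence x2: "\<bar>x\<bar> / (2 * L) \<le> (- t) * m * L powr (m - 2)" using L by (simp add: field_simps)
      have "\<sigma> = (1 - m) * (1/4) * (\<bar>x\<bar> / (2 * L))" by (simp add: \<sigma>_def)
      also have "\<dots> \<le> (1 - m) * (1/4) * ((- t) * m * L powr (m - 2))"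
        using x2 m by (intro mult_left_mono) auto
      also have "\<dots> = ((- t) * m * (1 - m)) * ((1/4) * L powr (m - 2))" by simp
      also have "\<dots> \<le> ((- t) * m * (1 - m)) * \<xi> powr (m - 2)"
        using p m t by (intro mult_left_mono mult_nonneg_nonneg) auto
      finally show "?\<phi>'' \<xi> \<ge> \<sigma>" unfolding pos'' .
    qed (use L \<sigma> d1 d2 d3 a in auto)
    also have "12 / sqrt \<sigma> = 12 * sqrt (8 * L / ((1 - m) * \<bar>x\<bar>))"
      by (simp add: \<sigma>_def real_sqrt_divide)
    finally show ?thesis using False tl by linarith
  qed
qed

text \<open>Complex conjugation changes the signs of x and t, which reduces t > 0 to the convex
  case.\<close>

lemma dyadic_kernel:
  fixes m x t c L :: real
  assumes m: "0 < m" "m < 1" and L: "1 \<le> L" and t: "\<bar>t\<bar> \<le> 1" and x: "x \<noteq> 0" and c: "c \<ge> 0"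
  defines "K \<equiv> integral {L..2*L} (\<lambda>\<xi>. cis (x * \<xi> + t * \<xi> powr m) * of_real (exp (- c * \<xi>\<^sup>2)))"
  shows "norm K \<le> 10 / \<bar>x\<bar> \<or> (\<bar>x\<bar> \<le> 2 * L powr (m - 1) \<and> norm K \<le> 12 * sqrt (8 * L / ((1 - m) * \<bar>x\<bar>)))"
proof (cases "t \<le> 0")
  case True
  thus ?thesis unfolding K_def using dyadic_kernel_neg[OF m L True _ x c] t by auto
next
  case False
  have "cnj K = integral {L..2*L} (\<lambda>\<xi>. cis (- x * \<xi> + (- t) * \<xi> powr m) * of_real (exp (- c * \<xi>\<^sup>2)))"
    unfolding K_def Henstock_Kurzweil_Integration.integral_cnj by (simp add: cis_cnj)
  moreover have "norm K = norm (cnj K)" by simp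
  ultimately show ?thesis using dyadic_kernel_neg[OF m L, of "- t" "- x" c] t x c False by auto
qed

lemma dyadic_kernel_trivial:
  fixes m x t c L :: real
  assumes L: "0 < L" and c: "c \<ge> 0"
  shows "norm (integral {L..2*L} (\<lambda>\<xi>. cis (x * \<xi> + t * \<xi> powr m) * of_real (exp (- c * \<xi>\<^sup>2)))) \<le> L"
proof -
  have "norm (integral {L..2*L} (\<lambda>\<xi>. cis (x * \<xi> + t * \<xi> powr m) * of_real (exp (- c * \<xi>\<^sup>2)))) \<le> 1 * (2 * L - L)"
    using L c by (intro integral_bound continuous_intros) (auto simp: norm_mult)
  thus ?thesis by simp
qed

text \<open>All frequencies below 2 are collected in the piece k = 0, where no oscillation is
  exploited; the half-open annuli make the pieces a partition of the line.\<close>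

definition annulus :: "nat \<Rightarrow> real set" where
  "annulus k = (if k = 0 then {-2<..<2} else {\<xi>. 2 ^ k \<le> \<bar>\<xi>\<bar> \<and> \<bar>\<xi>\<bar> < 2 ^ Suc k})"

text \<open>The parameter c covers the unregularised oscillation, c = 0, the regularised one, and
  the products of two regularised ones that T T* produces.\<close>

definition osc :: "real \<Rightarrow> real \<Rightarrow> real \<Rightarrow> real \<Rightarrow> real \<Rightarrow> complex" where
  "osc m x t c \<xi> = cis (x * \<xi> + t * \<bar>\<xi>\<bar> powr m) * of_real (exp (- c * \<xi>\<^sup>2))"

definition annulus_kernel :: "real \<Rightarrow> nat \<Rightarrow> real \<Rightarrow> real \<Rightarrow> real \<Rightarrow> complex" where
  "annulus_kernel m k x t c = (\<integral>\<xi>\<in>annulus k. osc m x t c \<xi> \<partial>lborel)"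

lemma annulus_measurable [measurable]: "annulus k \<in> sets borel"
  unfolding annulus_def by (cases "k = 0") simp_all

lemma annulus_subset: "annulus k \<subseteq> {- (2 ^ Suc k)..2 ^ Suc k}"
  by (auto simp: annulus_def)

lemma integrable_L2_annulus:
  assumes g: "in_L2 g" and "\<And>\<xi>. \<xi> \<notin> annulus k \<Longrightarrow> g \<xi> = 0"
  shows "integrable lborel g"
proof -
  have "g = (\<lambda>\<xi>. indicator {- (2 ^ Suc k)..2 ^ Suc k} \<xi> * g \<xi>)"
  proof
    fix \<xi>
    show "g \<xi> = indicator {- (2 ^ Suc k)..2 ^ Suc k} \<xi> * g \<xi>"
      using assms(2)[of \<xi>] subsetD[OF annulus_subset, of \<xi> k] by (cases "\<xi> \<in> annulus k") simp_all
  qed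
  thus ?thesis using integrable_L2_truncation[OF g, of "2 ^ Suc k"] by simp
qed

lemma osc_measurable [measurable]: "osc m x t c \<in> borel_measurable borel"
  unfolding osc_def[abs_def] by measurable

lemma norm_osc_le: "c \<ge> 0 \<Longrightarrow> norm (osc m x t c \<xi>) \<le> 1"
  by (simp add: osc_def norm_mult)

text \<open>\<open>\<bar>\<xi>\<bar> powr m\<close> and the Gaussian are even, so reflection turns
  the negative half into the positive half at \<open>- x\<close>. The half-open and the closed
  pieces differ only in the points \<open>2*L\<close> and \<open>- 2*L\<close>.\<close>

lemma annulus_kernel_split:
  fixes m x t c :: real
  assumes k: "k \<noteq> 0"
  defines "L \<equiv> 2 ^ k"
  defines "f \<equiv> (\<lambda>x \<xi>. cis (x * \<xi> + t * \<xi> powr m) * of_real (exp (- c * \<xi>\<^sup>2)))"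
  shows "annulus_kernel m k x t c = integral {L..2*L} (f x) + integral {L..2*L} (f (- x))"
proof -
  have L: "L > 0" by (simp add: L_def)
  have f_cont: "continuous_on {L..2*L} (f x)" for x
    using L unfolding f_def by (intro continuous_intros) auto
  have si: "set_integrable lborel {L..2*L} (f x)" for x
    by (intro borel_integrable_atLeastAtMost' f_cont)
  have i2: "integrable lborel (\<lambda>\<xi>. indicator {L..2*L} (- \<xi>) *\<^sub>R f (- x) (- \<xi>))"
    using lborel_integrable_real_affine_iff[of "-1" "\<lambda>\<xi>. indicator {L..2*L} \<xi> *\<^sub>R f (- x) \<xi>" 0] si[of "- x"]
    by (simp add: set_integrable_def)
  have "annulus_kernel m k x t c =
     (\<integral>\<xi>. indicator {L..2*L} \<xi> *\<^sub>R f x \<xi> + indicator {L..2*L} (- \<xi>) *\<^sub>R f (- x) (- \<xi>) \<partial>lborel)"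
    unfolding annulus_kernel_def set_lebesgue_integral_def
  proof (rule integral_cong_AE)
    show "(\<lambda>\<xi>. indicat_real {L..2*L} \<xi> *\<^sub>R f x \<xi> + indicat_real {L..2*L} (- \<xi>) *\<^sub>R f (- x) (- \<xi>)) \<in> borel_measurable lborel"
      unfolding f_def by measurable
    have "AE \<xi> in lborel. \<xi> \<notin> {2*L, - 2*L}"
      by (intro AE_not_in finite_imp_null_set_lborel) auto
    thus "AE \<xi> in lborel. indicat_real (annulus k) \<xi> *\<^sub>R osc m x t c \<xi> =
        indicat_real {L..2*L} \<xi> *\<^sub>R f x \<xi> + indicat_real {L..2*L} (- \<xi>) *\<^sub>R f (- x) (- \<xi>)"
    proof eventually_elim
      case (elim \<xi>)
      have "\<xi> \<in> annulus k \<longleftrightarrow> (\<xi> \<in> {L..2*L} \<or> - \<xi> \<in> {L..2*L})"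
        using elim k L by (auto simp: annulus_def L_def abs_if split: if_splits)
      moreover have "\<not> (\<xi> \<in> {L..2*L} \<and> - \<xi> \<in> {L..2*L})" using L by auto
      moreover have "osc m x t c \<xi> = f x \<xi>" if "\<xi> \<in> {L..2*L}" using that L by (simp add: osc_def f_def)
      moreover have "osc m x t c \<xi> = f (- x) (- \<xi>)" if "- \<xi> \<in> {L..2*L}" using that L by (simp add: osc_def f_def add.commute)
      ultimately show ?case by (auto split: split_indicator)
    qed
  qed measurable
  also have "\<dots> = (\<integral>\<xi>. indicator {L..2*L} \<xi> *\<^sub>R f x \<xi> \<partial>lborel) + (\<integral>\<xi>. indicator {L..2*L} (- \<xi>) *\<^sub>R f (- x) (- \<xi>) \<partial>lborel)"
    using si[of x] i2 by (intro Bochner_Integration.integral_add) (auto simp: set_integrable_def)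
  also have "(\<integral>\<xi>. indicator {L..2*L} (- \<xi>) *\<^sub>R f (- x) (- \<xi>) \<partial>lborel) = (\<integral>\<xi>. indicator {L..2*L} \<xi> *\<^sub>R f (- x) \<xi> \<partial>lborel)"
    using lborel_integral_real_affine[of "-1" "\<lambda>\<xi>. indicator {L..2*L} \<xi> *\<^sub>R f (- x) \<xi>" 0] by simp
  finally show ?thesis
    using set_borel_integral_eq_integral(2)[OF si, of x] set_borel_integral_eq_integral(2)[OF si, of "- x"]
    by (simp add: set_lebesgue_integral_def)
qed

text \<open>Once |x| powr (-\<alpha>) is split off, what remains is a power of L times a power of
  |x|, monotone in |x|, so one end of the range of |x| decides. The end 1/L leads to
  \<open>s1\<close>, the end 2 * L powr (m - 1) to \<open>s2\<close>; both are the hypotheses on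
  \<open>\<sigma>\<close> multiplied by q.\<close>

lemma half_kernel_power_bound:
  fixes m \<alpha> q :: real
  assumes m: "0 < m" "m < 1" and \<alpha>: "0 < \<alpha>" "\<alpha> \<le> 1" and q: "2 \<le> q"
    and \<sigma>: "1/2 - m/4 - (1 - m) * \<alpha> / q \<le> \<sigma>" "1/2 - \<alpha> / q \<le> \<sigma>"
  obtains C where "C \<ge> 1" "\<And>L x t c. 1 \<le> L \<Longrightarrow> \<bar>x\<bar> \<le> 1 \<Longrightarrow> \<bar>t\<bar> \<le> 1 \<Longrightarrow> 0 \<le> c \<Longrightarrow>
    norm (integral {L..2*L} (\<lambda>\<xi>. cis (x * \<xi> + t * \<xi> powr m) * of_real (exp (- c * \<xi>\<^sup>2)))) powr (q/2)
    \<le> C * (L powr (\<sigma> * q) * (if \<bar>x\<bar> \<le> 1 / L then L powr \<alpha> else \<bar>x\<bar> powr (- \<alpha>)))"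
proof
  define D where "D = 12 * sqrt (8 / (1 - m))"
  define C where "C = 1 + 10 powr (q/2) + 2 * D powr (q/2)"
  have q0: "q > 0" using q by simp
  have s1: "q / 2 - \<alpha> \<le> \<sigma> * q"
    using mult_right_mono[OF \<sigma>(2), of q] q0 by (simp add: algebra_simps)
  have s2: "q / 2 - m * q / 4 - (1 - m) * \<alpha> \<le> \<sigma> * q"
  proof -
    have "(1/2 - m/4 - X) * q = q / 2 - m * q / 4 - X * q" for X by (simp add: algebra_simps)
    hence "(1/2 - m/4 - (1 - m) * \<alpha> / q) * q = q / 2 - m * q / 4 - ((1 - m) * \<alpha> / q) * q" .
    also have "((1 - m) * \<alpha> / q) * q = (1 - m) * \<alpha>" using q0 by simp
    finally have "(1/2 - m/4 - (1 - m) * \<alpha> / q) * q = q / 2 - m * q / 4 - (1 - m) * \<alpha>" .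
    thus ?thesis using mult_right_mono[OF \<sigma>(1), of q] q0 by simp
  qed
  have D0: "D \<ge> 0" using m by (simp add: D_def)
  show "C \<ge> 1" by (simp add: C_def)
  fix L x t c :: real assume L: "1 \<le> L" and x: "\<bar>x\<bar> \<le> 1" and t: "\<bar>t\<bar> \<le> 1" and c: "0 \<le> c"
  define N where "N = norm (integral {L..2*L} (\<lambda>\<xi>. cis (x * \<xi> + t * \<xi> powr m) * of_real (exp (- c * \<xi>\<^sup>2))))"
  have N0: "N \<ge> 0" by (simp add: N_def)
  define E where "E = L powr (\<sigma> * q) * (if \<bar>x\<bar> \<le> 1 / L then L powr \<alpha> else \<bar>x\<bar> powr (- \<alpha>))"
  have E0: "E \<ge> 0" by (simp add: E_def)
  have "N powr (q/2) \<le> C * E"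
  proof (cases "\<bar>x\<bar> \<le> 1 / L")
    case True
    have "N \<le> L" unfolding N_def using L c by (intro dyadic_kernel_trivial) auto
    hence "N powr (q/2) \<le> L powr (q/2)" using N0 q by (intro powr_mono2) auto
    also have "\<dots> \<le> L powr (\<sigma> * q + \<alpha>)" using L s1 by (intro powr_mono) auto
    also have "\<dots> = 1 * E" using True by (simp add: E_def powr_add)
    also have "\<dots> \<le> C * E" using E0 by (intro mult_right_mono) (auto simp: C_def)
    finally show ?thesis .
  next
    case False
    hence x0: "x \<noteq> 0" and xL: "1 / L < \<bar>x\<bar>" using L by auto
    have E: "E = L powr (\<sigma> * q) * \<bar>x\<bar> powr (- \<alpha>)" using False by (simp add: E_def)
    consider (1) "N \<le> 10 / \<bar>x\<bar>" | (2) "\<bar>x\<bar> \<le> 2 * L powr (m - 1)" "N \<le> 12 * sqrt (8 * L / ((1 - m) * \<bar>x\<bar>))"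
      using dyadic_kernel[OF m L t x0 c] unfolding N_def by blast
    thus ?thesis
    proof cases
      case 1
      have "N powr (q/2) \<le> (10 / \<bar>x\<bar>) powr (q/2)" using N0 q 1 by (intro powr_mono2) auto
      also have "\<dots> = 10 powr (q/2) * (\<bar>x\<bar> powr (\<alpha> - q/2) * \<bar>x\<bar> powr (- \<alpha>))"
      proof -
        have "\<bar>x\<bar> powr (\<alpha> - q/2) * \<bar>x\<bar> powr (- \<alpha>) = \<bar>x\<bar> powr (- (q/2))"
          by (simp add: powr_add[symmetric])
        thus ?thesis using x0 by (simp only: powr_minus_divide powr_divide) simp
      qed
      also have "\<dots> \<le> 10 powr (q/2) * (L powr (\<sigma> * q) * \<bar>x\<bar> powr (- \<alpha>))"
      proof (intro mult_left_mono mult_right_mono)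
        \<comment> \<open>\<alpha> \<le> 1 \<le> q/2 makes the exponent nonpositive, so the smallest
          |x| is the worst.\<close>
        have "\<bar>x\<bar> powr (\<alpha> - q/2) \<le> (1 / L) powr (\<alpha> - q/2)"
          using xL L \<alpha> q by (intro powr_mono2') auto
        also have "\<dots> = L powr (q/2 - \<alpha>)"
          using L by (simp add: powr_divide powr_minus_divide[symmetric])
        also have "\<dots> \<le> L powr (\<sigma> * q)" using L s1 by (intro powr_mono) auto
        finally show "\<bar>x\<bar> powr (\<alpha> - q/2) \<le> L powr (\<sigma> * q)" .
      qed auto
      also have "\<dots> = 10 powr (q/2) * E" by (simp add: E)
      also have "\<dots> \<le> C * E" using E0 by (intro mult_right_mono) (auto simp: C_def)
      finally show ?thesis .
    next
      case 2
      have N2: "N \<le> D * sqrt (L / \<bar>x\<bar>)"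
      proof -
        have "8 * L / ((1 - m) * \<bar>x\<bar>) = (8 / (1 - m)) * (L / \<bar>x\<bar>)" by simp
        thus ?thesis using 2(2) by (simp only: D_def real_sqrt_mult mult.assoc)
      qed
      have "N powr (q/2) \<le> (D * sqrt (L / \<bar>x\<bar>)) powr (q/2)" using N0 q N2 by (intro powr_mono2) auto
      also have "\<dots> = D powr (q/2) * (L / \<bar>x\<bar>) powr (q/4)"
        using D0 L by (simp add: powr_mult powr_half_sqrt[symmetric] powr_powr)
      also have "(L / \<bar>x\<bar>) powr (q/4) = L powr (q/4) * \<bar>x\<bar> powr (\<alpha> - q/4) * \<bar>x\<bar> powr (- \<alpha>)"
      proof -
        have "\<bar>x\<bar> powr (\<alpha> - q/4) * \<bar>x\<bar> powr (- \<alpha>) = \<bar>x\<bar> powr (- (q/4))"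
          by (simp add: powr_add[symmetric])
        thus ?thesis using x0 L by (simp only: powr_minus_divide powr_divide mult.assoc) simp
      qed
      also have "D powr (q/2) * \<dots> \<le> D powr (q/2) * (2 * L powr (\<sigma> * q) * \<bar>x\<bar> powr (- \<alpha>))"
      proof (intro mult_left_mono mult_right_mono)
        show "L powr (q/4) * \<bar>x\<bar> powr (\<alpha> - q/4) \<le> 2 * L powr (\<sigma> * q)"
        \<comment> \<open>The sign of \<alpha> - q/4 decides which end of 1/L < |x| \<le> 2 * L powr
          (m - 1) is the worst.\<close>
        proof (cases "\<alpha> \<le> q / 4")
          case True
          have "\<bar>x\<bar> powr (\<alpha> - q/4) \<le> (1 / L) powr (\<alpha> - q/4)"
            using xL L True by (intro powr_mono2') auto
          also have "\<dots> = L powr (q/4 - \<alpha>)"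
            using L by (simp add: powr_divide powr_minus_divide[symmetric])
          finally have "L powr (q/4) * \<bar>x\<bar> powr (\<alpha> - q/4) \<le> L powr (q/4) * L powr (q/4 - \<alpha>)"
            by (intro mult_left_mono) auto
          also have "\<dots> = L powr (q/2 - \<alpha>)" by (simp add: powr_add[symmetric])
          also have "\<dots> \<le> L powr (\<sigma> * q)" using L s1 by (intro powr_mono) auto
          also have "\<dots> \<le> 2 * L powr (\<sigma> * q)" by simp
          finally show ?thesis .
        next
          case False
          have "\<bar>x\<bar> powr (\<alpha> - q/4) \<le> (2 * L powr (m - 1)) powr (\<alpha> - q/4)"
            using 2(1) False by (intro powr_mono2) auto
          also have "\<dots> = 2 powr (\<alpha> - q/4) * L powr ((m - 1) * (\<alpha> - q/4))"
            by (simp add: powr_mult powr_powr)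
          also have "\<dots> \<le> 2 * L powr ((m - 1) * (\<alpha> - q/4))"
          proof (rule mult_right_mono)
            have "2 powr (\<alpha> - q/4) \<le> (2::real) powr 1" using \<alpha> q by (intro powr_mono) auto
            thus "2 powr (\<alpha> - q/4) \<le> (2::real)" by simp
          qed auto
          finally have "L powr (q/4) * \<bar>x\<bar> powr (\<alpha> - q/4) \<le> L powr (q/4) * (2 * L powr ((m - 1) * (\<alpha> - q/4)))"
            by (intro mult_left_mono) auto
          also have "\<dots> = 2 * L powr (q/4 + (m - 1) * (\<alpha> - q/4))" by (simp add: powr_add)
          also have "q/4 + (m - 1) * (\<alpha> - q/4) = q / 2 - m * q / 4 - (1 - m) * \<alpha>"
            by (simp add: field_simps)
          also have "2 * L powr \<dots> \<le> 2 * L powr (\<sigma> * q)"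
            using L s2 by (intro mult_left_mono powr_mono) auto
          finally show ?thesis .
        qed
      qed auto
      also have "\<dots> = (2 * D powr (q/2)) * E" by (simp add: E)
      also have "\<dots> \<le> C * E" using E0 by (intro mult_right_mono) (auto simp: C_def)
      finally show ?thesis .
    qed
  qed
  thus "norm (integral {L..2*L} (\<lambda>\<xi>. cis (x * \<xi> + t * \<xi> powr m) * of_real (exp (- c * \<xi>\<^sup>2)))) powr (q/2)
    \<le> C * (L powr (\<sigma> * q) * (if \<bar>x\<bar> \<le> 1 / L then L powr \<alpha> else \<bar>x\<bar> powr (- \<alpha>)))"
    unfolding N_def E_def .
qed

text \<open>The Riesz kernel \<open>\<bar>x\<bar> powr (- \<alpha>)\<close> truncated at height \<open>2 powr (k \<alpha>)\<close>: against an \<open>\<alpha>\<close>-dimensional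
  measure each of the \<open>k\<close> dyadic shells contributes a bounded amount.\<close>

definition trunc_riesz :: "real \<Rightarrow> nat \<Rightarrow> real \<Rightarrow> real" where
  "trunc_riesz \<alpha> k x = (if \<bar>x\<bar> \<le> 1 / 2 ^ k then (2 ^ k) powr \<alpha> else \<bar>x\<bar> powr (- \<alpha>))"

lemma trunc_riesz_nonneg [simp]: "0 \<le> trunc_riesz \<alpha> k x"
  by (simp add: trunc_riesz_def)

lemma trunc_riesz_measurable [measurable]: "trunc_riesz \<alpha> k \<in> borel_measurable borel"
  unfolding trunc_riesz_def[abs_def] by measurable

lemma trunc_riesz_minus: "trunc_riesz \<alpha> k (- x) = trunc_riesz \<alpha> k x"
  by (simp add: trunc_riesz_def)

lemma annulus_kernel_power_bound:
  fixes m \<alpha> q :: real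
  assumes m: "0 < m" "m < 1" and \<alpha>: "0 < \<alpha>" "\<alpha> \<le> 1" and q: "2 \<le> q"
    and \<sigma>: "1/2 - m/4 - (1 - m) * \<alpha> / q \<le> \<sigma>" "1/2 - \<alpha> / q \<le> \<sigma>"
  obtains C where "C \<ge> 0" "\<And>k x t c. \<bar>x\<bar> \<le> 1 \<Longrightarrow> \<bar>t\<bar> \<le> 1 \<Longrightarrow> 0 \<le> c \<Longrightarrow>
    norm (annulus_kernel m k x t c) powr (q/2) \<le> C * ((2^k) powr (\<sigma> * q) * trunc_riesz \<alpha> k x)"
proof -
  obtain C1 where C1: "C1 \<ge> 1" "\<And>L x t c. 1 \<le> L \<Longrightarrow> \<bar>x\<bar> \<le> 1 \<Longrightarrow> \<bar>t\<bar> \<le> 1 \<Longrightarrow> 0 \<le> c \<Longrightarrow>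
    norm (integral {L..2*L} (\<lambda>\<xi>. cis (x * \<xi> + t * \<xi> powr m) * of_real (exp (- c * \<xi>\<^sup>2)))) powr (q/2)
    \<le> C1 * (L powr (\<sigma> * q) * (if \<bar>x\<bar> \<le> 1 / L then L powr \<alpha> else \<bar>x\<bar> powr (- \<alpha>)))"
    by (rule half_kernel_power_bound[OF assms]) blast
  define C where "C = 4 powr (q/2) + 2 powr (q/2) * C1"
  have "norm (annulus_kernel m k x t c) powr (q/2) \<le> C * ((2^k) powr (\<sigma> * q) * trunc_riesz \<alpha> k x)"
    if x: "\<bar>x\<bar> \<le> 1" and t: "\<bar>t\<bar> \<le> 1" and c: "0 \<le> c" for k x t c
  proof (cases "k = 0")
    case True
    \<comment> \<open>For k = 0 the length 4 of the interval is a sufficient bound, because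
      \<open>trunc_riesz \<alpha> 0 x\<close> is 1 for |x| \<le> 1.\<close>
    have "norm (annulus_kernel m k x t c) \<le> integral\<^sup>L lborel (indicat_real {-2<..<2::real})"
      unfolding annulus_kernel_def set_lebesgue_integral_def
    proof (rule Bochner_Integration.integral_norm_bound_integral)
      show "integrable lborel (\<lambda>\<xi>. indicat_real (annulus k) \<xi> *\<^sub>R osc m x t c \<xi>)"
      proof (rule Bochner_Integration.integrable_bound)
        show "integrable lborel (\<lambda>\<xi>. indicat_real {-2<..<2::real} \<xi>)" by (intro integrable_real_indicator) (auto simp: emeasure_lborel_Ioo)
        show "AE \<xi> in lborel. norm (indicat_real (annulus k) \<xi> *\<^sub>R osc m x t c \<xi>) \<le> norm (indicat_real {-2<..<2::real} \<xi>)"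
          using norm_osc_le[OF c] True by (intro AE_I2) (auto simp: annulus_def split: split_indicator)
      qed measurable
      show "integrable lborel (indicat_real {-2<..<2::real})" by (intro integrable_real_indicator) (auto simp: emeasure_lborel_Ioo)
      show "norm (indicat_real (annulus k) \<xi> *\<^sub>R osc m x t c \<xi>) \<le> indicat_real {-2<..<2::real} \<xi>" for \<xi>
        using norm_osc_le[OF c] True by (auto simp: annulus_def split: split_indicator)
    qed
    also have "\<dots> = 4" by simp
    finally have "norm (annulus_kernel m k x t c) powr (q/2) \<le> 4 powr (q/2)" using q by (intro powr_mono2) auto
    also have "\<dots> \<le> C * 1" using C1(1) by (simp add: C_def)
    also have "\<dots> = C * ((2^k) powr (\<sigma> * q) * trunc_riesz \<alpha> k x)" using True x by (simp add: trunc_riesz_def)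
    finally show ?thesis .
  next
    case False
    define E where "E = (2^k) powr (\<sigma> * q) * trunc_riesz \<alpha> k x"
    define I where "I = (\<lambda>x. integral {2^k..2*2^k} (\<lambda>\<xi>. cis (x * \<xi> + t * \<xi> powr m) * of_real (exp (- c * \<xi>\<^sup>2))))"
    \<comment> \<open>The power q/2 is undone before the two halves are added by the triangle
      inequality, and restored afterwards.\<close>
    define M where "M = (C1 * E) powr (2/q)"
    have CE: "C1 * E \<ge> 0" using C1(1) by (simp add: E_def)
    have I: "norm (I y) \<le> M" if "\<bar>y\<bar> = \<bar>x\<bar>" for y
    proof -
      have "norm (I y) powr (q/2) \<le> C1 * E"
        using C1(2)[of "2^k" y t c] x t c unfolding that I_def E_def trunc_riesz_def by simp
      hence "(norm (I y) powr (q/2)) powr (2/q) \<le> M" unfolding M_def using q by (intro powr_mono2) auto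
      thus ?thesis using q by (simp add: powr_powr)
    qed
    have "norm (annulus_kernel m k x t c) \<le> norm (I x) + norm (I (- x))"
      unfolding annulus_kernel_split[OF False] I_def by (rule norm_triangle_ineq)
    also have "\<dots> \<le> 2 * M" using I[of x] I[of "- x"] by simp
    finally have "norm (annulus_kernel m k x t c) powr (q/2) \<le> (2 * M) powr (q/2)" using q by (intro powr_mono2) auto
    also have "\<dots> = 2 powr (q/2) * (C1 * E)"
    proof -
      have "(z powr (2/q)) powr (q/2) = z" if "z \<ge> 0" for z :: real
        using q that by (simp add: powr_powr)
      thus ?thesis using CE powr_mult[of 2 "(C1 * E) powr (2/q)" "q/2"] by (simp only: M_def)
    qed
    also have "\<dots> \<le> C * E" unfolding C_def by (simp add: distrib_right E_def)
    finally show ?thesis unfolding E_def .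
  qed
  moreover have "C \<ge> 0" using C1(1) by (simp add: C_def)
  ultimately show ?thesis using that by blast
qed

section \<open>The maximal estimate\<close>

lemma borel_measurable_cnj [measurable (raw)]:
  "f \<in> borel_measurable M \<Longrightarrow> (\<lambda>x. cnj (f x)) \<in> borel_measurable M"
  by (rule measurable_compose[OF _ borel_measurable_continuous_onI]) (auto intro: continuous_intros)

lemma integral_Cauchy_Schwarz:
  fixes f g :: "real \<Rightarrow> complex"
  assumes [measurable]: "f \<in> borel_measurable M" "g \<in> borel_measurable M"
    and f: "integrable M (\<lambda>x. (norm (f x))\<^sup>2)" and g: "integrable M (\<lambda>x. (norm (g x))\<^sup>2)"
  shows "(norm (\<integral>x. f x * g x \<partial>M))\<^sup>2 \<le> (\<integral>x. (norm (f x))\<^sup>2 \<partial>M) * (\<integral>x. (norm (g x))\<^sup>2 \<partial>M)"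
proof -
  define a where "a = (\<integral>x. (norm (f x))\<^sup>2 \<partial>M)"
  define b where "b = (\<integral>x. (norm (g x))\<^sup>2 \<partial>M)"
  define X where "X = norm (\<integral>x. f x * g x \<partial>M)"
  have ab: "a \<ge> 0" "b \<ge> 0" "X \<ge> 0" by (auto simp: a_def b_def X_def)
  \<comment> \<open>AM-GM with a free weight s; after integration the choice s = X / a is optimal,
    and for a = 0 a large s is contradictory unless X = 0.\<close>
  have pt: "norm (f x * g x) \<le> (s * (norm (f x))\<^sup>2 + (norm (g x))\<^sup>2 / s) / 2" if "s > 0" for s x
  proof -
    let ?u = "norm (f x)" and ?v = "norm (g x)"
    have "0 \<le> (s * ?u - ?v)\<^sup>2 / s" using that by simp
    also have "\<dots> = s * ?u\<^sup>2 - 2 * (?u * ?v) + ?v\<^sup>2 / s"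
      using that by (simp add: power2_eq_square field_simps)
    finally show ?thesis by (simp add: norm_mult)
  qed
  have int: "integrable M (\<lambda>x. (s * (norm (f x))\<^sup>2 + (norm (g x))\<^sup>2 / s) / 2)" for s
    using f g by auto
  have fg: "integrable M (\<lambda>x. f x * g x)"
    by (rule Bochner_Integration.integrable_bound[OF int[of 1]]) (use pt[of 1] in \<open>auto intro: order_trans[OF _ abs_ge_self]\<close>)
  have main: "2 * X * s \<le> s\<^sup>2 * a + b" if "s > 0" for s
  proof -
    have "X \<le> (\<integral>x. (s * (norm (f x))\<^sup>2 + (norm (g x))\<^sup>2 / s) / 2 \<partial>M)"
      unfolding X_def using pt[OF that] by (intro Bochner_Integration.integral_norm_bound_integral fg int) auto
    also have "\<dots> = (s * a + b / s) / 2" using f g by (simp add: a_def b_def)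
    finally show ?thesis using that by (simp add: field_simps power2_eq_square)
  qed
  have "X\<^sup>2 \<le> a * b"
  proof (cases "X = 0")
    case False
    hence X: "X > 0" using ab by simp
    show ?thesis
    proof (cases "a = 0")
      case True
      from main[of "(b + 1) / X"] show ?thesis using X ab True by simp
    next
      case False
      hence a: "a > 0" using ab by simp
      from main[of "X / a"] have "2 * (X\<^sup>2 / a) \<le> X\<^sup>2 / a + b" using X a by (simp add: power2_eq_square)
      thus ?thesis using a by (simp add: field_simps)
    qed
  qed (use ab in auto)
  thus ?thesis by (simp add: X_def a_def b_def)
qed

text \<open>A weighted AM-GM inequality, normalised so that with \<open>X = \<integral> u powr q\<close> and \<open>\<integral> \<kappa> \<le> \<beta>\<close> the bracket has
  double integral at most \<open>1\<close>.\<close>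

lemma kernel_Young_pointwise:
  fixes u v \<kappa> q X \<beta> :: real
  assumes "0 \<le> u" "0 \<le> v" "0 \<le> k" "k powr (q/2) \<le> \<kappa>" "2 \<le> q" "0 < X" "0 < \<beta>"
  shows "u powr (q - 1) * v powr (q - 1) * k \<le> \<beta> powr (2/q) * X powr (2 - 2/q) *
    ((u powr q * \<kappa> + v powr q * \<kappa>) / (q * \<beta> * X) + (1 - 2/q) * (u powr q * v powr q) / X\<^sup>2)"
proof (cases "u = 0 \<or> v = 0 \<or> k = 0")
  case True
  have "0 \<le> \<kappa>" using assms(4) by (rule order_trans[rotated]) simp
  hence "0 \<le> \<beta> powr (2/q) * X powr (2 - 2/q) *
    ((u powr q * \<kappa> + v powr q * \<kappa>) / (q * \<beta> * X) + (1 - 2/q) * (u powr q * v powr q) / X\<^sup>2)"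
    using assms by (intro mult_nonneg_nonneg add_nonneg_nonneg divide_nonneg_nonneg) auto
  thus ?thesis using True assms(5) by auto
next
  case False
  hence pos: "u > 0" "v > 0" "k > 0" using assms by auto
  define Z where "Z = \<beta> powr (2/q) * X powr (2 - 2/q)"
  have Z: "Z > 0" using assms by (simp add: Z_def)
  \<comment> \<open>\<open>P\<close> carries the kernel and \<open>R\<close> is the rest without
    kernel; the left side is \<open>Z\<close> times their weighted geometric mean with weights 2/q
    and 1 - 2/q, both nonnegative because q \<ge> 2.\<close>
  define P where "P = (u * v) powr (q/2) * k powr (q/2) / (\<beta> * X)"
  define R where "R = (u * v) powr q / X\<^sup>2"
  have PR: "P > 0" "R > 0" using pos assms by (auto simp: P_def R_def)
  have q: "q > 0" using assms by simp
  have "P powr (2/q) = (u * v) * k / (\<beta> powr (2/q) * X powr (2/q))"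
    using pos q assms by (simp add: P_def powr_divide powr_mult powr_powr)
  moreover have "R powr (1 - 2/q) = (u * v) powr (q - 2) / X powr (2 - 4/q)"
  proof -
    have "(X powr 2) powr (1 - 2/q) = X powr (2 * (1 - 2/q))" by (rule powr_powr)
    hence "X\<^sup>2 powr (1 - 2/q) = X powr (2 - 4/q)" using assms by simp
    moreover have "q * (1 - 2/q) = q - 2" using q by (auto simp: field_simps)
    ultimately show ?thesis using pos assms by (simp add: R_def powr_divide powr_powr)
  qed
  ultimately have "P powr (2/q) * R powr (1 - 2/q) = ((u * v) * (u * v) powr (q - 2)) * k / (\<beta> powr (2/q) * (X powr (2/q) * X powr (2 - 4/q)))"
    by (simp add: mult_ac)
  also have "(u * v) * (u * v) powr (q - 2) = (u * v) powr (q - 1)"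
    using pos powr_add[of "u * v" 1 "q - 2"] by simp
  also have "X powr (2/q) * X powr (2 - 4/q) = X powr (2 - 2/q)"
    by (simp add: powr_add[symmetric])
  finally have eq: "u powr (q - 1) * v powr (q - 1) * k = Z * (P powr (2/q) * R powr (1 - 2/q))"
    using Z pos assms(6,7) by (simp add: Z_def powr_mult)
  have "P powr (2/q) * R powr (1 - 2/q) \<le> (2/q) * P + (1 - 2/q) * R"
    using assms PR by (intro Youngs_inequality_0) auto
  also have "(2/q) * P \<le> (u powr q * \<kappa> + v powr q * \<kappa>) / (q * \<beta> * X)"
  proof -
    \<comment> \<open>Splitting the product leaves only one of u and v beside \<kappa>, so that in
      the double integral the other variable meets \<kappa> alone and costs at most \<beta>.\<close>
    have "2 * (u powr (q/2) * v powr (q/2)) \<le> (u powr (q/2))\<^sup>2 + (v powr (q/2))\<^sup>2"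
      using sum_squares_bound by (simp add: mult.assoc)
    also have "\<dots> = u powr q + v powr q" by (simp add: power2_eq_square powr_add[symmetric])
    finally have "2 * (u * v) powr (q/2) \<le> u powr q + v powr q" using pos by (simp add: powr_mult)
    hence "2 * (u * v) powr (q/2) * k powr (q/2) \<le> (u powr q + v powr q) * \<kappa>"
      using assms(4) by (intro mult_mono) auto
    hence "(2 * (u * v) powr (q/2) * k powr (q/2)) / (q * \<beta> * X) \<le> ((u powr q + v powr q) * \<kappa>) / (q * \<beta> * X)"
      using q assms by (intro divide_right_mono) auto
    thus ?thesis by (simp add: P_def distrib_right distrib_left mult_ac)
  qed
  finally have "P powr (2/q) * R powr (1 - 2/q) \<le> (u powr q * \<kappa> + v powr q * \<kappa>) / (q * \<beta> * X) + (1 - 2/q) * R"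
    by simp
  moreover have "(1 - 2/q) * R = (1 - 2/q) * (u powr q * v powr q) / X\<^sup>2" using pos by (simp add: R_def powr_mult)
  ultimately show ?thesis unfolding eq Z_def[symmetric] using Z by (intro mult_left_mono) linarith+
qed

text \<open>Duality: pairing \<open>A\<close> with \<open>w\<close> gives X, and moving the operator
  onto \<open>w\<close> gives \<open>X\<^sup>2 \<le> G * V\<close>, where V is the squared norm of
  the adjoint applied to \<open>w\<close>, a double integral against the kernel. Young's inequality
  bounds V by \<open>\<beta> powr (2/q) * X powr (2 - 2/q)\<close>, and the powers of X cancel
  because X is positive and finite.\<close>

lemma TTstar_bound:
  fixes \<mu> :: "real measure" and e :: "real \<Rightarrow> real \<Rightarrow> complex" and g :: "real \<Rightarrow> complex" and \<kappa> :: "real \<Rightarrow> real \<Rightarrow> real"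
  assumes \<mu>: "finite_measure \<mu>" and sets: "sets \<mu> = sets borel"
    and e[measurable]: "(\<lambda>(x, \<xi>). e x \<xi>) \<in> borel_measurable (borel \<Otimes>\<^sub>M borel)"
    and e1: "\<And>x \<xi>. norm (e x \<xi>) \<le> 1"
    and J[measurable]: "J \<in> sets borel" and Jfin: "emeasure lborel J < \<infinity>"
    and g: "in_L2 g" and gJ: "\<And>\<xi>. \<xi> \<notin> J \<Longrightarrow> g \<xi> = 0"
    and \<kappa>[measurable]: "(\<lambda>(x, y). \<kappa> x y) \<in> borel_measurable (borel \<Otimes>\<^sub>M borel)"
    and \<kappa>_sym: "\<And>x y. \<kappa> x y = \<kappa> y x"
    and kernel: "\<And>x y. norm (\<integral>\<xi>\<in>J. e x \<xi> * cnj (e y \<xi>) \<partial>lborel) powr (q/2) \<le> \<kappa> x y"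
    and \<beta>: "0 < \<beta>" "\<And>x. (\<integral>\<^sup>+y. ennreal (\<kappa> x y) \<partial>\<mu>) \<le> ennreal \<beta>"
    and q: "2 \<le> q"
  shows "(\<integral>\<^sup>+x. ennreal (norm (\<integral>\<xi>. e x \<xi> * g \<xi> \<partial>lborel) powr q) \<partial>\<mu>)
     \<le> ennreal (\<beta> * (\<integral>\<xi>. (norm (g \<xi>))\<^sup>2 \<partial>lborel) powr (q/2))"
proof -
  interpret finite_measure \<mu> by fact
  have sf: "sigma_finite_measure \<mu>" by unfold_locales
  interpret PS: pair_sigma_finite \<mu> \<mu> by unfold_locales
  note [measurable_cong] = sets
  have [measurable]: "g \<in> borel_measurable borel" using g by (simp add: in_L2_def)
  have g2: "integrable lborel (\<lambda>\<xi>. (norm (g \<xi>))\<^sup>2)" using g by (simp add: in_L2_def)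
  have indJ: "integrable lborel (\<lambda>\<xi>. indicator J \<xi> :: complex)"
    using Jfin integrable_of_real[of lborel "indicat_real J"] by (simp add: integrable_real_indicator of_real_indicator)
  have gi: "integrable lborel g"
  proof (rule Bochner_Integration.integrable_bound)
    show "integrable lborel (\<lambda>\<xi>. indicat_real J \<xi> + (norm (g \<xi>))\<^sup>2)"
      using g2 Jfin by (intro Bochner_Integration.integrable_add integrable_real_indicator) auto
    show "AE \<xi> in lborel. norm (g \<xi>) \<le> norm (indicat_real J \<xi> + (norm (g \<xi>))\<^sup>2)"
    proof (rule AE_I2)
      fix \<xi>
      have "0 \<le> (norm (g \<xi>) - 1)\<^sup>2" by simp
      hence "2 * norm (g \<xi>) \<le> 1 + (norm (g \<xi>))\<^sup>2" by (simp add: power2_eq_square algebra_simps)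
      moreover have "norm (g \<xi>) \<ge> 0" by simp
      ultimately have "norm (g \<xi>) \<le> 1 + (norm (g \<xi>))\<^sup>2" by linarith
      thus "norm (g \<xi>) \<le> norm (indicat_real J \<xi> + (norm (g \<xi>))\<^sup>2)"
        using gJ[of \<xi>] by (cases "\<xi> \<in> J") auto
    qed
  qed auto
  define A where "A = (\<lambda>x. \<integral>\<xi>. e x \<xi> * g \<xi> \<partial>lborel)"
  define B where "B = (\<integral>\<xi>. norm (g \<xi>) \<partial>lborel)"
  have [measurable]: "A \<in> borel_measurable borel"
    unfolding A_def by (rule lborel.borel_measurable_lebesgue_integral) measurable
  have AB: "norm (A x) \<le> B" for x
  proof -
    have [measurable]: "e x \<in> borel_measurable borel" by measurable
    have "norm (e x \<xi> * g \<xi>) \<le> norm (g \<xi>)" for \<xi> using e1[of x \<xi>] by (simp add: norm_mult mult_left_le_one_le)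
    thus ?thesis unfolding A_def B_def using gi integrable_bounded_mult[OF gi, of "e x" 1] e1
      by (intro Bochner_Integration.integral_norm_bound_integral) auto
  qed
  define M where "M = (\<lambda>x. norm (A x))"
  have [measurable]: "M \<in> borel_measurable borel" unfolding M_def by measurable
  have M0: "M x \<ge> 0" and MB: "M x \<le> B" for x using AB by (auto simp: M_def)
  \<comment> \<open>The extremal dual function: \<open>w x * A x\<close> is the modulus of
    \<open>A x\<close> to the power q, and the modulus of \<open>w x\<close> is that of
    \<open>A x\<close> to the power q - 1.\<close>
  define w where "w = (\<lambda>x. of_real (M x powr (q - 2)) * cnj (A x))"
  have [measurable]: "w \<in> borel_measurable borel" unfolding w_def by measurable
  have wM: "norm (w x) = M x powr (q - 1)" for x
  proof (cases "M x = 0")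
    case False
    hence "M x > 0" using M0[of x] by simp
    thus ?thesis using powr_add[of "M x" "q - 2" 1] by (simp add: w_def norm_mult M_def)
  qed (use q in \<open>auto simp: w_def M_def\<close>)
  have wA: "w x * A x = of_real (M x powr q)" for x
  proof (cases "M x = 0")
    case False
    hence *: "M x > 0" using M0[of x] by simp
    have "w x * A x = of_real (M x powr (q - 2)) * (A x * cnj (A x))" by (simp add: w_def)
    also have "\<dots> = of_real (M x powr (q - 2) * (M x)\<^sup>2)"
      unfolding M_def of_real_mult complex_norm_square ..
    also have "M x powr (q - 2) * (M x)\<^sup>2 = M x powr q" using * powr_add[of "M x" "q - 2" 2] by simp
    finally show ?thesis .
  qed (use q in \<open>auto simp: w_def M_def\<close>)
  have bdi: "integrable \<mu> F" if "F \<in> borel_measurable borel" "\<And>x. norm (F x) \<le> b" for F :: "real \<Rightarrow> complex" and b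
    using that by (intro integrable_const_bound[of _ b]) auto
  have wi: "integrable \<mu> w"
  proof (rule bdi)
    show "norm (w x) \<le> B powr (q - 1)" for x unfolding wM using M0 MB q by (intro powr_mono2) auto
  qed measurable
  have Fi: "integrable \<mu> (\<lambda>x. M x powr q)"
    using M0 MB q by (intro integrable_const_bound[of _ "B powr q"]) (auto intro!: AE_I2 powr_mono2)
  define X where "X = (\<integral>x. M x powr q \<partial>\<mu>)"
  have X0: "X \<ge> 0" by (simp add: X_def)
  define G where "G = (\<integral>\<xi>. (norm (g \<xi>))\<^sup>2 \<partial>lborel)"
  have G0: "G \<ge> 0" by (simp add: G_def)
  have nnX: "(\<integral>\<^sup>+x. ennreal (M x powr q) \<partial>\<mu>) = ennreal X"
    unfolding X_def using Fi by (intro nn_integral_eq_integral) auto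
  have "X \<le> \<beta> * G powr (q/2)"
  proof (cases "X = 0")
    case False
    hence Xp: "X > 0" using X0 by simp
    \<comment> \<open>The adjoint applied to \<open>w\<close> is merely bounded in \<xi>; the
      cut-off to J, where g lives, makes it square-integrable.\<close>
    define W where "W = (\<lambda>\<xi>. indicator J \<xi> * (\<integral>x. e x \<xi> * w x \<partial>\<mu>))"
    have ew: "(\<lambda>\<xi>. \<integral>x. e x \<xi> * w x \<partial>\<mu>) \<in> borel_measurable borel"
      by (rule borel_measurable_lebesgue_integral) measurable
    have [measurable]: "W \<in> borel_measurable borel" unfolding W_def using ew by measurable
    define S where "S = (\<integral>x. norm (w x) \<partial>\<mu>)"
    have WS: "norm (\<integral>x. e x \<xi> * w x \<partial>\<mu>) \<le> S" for \<xi>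
    proof -
      have [measurable]: "(\<lambda>x. e x \<xi>) \<in> borel_measurable borel" by measurable
      have "norm (e x \<xi> * w x) \<le> norm (w x)" for x using e1[of x \<xi>] by (simp add: norm_mult mult_left_le_one_le)
      thus ?thesis unfolding S_def using wi integrable_bounded_mult[OF wi, of "\<lambda>x. e x \<xi>" 1] e1
        by (intro Bochner_Integration.integral_norm_bound_integral) auto
    qed
    have Wi: "integrable lborel W"
      unfolding W_def using integrable_bounded_mult[OF indJ, of "\<lambda>\<xi>. \<integral>x. e x \<xi> * w x \<partial>\<mu>" S] WS ew
      by (simp add: mult.commute)
    have W2: "integrable lborel (\<lambda>\<xi>. (norm (W \<xi>))\<^sup>2)"
    proof -
      have "norm (cnj (W \<xi>)) \<le> S" for \<xi> using WS[of \<xi>] order_trans[OF norm_ge_zero WS[of \<xi>]]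
        by (auto simp: W_def norm_mult split: split_indicator)
      hence "integrable lborel (\<lambda>\<xi>. norm (cnj (W \<xi>) * W \<xi>))"
        by (intro integrable_norm integrable_bounded_mult[OF Wi]) auto
      thus ?thesis by (simp add: norm_mult power2_eq_square)
    qed
    define V where "V = (\<integral>\<xi>. (norm (W \<xi>))\<^sup>2 \<partial>lborel)"
    have V0: "V \<ge> 0" by (simp add: V_def)
    have "of_real X = (\<integral>x. w x * A x \<partial>\<mu>)" unfolding wA X_def by simp
    also have "\<dots> = (\<integral>\<xi>. g \<xi> * (\<integral>x. e x \<xi> * w x \<partial>\<mu>) \<partial>lborel)"
      unfolding A_def by (intro Fubini_bounded_kernel[where B = 1] sf sigma_finite_lborel wi gi e1) measurable
    also have "\<dots> = (\<integral>\<xi>. g \<xi> * W \<xi> \<partial>lborel)"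
      using gJ by (intro Bochner_Integration.integral_cong) (auto simp: W_def split: split_indicator)
    finally have "norm (complex_of_real X) = norm (\<integral>\<xi>. g \<xi> * W \<xi> \<partial>lborel)" by simp
    hence XGV: "X\<^sup>2 \<le> G * V"
      using integral_Cauchy_Schwarz[of g lborel W] g2 W2 X0 by (simp add: G_def V_def)
    define K where "K = (\<lambda>x y. \<integral>\<xi>\<in>J. e x \<xi> * cnj (e y \<xi>) \<partial>lborel)"
    have Vform: "of_real V = (\<integral>y. cnj (w y) * (\<integral>x. w x * K x y \<partial>\<mu>) \<partial>\<mu>)"
    proof -
      have cW: "cnj (W \<xi>) = indicator J \<xi> * (\<integral>y. cnj (e y \<xi>) * cnj (w y) \<partial>\<mu>)" for \<xi>
        using Bochner_Integration.integral_cnj[of \<mu> "\<lambda>y. e y \<xi> * w y"] by (simp add: W_def split: split_indicator)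
      have "of_real V = (\<integral>\<xi>. W \<xi> * cnj (W \<xi>) \<partial>lborel)"
        unfolding V_def integral_complex_of_real[symmetric] complex_norm_square ..
      also have "\<dots> = (\<integral>\<xi>. W \<xi> * (\<integral>y. cnj (e y \<xi>) * cnj (w y) \<partial>\<mu>) \<partial>lborel)"
        unfolding cW by (intro Bochner_Integration.integral_cong) (auto simp: W_def split: split_indicator)
      also have "\<dots> = (\<integral>y. cnj (w y) * (\<integral>\<xi>. cnj (e y \<xi>) * W \<xi> \<partial>lborel) \<partial>\<mu>)"
        by (intro Fubini_bounded_kernel[where B = 1] sf sigma_finite_lborel Wi)
           (use wi e1 in \<open>auto\<close>)
      also have "(\<lambda>y. \<integral>\<xi>. cnj (e y \<xi>) * W \<xi> \<partial>lborel) = (\<lambda>y. \<integral>x. w x * K x y \<partial>\<mu>)"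
      proof
        fix y
        have [measurable]: "e y \<in> borel_measurable borel" by measurable
        have ci: "integrable lborel (\<lambda>\<xi>. cnj (e y \<xi>) * indicator J \<xi>)"
          using e1 by (intro integrable_bounded_mult[OF indJ, of _ 1]) auto
        have "(\<integral>\<xi>. cnj (e y \<xi>) * W \<xi> \<partial>lborel) = (\<integral>\<xi>. (cnj (e y \<xi>) * indicator J \<xi>) * (\<integral>x. e x \<xi> * w x \<partial>\<mu>) \<partial>lborel)"
          by (simp add: W_def mult.assoc)
        also have "\<dots> = (\<integral>x. w x * (\<integral>\<xi>. e x \<xi> * (cnj (e y \<xi>) * indicator J \<xi>) \<partial>lborel) \<partial>\<mu>)"
          by (intro Fubini_bounded_kernel[where B = 1] sf sigma_finite_lborel ci wi)
             (use e1 in \<open>auto\<close>)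
        also have "(\<lambda>x. \<integral>\<xi>. e x \<xi> * (cnj (e y \<xi>) * indicator J \<xi>) \<partial>lborel) = (\<lambda>x. K x y)"
          unfolding K_def set_lebesgue_integral_def
          by (intro ext Bochner_Integration.integral_cong) (auto split: split_indicator)
        finally show "(\<integral>\<xi>. cnj (e y \<xi>) * W \<xi> \<partial>lborel) = (\<integral>x. w x * K x y \<partial>\<mu>)" .
      qed
      finally show ?thesis .
    qed
    define Z where "Z = \<beta> powr (2/q) * X powr (2 - 2/q)"
    have Z0: "Z \<ge> 0" by (simp add: Z_def)
    have \<kappa>0: "\<kappa> x y \<ge> 0" for x y using kernel[of x y] by (rule order_trans[rotated]) simp
    define c1 where "c1 = Z / (q * \<beta> * X)"
    define c2 where "c2 = Z * (1 - 2/q) / X\<^sup>2"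
    have c0: "c1 \<ge> 0" "c2 \<ge> 0" using Z0 q \<beta>(1) Xp by (auto simp: c1_def c2_def)
    have bound: "ennreal (norm (integral\<^sup>L \<mu> F)) \<le> (\<integral>\<^sup>+x. ennreal (norm (F x)) \<partial>\<mu>)" for F :: "real \<Rightarrow> complex"
      by (cases "integrable \<mu> F") (auto simp: integral_norm_bound_ennreal not_integrable_integral_eq)
    have "ennreal V = ennreal (norm (complex_of_real V))" using V0 by simp
    also have "\<dots> \<le> (\<integral>\<^sup>+y. ennreal (norm (cnj (w y) * (\<integral>x. w x * K x y \<partial>\<mu>))) \<partial>\<mu>)"
      unfolding Vform by (rule bound)
    also have "\<dots> \<le> (\<integral>\<^sup>+y. (\<integral>\<^sup>+x. ennreal (c1 * M x powr q) * ennreal (\<kappa> x y) + ennreal (c1 * M y powr q) * ennreal (\<kappa> y x)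
         + ennreal (c2 * M y powr q) * ennreal (M x powr q) \<partial>\<mu>) \<partial>\<mu>)"
    proof (intro nn_integral_mono)
      fix y
      have "ennreal (norm (cnj (w y) * (\<integral>x. w x * K x y \<partial>\<mu>))) = ennreal (norm (\<integral>x. cnj (w y) * (w x * K x y) \<partial>\<mu>))"
        by simp
      also have "\<dots> \<le> (\<integral>\<^sup>+x. ennreal (norm (cnj (w y) * (w x * K x y))) \<partial>\<mu>)" by (rule bound)
      also have "\<dots> \<le> (\<integral>\<^sup>+x. ennreal (c1 * M x powr q) * ennreal (\<kappa> x y) + ennreal (c1 * M y powr q) * ennreal (\<kappa> y x)
         + ennreal (c2 * M y powr q) * ennreal (M x powr q) \<partial>\<mu>)"
      proof (intro nn_integral_mono)
        fix x
        have "norm (cnj (w y) * (w x * K x y)) = M x powr (q - 1) * M y powr (q - 1) * norm (K x y)"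
          by (simp add: norm_mult wM)
        also have "\<dots> \<le> Z * ((M x powr q * \<kappa> x y + M y powr q * \<kappa> x y) / (q * \<beta> * X) + (1 - 2/q) * (M x powr q * M y powr q) / X\<^sup>2)"
          unfolding Z_def by (intro kernel_Young_pointwise M0 q Xp \<beta>(1)) (auto simp: K_def kernel)
        also have "\<dots> = (c1 * M x powr q) * \<kappa> x y + (c1 * M y powr q) * \<kappa> y x + (c2 * M y powr q) * (M x powr q)"
          unfolding c1_def c2_def \<kappa>_sym[of y x] by (simp add: distrib_left add_divide_distrib mult_ac)
        finally have "ennreal (norm (cnj (w y) * (w x * K x y))) \<le> ennreal \<dots>" by (rule ennreal_leI)
        also have "\<dots> = ennreal (c1 * M x powr q) * ennreal (\<kappa> x y) + ennreal (c1 * M y powr q) * ennreal (\<kappa> y x)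
         + ennreal (c2 * M y powr q) * ennreal (M x powr q)"
          using c0 \<kappa>0 by (simp add: ennreal_mult[symmetric] ennreal_plus[symmetric] del: ennreal_plus)
        finally show "ennreal (norm (cnj (w y) * (w x * K x y))) \<le> \<dots>" .
      qed
      finally show "ennreal (norm (cnj (w y) * (\<integral>x. w x * K x y \<partial>\<mu>))) \<le> \<dots>" .
    qed
    also have "\<dots> = (\<integral>\<^sup>+y. (\<integral>\<^sup>+x. ennreal (c1 * M x powr q) * ennreal (\<kappa> x y) \<partial>\<mu>) \<partial>\<mu>)
       + (\<integral>\<^sup>+y. (\<integral>\<^sup>+x. ennreal (c1 * M y powr q) * ennreal (\<kappa> y x) \<partial>\<mu>) \<partial>\<mu>)
       + (\<integral>\<^sup>+y. (\<integral>\<^sup>+x. ennreal (c2 * M y powr q) * ennreal (M x powr q) \<partial>\<mu>) \<partial>\<mu>)"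
    proof -
      have gen: "(\<integral>\<^sup>+y. (\<integral>\<^sup>+x. a x y + b x y + c x y \<partial>\<mu>) \<partial>\<mu>) =
          (\<integral>\<^sup>+y. (\<integral>\<^sup>+x. a x y \<partial>\<mu>) \<partial>\<mu>) + (\<integral>\<^sup>+y. (\<integral>\<^sup>+x. b x y \<partial>\<mu>) \<partial>\<mu>) + (\<integral>\<^sup>+y. (\<integral>\<^sup>+x. c x y \<partial>\<mu>) \<partial>\<mu>)"
        if [measurable]: "(\<lambda>(x, y). a x y) \<in> borel_measurable (borel \<Otimes>\<^sub>M borel)" "(\<lambda>(x, y). b x y) \<in> borel_measurable (borel \<Otimes>\<^sub>M borel)"
          "(\<lambda>(x, y). c x y) \<in> borel_measurable (borel \<Otimes>\<^sub>M borel)" for a b c :: "real \<Rightarrow> real \<Rightarrow> ennreal"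
      proof -
        have [measurable]: "(\<lambda>y. \<integral>\<^sup>+x. a x y \<partial>\<mu>) \<in> borel_measurable borel" "(\<lambda>y. \<integral>\<^sup>+x. b x y \<partial>\<mu>) \<in> borel_measurable borel"
          "(\<lambda>y. \<integral>\<^sup>+x. c x y \<partial>\<mu>) \<in> borel_measurable borel"
          by (rule borel_measurable_nn_integral, measurable)+
        have "(\<integral>\<^sup>+x. a x y + b x y + c x y \<partial>\<mu>) = (\<integral>\<^sup>+x. a x y \<partial>\<mu>) + (\<integral>\<^sup>+x. b x y \<partial>\<mu>) + (\<integral>\<^sup>+x. c x y \<partial>\<mu>)" for y
          by (simp add: nn_integral_add)
        thus ?thesis by (simp add: nn_integral_add)
      qed
      show ?thesis by (rule gen) measurable
    qed
    also have "(\<integral>\<^sup>+y. (\<integral>\<^sup>+x. ennreal (c1 * M x powr q) * ennreal (\<kappa> x y) \<partial>\<mu>) \<partial>\<mu>)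
        = (\<integral>\<^sup>+y. (\<integral>\<^sup>+x. ennreal (c1 * M y powr q) * ennreal (\<kappa> y x) \<partial>\<mu>) \<partial>\<mu>)"
      by (rule PS.Fubini') measurable
    also have T1: "(\<integral>\<^sup>+y. (\<integral>\<^sup>+x. ennreal (c1 * M y powr q) * ennreal (\<kappa> y x) \<partial>\<mu>) \<partial>\<mu>) \<le> ennreal (c1 * X * \<beta>)"
    proof -
      have "(\<integral>\<^sup>+y. (\<integral>\<^sup>+x. ennreal (c1 * M y powr q) * ennreal (\<kappa> y x) \<partial>\<mu>) \<partial>\<mu>) \<le> (\<integral>\<^sup>+y. ennreal (c1 * \<beta>) * ennreal (M y powr q) \<partial>\<mu>)"
      proof (intro nn_integral_mono)
        fix y
        have "(\<integral>\<^sup>+x. ennreal (c1 * M y powr q) * ennreal (\<kappa> y x) \<partial>\<mu>) = ennreal (c1 * M y powr q) * (\<integral>\<^sup>+x. ennreal (\<kappa> y x) \<partial>\<mu>)"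
          by (intro nn_integral_cmult) measurable
        also have "\<dots> \<le> ennreal (c1 * M y powr q) * ennreal \<beta>" by (intro mult_left_mono \<beta>(2)) auto
        also have "\<dots> = ennreal (c1 * \<beta>) * ennreal (M y powr q)"
          using c0 \<beta>(1) by (simp add: ennreal_mult[symmetric] mult_ac)
        finally show "(\<integral>\<^sup>+x. ennreal (c1 * M y powr q) * ennreal (\<kappa> y x) \<partial>\<mu>) \<le> \<dots>" .
      qed
      also have "\<dots> = ennreal (c1 * \<beta>) * ennreal X" by (subst nn_integral_cmult) (auto simp: nnX)
      also have "\<dots> = ennreal (c1 * X * \<beta>)" using c0 \<beta>(1) X0 by (simp add: ennreal_mult[symmetric] mult_ac)
      finally show ?thesis .
    qed
    also have "(\<integral>\<^sup>+y. (\<integral>\<^sup>+x. ennreal (c2 * M y powr q) * ennreal (M x powr q) \<partial>\<mu>) \<partial>\<mu>) = ennreal (c2 * X * X)"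
    proof -
      have "(\<integral>\<^sup>+y. (\<integral>\<^sup>+x. ennreal (c2 * M y powr q) * ennreal (M x powr q) \<partial>\<mu>) \<partial>\<mu>) = (\<integral>\<^sup>+y. ennreal (c2 * X) * ennreal (M y powr q) \<partial>\<mu>)"
        using c0 X0 by (intro nn_integral_cong, subst nn_integral_cmult) (auto simp: nnX ennreal_mult[symmetric] mult_ac)
      also have "\<dots> = ennreal (c2 * X) * ennreal X" by (subst nn_integral_cmult) (auto simp: nnX)
      finally show ?thesis using c0 X0 by (simp add: ennreal_mult[symmetric] mult_ac)
    qed
    finally have "ennreal V \<le> ennreal (c1 * X * \<beta>) + ennreal (c1 * X * \<beta>) + ennreal (c2 * X * X)"
      using T1 by (metis (no_types, lifting) add_mono add_right_mono order_trans)
    also have "\<dots> = ennreal (2 * (c1 * X * \<beta>) + c2 * X * X)"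
      using c0 X0 \<beta>(1) by (simp add: ennreal_plus[symmetric] del: ennreal_plus)
    \<comment> \<open>The normalisation of the constants: the shares 2/q and 1 - 2/q add up to
      1.\<close>
    also have "2 * (c1 * X * \<beta>) + c2 * X * X = Z"
    proof -
      have "c1 * X * \<beta> = Z / q" using Xp \<beta>(1) q by (simp add: c1_def)
      moreover have "c2 * X * X = Z * (1 - 2/q)" using Xp by (simp add: c2_def power2_eq_square)
      ultimately show ?thesis by (simp add: algebra_simps)
    qed
    finally have "V \<le> Z" using Z0 by (simp add: ennreal_le_iff)
    hence "X\<^sup>2 \<le> G * (\<beta> powr (2/q) * X powr (2 - 2/q))"
      using XGV mult_left_mono[OF _ G0, of V Z] unfolding Z_def by linarith
    hence "X powr (2/q) * X powr (2 - 2/q) \<le> (G * \<beta> powr (2/q)) * X powr (2 - 2/q)"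
      using Xp by (simp add: powr_add[symmetric] mult.assoc)
    hence "X powr (2/q) \<le> G * \<beta> powr (2/q)" using Xp by simp
    hence "(X powr (2/q)) powr (q/2) \<le> (G * \<beta> powr (2/q)) powr (q/2)" using q by (intro powr_mono2) auto
    also have "\<dots> = G powr (q/2) * \<beta>" using G0 \<beta>(1) q by (simp add: powr_mult powr_powr)
    also have "(X powr (2/q)) powr (q/2) = X" using Xp q by (simp add: powr_powr)
    finally show ?thesis by (simp add: mult.commute)
  qed (use \<beta>(1) in auto)
  hence "ennreal X \<le> ennreal (\<beta> * G powr (q/2))" by (rule ennreal_leI)
  thus ?thesis using nnX unfolding M_def A_def G_def by simp
qed

text \<open>The kernel bound is uniform in i and j, so it survives any measurable choice of the
  index depending on x. The least index that maximises among finitely many is such a choice; the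
  supremum over all of them follows by monotone convergence.\<close>

lemma maximal_TTstar_bound:
  fixes \<mu> :: "real measure" and e :: "nat \<Rightarrow> real \<Rightarrow> real \<Rightarrow> complex" and g :: "real \<Rightarrow> complex" and \<kappa> :: "real \<Rightarrow> real \<Rightarrow> real"
  assumes \<mu>: "finite_measure \<mu>" and sets: "sets \<mu> = sets borel"
    and e[measurable]: "\<And>i. (\<lambda>(x, \<xi>). e i x \<xi>) \<in> borel_measurable (borel \<Otimes>\<^sub>M borel)"
    and e1: "\<And>i x \<xi>. norm (e i x \<xi>) \<le> 1"
    and J[measurable]: "J \<in> sets borel" and Jfin: "emeasure lborel J < \<infinity>"
    and g: "in_L2 g" and gJ: "\<And>\<xi>. \<xi> \<notin> J \<Longrightarrow> g \<xi> = 0"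
    and \<kappa>: "(\<lambda>(x, y). \<kappa> x y) \<in> borel_measurable (borel \<Otimes>\<^sub>M borel)"
    and \<kappa>_sym: "\<And>x y. \<kappa> x y = \<kappa> y x"
    and kernel: "\<And>i j x y. norm (\<integral>\<xi>\<in>J. e i x \<xi> * cnj (e j y \<xi>) \<partial>lborel) powr (q/2) \<le> \<kappa> x y"
    and \<beta>: "0 < \<beta>" "\<And>x. (\<integral>\<^sup>+y. ennreal (\<kappa> x y) \<partial>\<mu>) \<le> ennreal \<beta>"
    and q: "2 \<le> q"
  shows "(\<integral>\<^sup>+x. (SUP i. ennreal (norm (\<integral>\<xi>. e i x \<xi> * g \<xi> \<partial>lborel) powr q)) \<partial>\<mu>)
     \<le> ennreal (\<beta> * (\<integral>\<xi>. (norm (g \<xi>))\<^sup>2 \<partial>lborel) powr (q/2))"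
proof -
  note [measurable_cong] = sets
  have [measurable]: "g \<in> borel_measurable borel" using g by (simp add: in_L2_def)
  define A where "A = (\<lambda>i x. \<integral>\<xi>. e i x \<xi> * g \<xi> \<partial>lborel)"
  have A[measurable]: "A i \<in> borel_measurable borel" for i
    unfolding A_def by (rule lborel.borel_measurable_lebesgue_integral) measurable
  define U where "U = (\<lambda>i x. ennreal (norm (A i x) powr q))"
  have [measurable]: "U i \<in> borel_measurable borel" for i unfolding U_def by measurable
  have fin: "(\<integral>\<^sup>+x. (SUP i\<in>{..n}. U i x) \<partial>\<mu>) \<le> ennreal (\<beta> * (\<integral>\<xi>. (norm (g \<xi>))\<^sup>2 \<partial>lborel) powr (q/2))" for n :: nat
  proof -
    define sel where "sel = (\<lambda>x. LEAST i. i \<le> n \<and> (\<forall>j\<le>n. norm (A j x) \<le> norm (A i x)))"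
    have sel_m[measurable]: "sel \<in> measurable borel (count_space UNIV)"
      unfolding sel_def by measurable
    have sel: "sel x \<le> n \<and> (\<forall>j\<le>n. norm (A j x) \<le> norm (A (sel x) x))" for x
    proof -
      have "Max ((\<lambda>i. norm (A i x)) ` {..n}) \<in> (\<lambda>i. norm (A i x)) ` {..n}" by (intro Max_in) auto
      then obtain i where i: "Max ((\<lambda>i. norm (A i x)) ` {..n}) = norm (A i x)" "i \<in> {..n}" by (rule imageE)
      have "\<forall>j\<le>n. norm (A j x) \<le> norm (A i x)" unfolding i(1)[symmetric] by (auto intro!: Max_ge)
      thus ?thesis unfolding sel_def using i(2) by (intro LeastI[of "\<lambda>i. i \<le> n \<and> (\<forall>j\<le>n. norm (A j x) \<le> norm (A i x))" i]) auto
    qed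
    have "(\<lambda>p. (\<lambda>i p. case p of (x, \<xi>) \<Rightarrow> e i x \<xi>) (sel (fst p)) p) \<in> borel_measurable (borel \<Otimes>\<^sub>M borel)"
      by (rule measurable_compose_countable) measurable
    hence em: "(\<lambda>(x, \<xi>). e (sel x) x \<xi>) \<in> borel_measurable (borel \<Otimes>\<^sub>M borel)"
      by (simp add: case_prod_unfold)
    have "(\<integral>\<^sup>+x. (SUP i\<in>{..n}. U i x) \<partial>\<mu>) \<le> (\<integral>\<^sup>+x. ennreal (norm (\<integral>\<xi>. e (sel x) x \<xi> * g \<xi> \<partial>lborel) powr q) \<partial>\<mu>)"
      using sel q unfolding U_def A_def[symmetric]
      by (intro nn_integral_mono SUP_least ennreal_leI powr_mono2) (auto simp: A_def)
    also have "\<dots> \<le> ennreal (\<beta> * (\<integral>\<xi>. (norm (g \<xi>))\<^sup>2 \<partial>lborel) powr (q/2))"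
      by (rule TTstar_bound[OF \<mu> sets em e1 J Jfin g gJ \<kappa> \<kappa>_sym kernel \<beta> q])
    finally show ?thesis .
  qed
  have "(SUP i. U i x) = (SUP n. SUP i\<in>{..n}. U i x)" for x
    by (intro antisym SUP_least) (auto intro!: SUP_upper2[of i for i] SUP_upper)
  hence "(\<integral>\<^sup>+x. (SUP i. U i x) \<partial>\<mu>) = (\<integral>\<^sup>+x. (SUP n. SUP i\<in>{..n}. U i x) \<partial>\<mu>)" by simp
  also have "\<dots> = (SUP n. \<integral>\<^sup>+x. (SUP i\<in>{..n}. U i x) \<partial>\<mu>)"
  proof (rule nn_integral_monotone_convergence_SUP)
    show "incseq (\<lambda>n x. SUP i\<in>{..n}. U i x)"
      by (intro incseq_SucI le_funI SUP_subset_mono) auto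
  qed measurable
  also have "\<dots> \<le> ennreal (\<beta> * (\<integral>\<xi>. (norm (g \<xi>))\<^sup>2 \<partial>lborel) powr (q/2))"
    using fin by (intro SUP_least) auto
  finally show ?thesis unfolding U_def A_def .
qed

section \<open>Potentials of fractal measures\<close>

lemma dimensional_ball_bound:
  assumes "dimensional \<alpha> \<mu>"
  obtains A where "A \<ge> 0" "\<And>x r. r > 0 \<Longrightarrow> emeasure \<mu> (ball x r) \<le> ennreal (A * r powr \<alpha>)"
proof
  define S where "S = (SUP x. SUP r\<in>{0<..}. emeasure \<mu> (ball x r) / ennreal (r powr \<alpha>))"
  have S: "S < top" using assms by (simp add: dimensional_def S_def)
  show "enn2real S \<ge> 0" by simp
  fix x r :: real assume r: "r > 0"
  have rp: "ennreal (r powr \<alpha>) \<noteq> 0" "ennreal (r powr \<alpha>) \<noteq> top" using r by (auto simp: ennreal_eq_0_iff)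
  have "emeasure \<mu> (ball x r) / ennreal (r powr \<alpha>) \<le> S"
    unfolding S_def using r by (intro SUP_upper2[of x] SUP_upper) auto
  hence "emeasure \<mu> (ball x r) / ennreal (r powr \<alpha>) * ennreal (r powr \<alpha>) \<le> S * ennreal (r powr \<alpha>)"
    by (rule mult_right_mono) auto
  also have "emeasure \<mu> (ball x r) / ennreal (r powr \<alpha>) * ennreal (r powr \<alpha>) = emeasure \<mu> (ball x r)"
    using rp by (simp add: ennreal_divide_times ennreal_divide_self less_top)
  also have "S * ennreal (r powr \<alpha>) = ennreal (enn2real S * r powr \<alpha>)"
    using S by (simp add: ennreal_mult)
  finally show "emeasure \<mu> (ball x r) \<le> ennreal (enn2real S * r powr \<alpha>)" .
qed

lemma fractal_measure_finite:
  assumes "\<mu> \<in> fractal_measures \<alpha>"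
  shows "finite_measure \<mu>"
proof
  have s: "sets \<mu> = sets borel" and n: "emeasure \<mu> (- cball 0 1) = 0" and d: "dimensional \<alpha> \<mu>"
    using assms by (auto simp: fractal_measures_def)
  obtain A where A: "A \<ge> 0" "\<And>x r. r > 0 \<Longrightarrow> emeasure \<mu> (ball x r) \<le> ennreal (A * r powr \<alpha>)"
    by (rule dimensional_ball_bound[OF d]) blast
  have sp: "space \<mu> = UNIV" using sets_eq_imp_space_eq[OF s] by simp
  have "emeasure \<mu> UNIV \<le> emeasure \<mu> (ball 0 2 \<union> - cball 0 1)"
    by (intro emeasure_mono) (auto simp: s)
  also have "\<dots> \<le> emeasure \<mu> (ball 0 2) + emeasure \<mu> (- cball 0 1)"
    by (intro emeasure_subadditive) (auto simp: s)
  also have "\<dots> \<le> ennreal (A * 2 powr \<alpha>)" using A(2)[of 2 0] n by simp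
  also have "\<dots> < \<infinity>" by simp
  finally show "emeasure \<mu> (space \<mu>) \<noteq> \<infinity>" by (simp add: sp)
qed

text \<open>The one term belonging to the shell of y already dominates; the sum makes the right side
  independent of the shell, so that it can be integrated ball by ball.\<close>

lemma trunc_riesz_le_sum:
  assumes \<alpha>: "0 \<le> \<alpha>" and y: "\<bar>y\<bar> < 1"
  shows "trunc_riesz \<alpha> k y \<le> (\<Sum>j\<le>k. (2 ^ j) powr \<alpha> * indicator (ball 0 (2 / 2 ^ j)) y)"
proof -
  have "\<exists>j\<le>k. trunc_riesz \<alpha> k y \<le> (2 ^ j) powr \<alpha> \<and> \<bar>y\<bar> < 2 / 2 ^ j"
  proof (cases "\<bar>y\<bar> \<le> 1 / 2 ^ k")
    case True
    have "\<bar>y\<bar> < 2 / 2 ^ k" by (rule le_less_trans[OF True]) (simp add: divide_strict_right_mono)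
    thus ?thesis using True by (intro exI[of _ k]) (simp add: trunc_riesz_def)
  next
    case False
    \<comment> \<open>|y| < 1 excludes j = 0, so minimality gives |y| < 2 / 2 ^ j.\<close>
    define j where "j = (LEAST j::nat. 1 / 2 ^ j \<le> \<bar>y\<bar>)"
    have k: "1 / 2 ^ k \<le> \<bar>y\<bar>" using False by simp
    have j: "1 / 2 ^ j \<le> \<bar>y\<bar>" unfolding j_def using k by (rule LeastI)
    have jk: "j \<le> k" unfolding j_def using k by (rule Least_le)
    have j0: "j \<noteq> 0" using j y by (intro notI) simp
    then obtain i where i: "j = Suc i" using not0_implies_Suc by blast
    have "\<not> 1 / 2 ^ i \<le> \<bar>y\<bar>" using not_less_Least[of i "\<lambda>j. 1 / 2 ^ j \<le> \<bar>y\<bar>"] i unfolding j_def by simp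
    hence up: "\<bar>y\<bar> < 2 / 2 ^ j" by (simp add: i)
    have "\<bar>y\<bar> powr (- \<alpha>) \<le> (1 / 2 ^ j) powr (- \<alpha>)" using j \<alpha> by (intro powr_mono2') auto
    also have "\<dots> = (2 ^ j) powr \<alpha>" by (simp add: powr_divide powr_minus_divide)
    finally show ?thesis using False up jk by (intro exI[of _ j]) (simp add: trunc_riesz_def)
  qed
  then obtain j where j: "j \<le> k" "trunc_riesz \<alpha> k y \<le> (2 ^ j) powr \<alpha>" "\<bar>y\<bar> < 2 / 2 ^ j" by blast
  have "trunc_riesz \<alpha> k y \<le> (2 ^ j) powr \<alpha> * indicator (ball 0 (2 / 2 ^ j)) y"
    using j by (simp add: dist_real_def)
  also have "\<dots> \<le> (\<Sum>j\<le>k. (2 ^ j) powr \<alpha> * indicator (ball 0 (2 / 2 ^ j)) y)"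
    using j(1) by (intro member_le_sum) auto
  finally show ?thesis .
qed

lemma trunc_riesz_potential_bound:
  assumes \<alpha>: "0 < \<alpha>" and \<mu>: "\<mu> \<in> fractal_measures \<alpha>"
  obtains C where "C \<ge> 0"
    "\<And>k x. (\<integral>\<^sup>+y. indicator (ball x 1) y * ennreal (trunc_riesz \<alpha> k (x - y)) \<partial>\<mu>) \<le> ennreal (C * (real k + 1))"
proof -
  have s: "sets \<mu> = sets borel" and d: "dimensional \<alpha> \<mu>"
    using \<mu> by (auto simp: fractal_measures_def)
  note [measurable_cong] = s
  obtain A where A: "A \<ge> 0" "\<And>x r. r > 0 \<Longrightarrow> emeasure \<mu> (ball x r) \<le> ennreal (A * r powr \<alpha>)"
    by (rule dimensional_ball_bound[OF d]) blast
  have bs: "ball x r \<in> sets \<mu>" for x r :: real by (simp add: s)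
  have "(\<integral>\<^sup>+y. indicator (ball x 1) y * ennreal (trunc_riesz \<alpha> k (x - y)) \<partial>\<mu>) \<le> ennreal (A * 2 powr \<alpha> * (real k + 1))" for k x
  proof -
    have "(\<integral>\<^sup>+y. indicator (ball x 1) y * ennreal (trunc_riesz \<alpha> k (x - y)) \<partial>\<mu>)
       \<le> (\<integral>\<^sup>+y. (\<Sum>j\<le>k. ennreal ((2 ^ j) powr \<alpha>) * indicator (ball x (2 / 2 ^ j)) y) \<partial>\<mu>)"
    proof (intro nn_integral_mono)
      fix y
      show "indicator (ball x 1) y * ennreal (trunc_riesz \<alpha> k (x - y)) \<le> (\<Sum>j\<le>k. ennreal ((2 ^ j) powr \<alpha>) * indicator (ball x (2 / 2 ^ j)) y)"
      proof (cases "y \<in> ball x 1")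
        case True
        hence "\<bar>x - y\<bar> < 1" by (simp add: dist_real_def)
        from trunc_riesz_le_sum[OF less_imp_le[OF \<alpha>] this, of k]
        have "ennreal (trunc_riesz \<alpha> k (x - y)) \<le> ennreal (\<Sum>j\<le>k. (2 ^ j) powr \<alpha> * indicator (ball 0 (2 / 2 ^ j)) (x - y))"
          by (rule ennreal_leI)
        also have "\<dots> = (\<Sum>j\<le>k. ennreal ((2 ^ j) powr \<alpha>) * indicator (ball x (2 / 2 ^ j)) y)"
          by (subst sum_ennreal[symmetric]) (auto simp: dist_real_def abs_minus_commute intro!: sum.cong split: split_indicator)
        finally show ?thesis using True by simp
      qed simp
    qed
    also have "\<dots> = (\<Sum>j\<le>k. \<integral>\<^sup>+y. ennreal ((2 ^ j) powr \<alpha>) * indicator (ball x (2 / 2 ^ j)) y \<partial>\<mu>)"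
      by (intro nn_integral_sum borel_measurable_times_ennreal borel_measurable_const borel_measurable_indicator bs)
    also have "\<dots> = (\<Sum>j\<le>k. ennreal ((2 ^ j) powr \<alpha>) * emeasure \<mu> (ball x (2 / 2 ^ j)))"
      by (intro sum.cong refl nn_integral_cmult_indicator bs)
    \<comment> \<open>The mass of the ball cancels the height of the kernel on the shell, so that
      all k + 1 terms have the same bound.\<close>
    also have "\<dots> \<le> (\<Sum>j\<le>k. ennreal (A * 2 powr \<alpha>))"
    proof (intro sum_mono)
      fix j
      have "ennreal ((2 ^ j) powr \<alpha>) * emeasure \<mu> (ball x (2 / 2 ^ j)) \<le> ennreal ((2 ^ j) powr \<alpha>) * ennreal (A * (2 / 2 ^ j) powr \<alpha>)"
        by (intro mult_left_mono A) auto
      also have "\<dots> = ennreal (A * 2 powr \<alpha>)"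
        using A(1) by (simp add: ennreal_mult[symmetric] powr_divide)
      finally show "ennreal ((2 ^ j) powr \<alpha>) * emeasure \<mu> (ball x (2 / 2 ^ j)) \<le> ennreal (A * 2 powr \<alpha>)" .
    qed
    also have "\<dots> = ennreal (A * 2 powr \<alpha> * (real k + 1))"
      using A(1) by (subst sum_ennreal) (auto simp: algebra_simps)
    finally show ?thesis .
  qed
  thus ?thesis using A(1) that[of "A * 2 powr \<alpha>"] by simp
qed

section \<open>Maximal functions of single annuli\<close>

lemma osc_integral_tendsto:
  fixes X Y :: "nat \<Rightarrow> real"
  assumes h: "integrable lborel h" and c: "\<And>n. Y n \<ge> 0" and X: "X \<longlonglongrightarrow> t" and Y: "Y \<longlonglongrightarrow> c"
  shows "(\<lambda>n. \<integral>\<xi>. osc m x (X n) (Y n) \<xi> * h \<xi> \<partial>lborel) \<longlonglongrightarrow> (\<integral>\<xi>. osc m x t c \<xi> * h \<xi> \<partial>lborel)"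
proof (rule integral_dominated_convergence[where w = "\<lambda>\<xi>. norm (h \<xi>)"])
  have [measurable]: "h \<in> borel_measurable borel" using h by auto
  show "(\<lambda>\<xi>. osc m x t c \<xi> * h \<xi>) \<in> borel_measurable lborel"
    "(\<lambda>\<xi>. osc m x (X n) (Y n) \<xi> * h \<xi>) \<in> borel_measurable lborel" for n by measurable
  show "integrable lborel (\<lambda>\<xi>. norm (h \<xi>))" using h by simp
  show "AE \<xi> in lborel. (\<lambda>n. osc m x (X n) (Y n) \<xi> * h \<xi>) \<longlonglongrightarrow> osc m x t c \<xi> * h \<xi>"
  proof (rule AE_I2)
    fix \<xi>
    have "(\<lambda>n. x * \<xi> + X n * \<bar>\<xi>\<bar> powr m) \<longlonglongrightarrow> x * \<xi> + t * \<bar>\<xi>\<bar> powr m" by (intro tendsto_intros X)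
    hence "(\<lambda>n. cis (x * \<xi> + X n * \<bar>\<xi>\<bar> powr m)) \<longlonglongrightarrow> cis (x * \<xi> + t * \<bar>\<xi>\<bar> powr m)"
      by (intro continuous_on_tendsto_compose[OF continuous_on_cis[OF continuous_on_id, of UNIV]]) auto
    thus "(\<lambda>n. osc m x (X n) (Y n) \<xi> * h \<xi>) \<longlonglongrightarrow> osc m x t c \<xi> * h \<xi>"
      unfolding osc_def by (intro tendsto_mult tendsto_const tendsto_of_real tendsto_exp tendsto_minus Y)
  qed
  show "AE \<xi> in lborel. norm (osc m x (X n) (Y n) \<xi> * h \<xi>) \<le> norm (h \<xi>)" for n
    using norm_osc_le[OF c, of m x] by (intro AE_I2) (simp add: norm_mult mult_left_le_one_le)
qed

lemma rational_approx_I01: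
  assumes "t \<in> I01"
  obtains X :: "nat \<Rightarrow> real" where "\<And>n. X n \<in> I01 \<inter> \<rat>" "X \<longlonglongrightarrow> t"
proof -
  have "\<exists>r\<in>\<rat>. t < r \<and> r < min 1 (t + 1 / (real n + 1))" for n
    using assms by (intro Rats_dense_in_real) auto
  then obtain X where X: "\<And>n. X n \<in> \<rat>" "\<And>n. t < X n" "\<And>n. X n < min 1 (t + 1 / (real n + 1))" by metis
  have "X \<longlonglongrightarrow> t"
  proof (rule tendsto_sandwich[where f = "\<lambda>_. t" and h = "\<lambda>n. t + 1 / (real n + 1)"])
    show "(\<lambda>n. t + 1 / (real n + 1)) \<longlonglongrightarrow> t" by real_asymp
    show "\<forall>\<^sub>F n in sequentially. t \<le> X n" by (intro always_eventually allI less_imp_le X(2))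
    show "\<forall>\<^sub>F n in sequentially. X n \<le> t + 1 / (real n + 1)" using X(3) by (auto intro!: always_eventually less_imp_le)
  qed auto
  moreover have "X n \<in> I01 \<inter> \<rat>" for n using X(1)[of n] X(2)[of n] X(3)[of n] assms by auto
  ultimately show ?thesis using that by blast
qed

text \<open>The propagator uses the regularisation \<open>exp (- \<xi>\<^sup>2 / N\<^sup>2)\<close>; \<open>reg\<close> starts at \<open>N = 1\<close> because \<open>N = 0\<close> gives the
  junk value \<open>\<xi>\<^sup>2 / 0 = 0\<close>.\<close>

definition reg :: "nat \<Rightarrow> real" where "reg n = 1 / (real n + 1)\<^sup>2"

lemma reg_nonneg [simp]: "0 \<le> reg n" by (simp add: reg_def)

lemma reg_tendsto: "reg \<longlonglongrightarrow> 0" unfolding reg_def[abs_def] by real_asymp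

text \<open>Including the regularisations in the supremum is what later gives convergence of the
  regularised integrals, and not only a bound for their limit.\<close>

lemma annulus_maximal_bound:
  fixes m \<alpha> q \<sigma> :: real
  assumes m: "0 < m" "m < 1" and \<alpha>: "0 < \<alpha>" "\<alpha> \<le> 1" and q: "2 \<le> q"
    and \<sigma>: "1/2 - m/4 - (1 - m) * \<alpha> / q \<le> \<sigma>" "1/2 - \<alpha> / q \<le> \<sigma>"
    and \<mu>: "\<mu> \<in> fractal_measures \<alpha>"
  obtains C where "C > 0" "\<And>k g. in_L2 g \<Longrightarrow> (\<And>\<xi>. \<xi> \<notin> annulus k \<Longrightarrow> g \<xi> = 0) \<Longrightarrow>
    \<exists>S\<in>borel_measurable borel. (\<integral>\<^sup>+x. S x \<partial>\<mu>) \<le> ennreal (C * (real k + 1) * (2 ^ k) powr (\<sigma> * q) * (\<integral>\<xi>. (norm (g \<xi>))\<^sup>2 \<partial>lborel) powr (q/2)) \<and>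
      (\<forall>x\<in>I01. \<forall>t\<in>I01. \<forall>c\<in>insert 0 (range reg). ennreal (norm (\<integral>\<xi>. osc m x t c \<xi> * g \<xi> \<partial>lborel) powr q) \<le> S x)"
proof -
  have s: "sets \<mu> = sets borel" using \<mu> by (auto simp: fractal_measures_def)
  note [measurable_cong] = s
  obtain C1 where C1: "C1 \<ge> 0" "\<And>k x t c. \<bar>x\<bar> \<le> 1 \<Longrightarrow> \<bar>t\<bar> \<le> 1 \<Longrightarrow> 0 \<le> c \<Longrightarrow>
    norm (annulus_kernel m k x t c) powr (q/2) \<le> C1 * ((2^k) powr (\<sigma> * q) * trunc_riesz \<alpha> k x)"
    by (rule annulus_kernel_power_bound[OF m \<alpha> q \<sigma>]) blast
  obtain C2 where C2: "C2 \<ge> 0" "\<And>k x. (\<integral>\<^sup>+y. indicator (ball x 1) y * ennreal (trunc_riesz \<alpha> k (x - y)) \<partial>\<mu>) \<le> ennreal (C2 * (real k + 1))"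
    by (rule trunc_riesz_potential_bound[OF \<alpha>(1) \<mu>]) blast
  \<comment> \<open>The summand 1 keeps C positive, as the T T* inequality divides by
    \<beta>.\<close>
  define C where "C = C1 * C2 + 1"
  have C: "C > 0" using C1(1) C2(1) by (simp add: C_def add_nonneg_pos)
  define Q where "Q = I01 \<inter> \<rat>"
  have Q: "countable Q" "Q \<noteq> {}"
  proof -
    show "countable Q" unfolding Q_def by (intro countable_Int2 countable_rat)
    have "1 / 2 \<in> Q" by (simp add: Q_def)
    thus "Q \<noteq> {}" by blast
  qed
  \<comment> \<open>One index enumerates all pairs of a rational time and a regularisation, so that
    the supremum is over a countable family.\<close>
  define T where "T = (\<lambda>i. from_nat_into Q (fst (prod_decode i)))"
  define R where "R = (\<lambda>i. reg (snd (prod_decode i)))"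
  have T: "T i \<in> I01" for i using from_nat_into[OF Q(2)] by (auto simp: T_def Q_def)
  have R: "R i \<ge> 0" for i by (simp add: R_def)
  have TR: "\<exists>i. T i = t \<and> R i = reg n" if "t \<in> Q" for t n
    using that Q by (intro exI[of _ "prod_encode (to_nat_on Q t, n)"]) (simp add: T_def R_def)
  \<comment> \<open>The indicator function confines x and y to the unit interval, hence |x - y| < 1,
    the range of the kernel bound and of the potential bound.\<close>
  define e where "e = (\<lambda>i x \<xi>. indicator I01 x * osc m x (T i) (R i) \<xi>)"
  have em: "(\<lambda>(x, \<xi>). e i x \<xi>) \<in> borel_measurable (borel \<Otimes>\<^sub>M borel)" for i
    unfolding e_def osc_def by measurable
  have e1: "norm (e i x \<xi>) \<le> 1" for i x \<xi>
    using norm_osc_le[OF R, of m x "T i" i \<xi>] by (simp add: e_def norm_mult split: split_indicator)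
  have main: "\<exists>S\<in>borel_measurable borel. (\<integral>\<^sup>+x. S x \<partial>\<mu>) \<le> ennreal (C * (real k + 1) * (2 ^ k) powr (\<sigma> * q) * (\<integral>\<xi>. (norm (g \<xi>))\<^sup>2 \<partial>lborel) powr (q/2)) \<and>
      (\<forall>x\<in>I01. \<forall>t\<in>I01. \<forall>c\<in>insert 0 (range reg). ennreal (norm (\<integral>\<xi>. osc m x t c \<xi> * g \<xi> \<partial>lborel) powr q) \<le> S x)"
    if g: "in_L2 g" and gJ: "\<And>\<xi>. \<xi> \<notin> annulus k \<Longrightarrow> g \<xi> = 0" for k g
  proof -
    have [measurable]: "g \<in> borel_measurable borel" using g by (simp add: in_L2_def)
    have Jfin: "emeasure lborel (annulus k) < \<infinity>"
      by (rule le_less_trans[OF emeasure_mono[OF annulus_subset]]) (auto simp: emeasure_lborel_Icc_eq)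
    have gi: "integrable lborel g" using g gJ by (rule integrable_L2_annulus)
    define P where "P = (2 ^ k) powr (\<sigma> * q)"
    have P: "P > 0" by (simp add: P_def)
    define \<kappa> where "\<kappa> = (\<lambda>x y. indicator {-1<..<1} (x - y) * (C1 * (P * trunc_riesz \<alpha> k (x - y))))"
    have \<kappa>m: "(\<lambda>(x, y). \<kappa> x y) \<in> borel_measurable (borel \<Otimes>\<^sub>M borel)"
      unfolding \<kappa>_def by measurable
    have \<kappa>_sym: "\<kappa> x y = \<kappa> y x" for x y
      using trunc_riesz_minus[of \<alpha> k "x - y"] by (auto simp: \<kappa>_def split: split_indicator)
    have kernel: "norm (\<integral>\<xi>\<in>annulus k. e i x \<xi> * cnj (e j y \<xi>) \<partial>lborel) powr (q/2) \<le> \<kappa> x y" for i j x y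
    proof (cases "x \<in> I01 \<and> y \<in> I01")
      case True
      \<comment> \<open>Positions and times are subtracted but regularisations are added, so the
        product is again of the form \<open>osc\<close> with a nonnegative parameter.\<close>
      have "e i x \<xi> * cnj (e j y \<xi>) = osc m (x - y) (T i - T j) (R i + R j) \<xi>" for \<xi>
      proof -
        have "e i x \<xi> * cnj (e j y \<xi>) = (cis (x * \<xi> + T i * \<bar>\<xi>\<bar> powr m) * cis (- (y * \<xi> + T j * \<bar>\<xi>\<bar> powr m))) *
           (of_real (exp (- R i * \<xi>\<^sup>2)) * of_real (exp (- R j * \<xi>\<^sup>2)))"
          using True by (simp add: e_def osc_def cis_cnj)
        also have "cis (x * \<xi> + T i * \<bar>\<xi>\<bar> powr m) * cis (- (y * \<xi> + T j * \<bar>\<xi>\<bar> powr m)) = cis ((x - y) * \<xi> + (T i - T j) * \<bar>\<xi>\<bar> powr m)"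
          by (simp only: cis_mult) (simp add: algebra_simps)
        also have "complex_of_real (exp (- R i * \<xi>\<^sup>2)) * of_real (exp (- R j * \<xi>\<^sup>2)) = of_real (exp (- (R i + R j) * \<xi>\<^sup>2))"
          by (simp add: exp_add[symmetric] algebra_simps flip: of_real_mult)
        finally show ?thesis by (simp add: osc_def)
      qed
      hence "(\<integral>\<xi>\<in>annulus k. e i x \<xi> * cnj (e j y \<xi>) \<partial>lborel) = annulus_kernel m k (x - y) (T i - T j) (R i + R j)"
        by (simp add: annulus_kernel_def)
      moreover have "\<bar>T i - T j\<bar> \<le> 1" using T[of i] T[of j] by (auto simp: abs_le_iff)
      moreover have "\<bar>x - y\<bar> \<le> 1" "x - y \<in> {-1<..<1}" using True by (auto simp: abs_le_iff)
      ultimately show ?thesis using C1(2)[of "x - y" "T i - T j" "R i + R j" k] R[of i] R[of j]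
        by (simp add: \<kappa>_def P_def)
    next
      case False
      hence z: "(\<lambda>\<xi>. e i x \<xi> * cnj (e j y \<xi>)) = (\<lambda>_. 0)" by (auto simp: e_def)
      show ?thesis using C1(1) P q unfolding z by (simp add: \<kappa>_def set_lebesgue_integral_def)
    qed
    define \<beta> where "\<beta> = C * (real k + 1) * P"
    have \<beta>0: "\<beta> > 0" using C P by (simp add: \<beta>_def)
    have \<beta>: "(\<integral>\<^sup>+y. ennreal (\<kappa> x y) \<partial>\<mu>) \<le> ennreal \<beta>" for x
    proof -
      have "(\<integral>\<^sup>+y. ennreal (\<kappa> x y) \<partial>\<mu>) = (\<integral>\<^sup>+y. ennreal (C1 * P) * (indicator (ball x 1) y * ennreal (trunc_riesz \<alpha> k (x - y))) \<partial>\<mu>)"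
        using C1(1) P by (intro nn_integral_cong) (auto simp: \<kappa>_def dist_real_def ennreal_mult[symmetric] mult_ac abs_less_iff split: split_indicator)
      also have "\<dots> = ennreal (C1 * P) * (\<integral>\<^sup>+y. indicator (ball x 1) y * ennreal (trunc_riesz \<alpha> k (x - y)) \<partial>\<mu>)"
      proof (rule nn_integral_cmult)
        have "indicator (ball x 1) \<in> borel_measurable borel" by (intro borel_measurable_indicator) simp
        thus "(\<lambda>y. indicator (ball x 1) y * ennreal (trunc_riesz \<alpha> k (x - y))) \<in> borel_measurable \<mu>" by measurable
      qed
      also have "\<dots> \<le> ennreal (C1 * P) * ennreal (C2 * (real k + 1))" by (intro mult_left_mono C2) auto
      also have "\<dots> = ennreal (C1 * C2 * (real k + 1) * P)" using C1(1) C2(1) P by (simp add: ennreal_mult[symmetric] mult_ac)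
      also have "\<dots> \<le> ennreal \<beta>" unfolding \<beta>_def C_def using P by (intro ennreal_leI mult_right_mono) auto
      finally show ?thesis .
    qed
    define S where "S = (\<lambda>x. SUP i. ennreal (norm (\<integral>\<xi>. e i x \<xi> * g \<xi> \<partial>lborel) powr q))"
    have "S \<in> borel_measurable borel"
    proof -
      note [measurable] = em
      have [measurable]: "(\<lambda>x. \<integral>\<xi>. e i x \<xi> * g \<xi> \<partial>lborel) \<in> borel_measurable borel" for i
        by (rule lborel.borel_measurable_lebesgue_integral) measurable
      show ?thesis unfolding S_def by measurable
    qed
    moreover have "(\<integral>\<^sup>+x. S x \<partial>\<mu>) \<le> ennreal (\<beta> * (\<integral>\<xi>. (norm (g \<xi>))\<^sup>2 \<partial>lborel) powr (q/2))"
      unfolding S_def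
      by (rule maximal_TTstar_bound[OF fractal_measure_finite[OF \<mu>] s em e1 annulus_measurable Jfin g gJ \<kappa>m \<kappa>_sym kernel \<beta>0 \<beta> q])
    moreover have "ennreal (norm (\<integral>\<xi>. osc m x t c \<xi> * g \<xi> \<partial>lborel) powr q) \<le> S x"
      if x: "x \<in> I01" and t: "t \<in> I01" and c: "c \<in> insert 0 (range reg)" for x t c
    proof -
      \<comment> \<open>Continuity of the integral in t and c passes from rational times to all
        times, and from the regularisations to their limit c = 0.\<close>
      obtain Tn where Tn: "\<And>n. Tn n \<in> Q" "Tn \<longlonglongrightarrow> t" by (rule rational_approx_I01[OF t]) (auto simp: Q_def)
      obtain N where N: "(\<lambda>n. reg (N n)) \<longlonglongrightarrow> c"
      proof (cases "c = 0")
        case True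
        thus ?thesis using that[of "\<lambda>n. n"] reg_tendsto by simp
      next
        case False
        then obtain n where "c = reg n" using c by auto
        thus ?thesis using that[of "\<lambda>_. n"] by simp
      qed
      have lim: "(\<lambda>n. ennreal (norm (\<integral>\<xi>. osc m x (Tn n) (reg (N n)) \<xi> * g \<xi> \<partial>lborel) powr q)) \<longlonglongrightarrow> ennreal (norm (\<integral>\<xi>. osc m x t c \<xi> * g \<xi> \<partial>lborel) powr q)"
        using q by (intro tendsto_ennrealI tendsto_powr2 tendsto_norm osc_integral_tendsto gi Tn N tendsto_const) auto
      have "ennreal (norm (\<integral>\<xi>. osc m x (Tn n) (reg (N n)) \<xi> * g \<xi> \<partial>lborel) powr q) \<le> S x" for n
      proof -
        obtain i where "T i = Tn n" "R i = reg (N n)" using TR[OF Tn(1)] by blast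
        hence "(\<lambda>\<xi>. osc m x (Tn n) (reg (N n)) \<xi> * g \<xi>) = (\<lambda>\<xi>. e i x \<xi> * g \<xi>)" using x by (simp add: e_def)
        thus ?thesis unfolding S_def by (auto intro: SUP_upper)
      qed
      thus ?thesis by (intro LIMSEQ_le_const2[OF lim]) blast
    qed
    ultimately show ?thesis unfolding \<beta>_def P_def by (intro bexI[of _ S]) auto
  qed
  show ?thesis by (rule that[OF C main])
qed

section \<open>Summation over the annuli\<close>

lemma annulus_partition: "(\<Union>k. annulus k) = UNIV" "i \<noteq> j \<Longrightarrow> annulus i \<inter> annulus j = {}"
proof -
  have "\<exists>k. \<xi> \<in> annulus k" for \<xi>
  proof (cases "\<bar>\<xi>\<bar> < 2")
    case True
    thus ?thesis by (intro exI[of _ 0]) (auto simp: annulus_def)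
  next
    case False
    obtain n where n: "\<bar>\<xi>\<bar> < 2 ^ n" using real_arch_pow[of 2 "\<bar>\<xi>\<bar>"] by auto
    define k where "k = (LEAST n. \<bar>\<xi>\<bar> < 2 ^ n)"
    have k: "\<bar>\<xi>\<bar> < 2 ^ k" unfolding k_def using n by (rule LeastI)
    have "k \<noteq> 0"
    proof
      assume "k = 0"
      with k have "\<bar>\<xi>\<bar> < 1" by simp
      with False show False by linarith
    qed
    moreover have "k \<noteq> 1" using k False by auto
    ultimately
    obtain i where i: "k = Suc i" "i \<noteq> 0" by (cases k) auto
    have "\<not> \<bar>\<xi>\<bar> < 2 ^ i" using not_less_Least[of i "\<lambda>n. \<bar>\<xi>\<bar> < 2 ^ n"] i unfolding k_def by simp
    thus ?thesis using k i by (intro exI[of _ i]) (auto simp: annulus_def)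
  qed
  thus "(\<Union>k. annulus k) = UNIV" by auto
  have *: "annulus i \<inter> annulus j = {}" if "i < j" for i j
  proof -
    have "(2::real) ^ Suc i \<le> 2 ^ j" using that by (intro power_increasing) auto
    thus ?thesis using that by (auto simp: annulus_def abs_less_iff)
  qed
  show "i \<noteq> j \<Longrightarrow> annulus i \<inter> annulus j = {}"
    using *[of i j] *[of j i] by (cases i j rule: linorder_cases) auto
qed

lemma annulus_symbol_ge:
  assumes "\<xi> \<in> annulus k" "0 \<le> s"
  shows "(2 ^ k) powr (2 * s) \<le> (1 + \<xi>\<^sup>2) powr s"
proof -
  have "(2 ^ k)\<^sup>2 \<le> 1 + \<xi>\<^sup>2"
  proof (cases "k = 0")
    case False
    hence "(2 ^ k)\<^sup>2 \<le> \<bar>\<xi>\<bar>\<^sup>2" using assms(1) by (intro power_mono) (auto simp: annulus_def)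
    thus ?thesis by simp
  qed simp
  hence "((2 ^ k)\<^sup>2) powr s \<le> (1 + \<xi>\<^sup>2) powr s" using assms(2) by (intro powr_mono2) auto
  moreover have "((2 ^ k)\<^sup>2) powr s = ((2::real) ^ k) powr (2 * s)"
    using powr_powr[of "2 ^ k" 2 s] by simp
  ultimately show ?thesis by simp
qed

lemma propagator_reg_Suc:
  "propagator_reg m f x t (Suc n) = of_real (1 / (2 * pi)) * (\<integral>\<xi>. osc m x t (reg n) \<xi> * fhat f \<xi> \<partial>lborel)"
  unfolding propagator_reg_def osc_def reg_def cis_conv_exp by (simp add: add.commute)

lemma ennpowr_le:
  assumes "y \<le> ennreal r" "0 \<le> a"
  shows "ennpowr y a \<le> ennreal (r powr a)"
proof (cases "r \<ge> 0")
  case True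
  have "y < top" using assms(1) by (rule le_less_trans) simp
  moreover have "enn2real y \<le> r" using assms(1) True by (simp add: enn2real_leI)
  ultimately show ?thesis using assms(2) by (auto simp: ennpowr_def intro!: ennreal_leI powr_mono2)
next
  case False
  hence "y = 0" using assms(1) by (simp add: ennreal_neg)
  thus ?thesis by (simp add: ennpowr_def)
qed

text \<open>Two sums over the annuli are taken. Integrating the weighted sum \<open>T\<close> of
  maximal functions shows that it is finite \<mu>-almost everywhere; where it is finite, the k-th
  piece is at most a multiple of \<theta> ^ k, uniformly in t and in the regularisation, so that
  limit and sum may be exchanged.\<close>

lemma maximal_estimate:
  fixes m \<alpha> q s :: real
  assumes m: "0 < m" "m < 1" and \<alpha>: "0 < \<alpha>" "\<alpha> \<le> 1" and q: "2 \<le> q"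
    and s: "s > max (1/2 - m/4 - (1 - m) * \<alpha> / q) (1/2 - \<alpha> / q)"
    and \<mu>: "\<mu> \<in> fractal_measures \<alpha>"
  obtains C :: real where "C \<ge> 0" "\<And>f. f \<in> sobolev s \<Longrightarrow>
    (AE x in \<mu>. x \<in> I01 \<longrightarrow> (\<forall>t\<in>I01. propagator_defined m f x t)) \<and>
    mixed_norm q \<mu> (propagator m f) \<le> ennreal (C * sobolev_norm s f)"
proof -
  define \<sigma> where "\<sigma> = max (1/2 - m/4 - (1 - m) * \<alpha> / q) (1/2 - \<alpha> / q)"
  have \<sigma>: "1/2 - m/4 - (1 - m) * \<alpha> / q \<le> \<sigma>" "1/2 - \<alpha> / q \<le> \<sigma>" by (auto simp: \<sigma>_def)
  \<comment> \<open>Hence s > 0, so that \<open>fhat f\<close> is square-integrable and the symbol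
    is bounded below on each annulus by its size at 2 ^ k.\<close>
  have "\<alpha> / q \<le> 1 / 2" using \<alpha> q by (simp add: field_simps)
  hence \<sigma>0: "\<sigma> \<ge> 0" using \<sigma>(2) by linarith
  have s\<sigma>: "s > \<sigma>" using s by (simp add: \<sigma>_def)
  have s0: "s \<ge> 0" using \<sigma>0 s\<sigma> by linarith
  have sets: "sets \<mu> = sets borel" using \<mu> by (auto simp: fractal_measures_def)
  note [measurable_cong] = sets
  obtain C where C: "C > 0" "\<And>k g. in_L2 g \<Longrightarrow> (\<And>\<xi>. \<xi> \<notin> annulus k \<Longrightarrow> g \<xi> = 0) \<Longrightarrow>
    \<exists>S\<in>borel_measurable borel. (\<integral>\<^sup>+x. S x \<partial>\<mu>) \<le> ennreal (C * (real k + 1) * (2 ^ k) powr (\<sigma> * q) * (\<integral>\<xi>. (norm (g \<xi>))\<^sup>2 \<partial>lborel) powr (q/2)) \<and>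
      (\<forall>x\<in>I01. \<forall>t\<in>I01. \<forall>c\<in>insert 0 (range reg). ennreal (norm (\<integral>\<xi>. osc m x t c \<xi> * g \<xi> \<partial>lborel) powr q) \<le> S x)"
    by (rule annulus_maximal_bound[OF m \<alpha> q \<sigma> \<mu>]) blast
  \<comment> \<open>Half of the surplus of s pays for the weights in \<open>T\<close>, which become
    the decay \<theta> ^ k of the pieces; the other half makes the integral of \<open>T\<close> a
    convergent series with ratio \<rho>.\<close>
  define b where "b = (s - \<sigma>) / 2"
  have b: "b > 0" using s\<sigma> by (simp add: b_def)
  define \<rho> where "\<rho> = (2::real) powr (- (b * q))"
  have \<rho>: "0 < \<rho>" "\<rho> < 1" using b q by (auto simp: \<rho>_def powr_less_one)
  define \<theta> where "\<theta> = (2::real) powr (- b)"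
  have \<theta>: "0 < \<theta>" "\<theta> < 1" using b by (auto simp: \<theta>_def powr_less_one)
  have pw: "((2::real) ^ k) powr a = (2 powr a) ^ k" for k a
    by (simp add: powr_powr powr_realpow[symmetric] mult.commute)
  \<comment> \<open>The second factor is the sum of (k + 1) \<rho> ^ k, where k + 1 stems from the
    potential bound: here the logarithmic loss is absorbed.\<close>
  define C2 where "C2 = C * (1 / (1 - \<rho>)\<^sup>2)"
  have C2: "C2 \<ge> 0" using C(1) by (simp add: C2_def)
  define C3 where "C3 = 1 / (1 - \<theta>)"
  have C3: "C3 \<ge> 0" using \<theta> by (simp add: C3_def)
  define CC where "CC = (C3 powr q * C2) powr (1/q) * sqrt (2 * pi)"
  have main: "(AE x in \<mu>. x \<in> I01 \<longrightarrow> (\<forall>t\<in>I01. propagator_defined m f x t)) \<and>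
    mixed_norm q \<mu> (propagator m f) \<le> ennreal (CC * sobolev_norm s f)" if f: "f \<in> sobolev s" for f
  proof -
    note fh[measurable] = sobolev_fhat(1)[OF f]
    define h where "h = fhat f"
    have [measurable]: "h \<in> borel_measurable borel" using fh by (simp add: h_def)
    define I where "I = (\<integral>\<xi>. (1 + \<xi>\<^sup>2) powr s * (norm (h \<xi>))\<^sup>2 \<partial>lborel)"
    have Iint: "integrable lborel (\<lambda>\<xi>. (1 + \<xi>\<^sup>2) powr s * (norm (h \<xi>))\<^sup>2)"
      and I_le: "I \<le> 2 * pi * (sobolev_norm s f)\<^sup>2"
      using sobolev_fhat(2,3)[OF f] by (auto simp: h_def I_def)
    have I0: "I \<ge> 0" unfolding I_def by (intro integral_nonneg_AE AE_I2) auto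
    have h_le: "(norm (h \<xi>))\<^sup>2 \<le> (1 + \<xi>\<^sup>2) powr s * (norm (h \<xi>))\<^sup>2" for \<xi>
    proof -
      have "1 powr s \<le> (1 + \<xi>\<^sup>2) powr s" using s0 by (intro powr_mono2) auto
      thus ?thesis using mult_right_mono[of 1 "(1 + \<xi>\<^sup>2) powr s" "(norm (h \<xi>))\<^sup>2"] by simp
    qed
    have h2: "integrable lborel (\<lambda>\<xi>. (norm (h \<xi>))\<^sup>2)"
      by (rule Bochner_Integration.integrable_bound[OF Iint]) (use h_le in auto)
    define g where "g = (\<lambda>k \<xi>. indicator (annulus k) \<xi> * h \<xi>)"
    have gm[measurable]: "g k \<in> borel_measurable borel" for k unfolding g_def by measurable
    have g_le: "(norm (g k \<xi>))\<^sup>2 \<le> (2 ^ k) powr (- (2 * s)) * ((1 + \<xi>\<^sup>2) powr s * (norm (h \<xi>))\<^sup>2)" for k \<xi>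
    proof (cases "\<xi> \<in> annulus k")
      case True
      have "1 = ((2::real) ^ k) powr (- (2 * s)) * (2 ^ k) powr (2 * s)" by (simp add: powr_add[symmetric])
      also have "\<dots> \<le> (2 ^ k) powr (- (2 * s)) * (1 + \<xi>\<^sup>2) powr s"
        by (intro mult_left_mono annulus_symbol_ge True s0) auto
      finally have "1 \<le> (2 ^ k) powr (- (2 * s)) * (1 + \<xi>\<^sup>2) powr s" .
      from mult_right_mono[OF this, of "(norm (h \<xi>))\<^sup>2"] show ?thesis using True by (simp add: g_def mult.assoc)
    qed (simp add: g_def)
    have gL2: "in_L2 (g k)" for k
      unfolding in_L2_def
    proof
      show "integrable lborel (\<lambda>\<xi>. (norm (g k \<xi>))\<^sup>2)"
        by (rule Bochner_Integration.integrable_bound[OF h2]) (auto simp: g_def split: split_indicator)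
    qed measurable
    have gI: "(\<integral>\<xi>. (norm (g k \<xi>))\<^sup>2 \<partial>lborel) \<le> (2 ^ k) powr (- (2 * s)) * I" for k
    proof -
      have "(\<integral>\<xi>. (norm (g k \<xi>))\<^sup>2 \<partial>lborel) \<le> (\<integral>\<xi>. (2 ^ k) powr (- (2 * s)) * ((1 + \<xi>\<^sup>2) powr s * (norm (h \<xi>))\<^sup>2) \<partial>lborel)"
        using gL2[of k] Iint g_le by (intro integral_mono integrable_mult_right) (auto simp: in_L2_def)
      thus ?thesis by (simp add: I_def)
    qed
    define is_max where "is_max = (\<lambda>k S. S \<in> borel_measurable borel \<and>
      (\<integral>\<^sup>+x. S x \<partial>\<mu>) \<le> ennreal (C * (real k + 1) * (2 ^ k) powr (\<sigma> * q) * (\<integral>\<xi>. (norm (g k \<xi>))\<^sup>2 \<partial>lborel) powr (q/2)) \<and>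
      (\<forall>x\<in>I01. \<forall>t\<in>I01. \<forall>c\<in>insert 0 (range reg). ennreal (norm (\<integral>\<xi>. osc m x t c \<xi> * g k \<xi> \<partial>lborel) powr q) \<le> S x))"
    have "\<exists>S. is_max k S" for k
      using C(2)[OF gL2, of k k] unfolding is_max_def by (simp add: g_def Bex_def)
    then obtain S where is_max: "\<And>k. is_max k (S k)" by metis
    have Sm[measurable]: "S k \<in> borel_measurable borel"
      and SI: "(\<integral>\<^sup>+x. S k x \<partial>\<mu>) \<le> ennreal (C * (real k + 1) * (2 ^ k) powr (\<sigma> * q) * (\<integral>\<xi>. (norm (g k \<xi>))\<^sup>2 \<partial>lborel) powr (q/2))"
      and S: "x \<in> I01 \<Longrightarrow> t \<in> I01 \<Longrightarrow> c \<in> insert 0 (range reg) \<Longrightarrow> ennreal (norm (\<integral>\<xi>. osc m x t c \<xi> * g k \<xi> \<partial>lborel) powr q) \<le> S k x"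
      for k x t c
      using is_max[of k] unfolding is_max_def by blast+
    define T where "T = (\<lambda>x. \<Sum>k. ennreal ((2 ^ k) powr (b * q)) * S k x)"
    have [measurable]: "T \<in> borel_measurable borel" unfolding T_def by measurable
    have TI: "(\<integral>\<^sup>+x. T x \<partial>\<mu>) \<le> ennreal (C2 * I powr (q/2))"
    proof -
      have "(\<integral>\<^sup>+x. T x \<partial>\<mu>) = (\<Sum>k. \<integral>\<^sup>+x. ennreal ((2 ^ k) powr (b * q)) * S k x \<partial>\<mu>)"
        unfolding T_def by (intro nn_integral_suminf) measurable
      also have "\<dots> = (\<Sum>k. ennreal ((2 ^ k) powr (b * q)) * (\<integral>\<^sup>+x. S k x \<partial>\<mu>))"
        by (intro suminf_cong nn_integral_cmult) measurable
      also have "\<dots> \<le> (\<Sum>k. ennreal (C * I powr (q/2) * (of_nat (Suc k) * \<rho> ^ k)))"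
      proof (intro suminf_le summableI)
        fix k
        have "C * (real k + 1) * (2 ^ k) powr (\<sigma> * q) * (\<integral>\<xi>. (norm (g k \<xi>))\<^sup>2 \<partial>lborel) powr (q/2)
           \<le> C * (real k + 1) * (2 ^ k) powr (\<sigma> * q) * ((2 ^ k) powr (- (2 * s)) * I) powr (q/2)"
          using gI[of k] q C(1) by (intro mult_left_mono powr_mono2) auto
        also have "((2 ^ k) powr (- (2 * s)) * I) powr (q/2) = (2 ^ k) powr (- (s * q)) * I powr (q/2)"
          using I0 by (simp add: powr_mult powr_powr)
        finally have le: "C * (real k + 1) * (2 ^ k) powr (\<sigma> * q) * (\<integral>\<xi>. (norm (g k \<xi>))\<^sup>2 \<partial>lborel) powr (q/2)
           \<le> C * (real k + 1) * (2 ^ k) powr (\<sigma> * q) * ((2 ^ k) powr (- (s * q)) * I powr (q/2))" .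
        have "ennreal ((2 ^ k) powr (b * q)) * (\<integral>\<^sup>+x. S k x \<partial>\<mu>) \<le>
          ennreal ((2 ^ k) powr (b * q)) * ennreal (C * (real k + 1) * (2 ^ k) powr (\<sigma> * q) * ((2 ^ k) powr (- (s * q)) * I powr (q/2)))"
          by (intro mult_left_mono order_trans[OF SI] ennreal_leI le) auto
        also have "\<dots> = ennreal ((2 ^ k) powr (b * q) * (C * (real k + 1) * (2 ^ k) powr (\<sigma> * q) * ((2 ^ k) powr (- (s * q)) * I powr (q/2))))"
          using C(1) by (intro ennreal_mult[symmetric]) auto
        also have "(2 ^ k) powr (b * q) * (C * (real k + 1) * (2 ^ k) powr (\<sigma> * q) * ((2 ^ k) powr (- (s * q)) * I powr (q/2)))
          = C * I powr (q/2) * ((real k + 1) * ((2 ^ k) powr (b * q) * ((2 ^ k) powr (\<sigma> * q) * (2 ^ k) powr (- (s * q)))))"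
          by (simp add: mult_ac)
        also have "((2::real) ^ k) powr (b * q) * ((2 ^ k) powr (\<sigma> * q) * (2 ^ k) powr (- (s * q))) = (2 ^ k) powr (- (b * q))"
        proof -
          have "b * q + (\<sigma> * q + - (s * q)) = - (b * q)" by (simp add: b_def field_simps)
          thus ?thesis by (simp only: powr_add[symmetric])
        qed
        also have "\<dots> = \<rho> ^ k" unfolding \<rho>_def by (rule pw)
        finally show "ennreal ((2 ^ k) powr (b * q)) * (\<integral>\<^sup>+x. S k x \<partial>\<mu>) \<le> ennreal (C * I powr (q/2) * (of_nat (Suc k) * \<rho> ^ k))"
          by (simp add: add.commute)
      qed
      also have "\<dots> = ennreal (\<Sum>k. C * I powr (q/2) * (of_nat (Suc k) * \<rho> ^ k))"
        using C(1) \<rho> geometric_deriv_sums[of \<rho>]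
        by (intro suminf_ennreal2 summable_mult) (auto simp: sums_iff simp del: of_nat_Suc)
      also have "(\<Sum>k. C * I powr (q/2) * (of_nat (Suc k) * \<rho> ^ k)) = C2 * I powr (q/2)"
        using sums_unique[OF sums_mult[OF geometric_deriv_sums[of \<rho>], of "C * I powr (q/2)"]] \<rho>
        by (simp add: C2_def)
      finally show ?thesis .
    qed
    define A where "A = (\<lambda>k x t c. \<integral>\<xi>. osc m x t c \<xi> * g k \<xi> \<partial>lborel)"
    \<comment> \<open>For fixed n the Gaussian makes the integral of the L2 function
      \<open>h\<close> absolutely convergent, so that it splits over the partition.\<close>
    have split: "(\<integral>\<xi>. osc m x t (reg n) \<xi> * h \<xi> \<partial>lborel) = (\<Sum>k. A k x t (reg n))" for x t n
    proof -
      have gx: "integrable lborel (\<lambda>\<xi>. exp (- (reg n * \<xi>\<^sup>2)))"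
      proof -
        have "(\<lambda>\<xi>. exp (- (reg n * \<xi>\<^sup>2))) = gexp ((real n + 1) / sqrt 2)"
          by (auto simp: gexp_def reg_def power_divide field_simps)
        thus ?thesis using integrable_gexp[of "(real n + 1) / sqrt 2"] by simp
      qed
      have int: "integrable lborel (\<lambda>\<xi>. osc m x t (reg n) \<xi> * h \<xi>)"
      proof (rule Bochner_Integration.integrable_bound)
        show "integrable lborel (\<lambda>\<xi>. exp (- (reg n * \<xi>\<^sup>2)) + (norm (h \<xi>))\<^sup>2)" using gx h2 by auto
        show "AE \<xi> in lborel. norm (osc m x t (reg n) \<xi> * h \<xi>) \<le> norm (exp (- (reg n * \<xi>\<^sup>2)) + (norm (h \<xi>))\<^sup>2)"
        proof (rule AE_I2)
          fix \<xi>
          let ?E = "exp (- (reg n * \<xi>\<^sup>2))" and ?h = "norm (h \<xi>)"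
          have E: "0 \<le> ?E" "?E \<le> 1" by auto
          have "2 * (?E * ?h) \<le> ?E * ?E + ?h\<^sup>2" using sum_squares_bound[of ?E ?h] by (simp add: power2_eq_square)
          also have "?E * ?E \<le> ?E" using E by (simp add: mult_left_le_one_le)
          finally have "?E * ?h \<le> ?E + ?h\<^sup>2" using mult_nonneg_nonneg[OF E(1) norm_ge_zero[of "h \<xi>"]] by linarith
          thus "norm (osc m x t (reg n) \<xi> * h \<xi>) \<le> norm (?E + ?h\<^sup>2)" by (simp add: osc_def norm_mult)
        qed
      qed measurable
      have "(\<integral>\<xi>. osc m x t (reg n) \<xi> * h \<xi> \<partial>lborel) = (\<integral>\<xi>\<in>(\<Union>k. annulus k). osc m x t (reg n) \<xi> * h \<xi> \<partial>lborel)"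
        by (simp add: annulus_partition(1) set_lebesgue_integral_def)
      also have "\<dots> = (\<Sum>k. \<integral>\<xi>\<in>annulus k. osc m x t (reg n) \<xi> * h \<xi> \<partial>lborel)"
        by (rule lebesgue_integral_countable_add) (use annulus_partition int in \<open>auto simp: set_integrable_def\<close>)
      also have "(\<lambda>k. \<integral>\<xi>\<in>annulus k. osc m x t (reg n) \<xi> * h \<xi> \<partial>lborel) = (\<lambda>k. A k x t (reg n))"
        unfolding A_def g_def set_lebesgue_integral_def
        by (intro ext Bochner_Integration.integral_cong) (auto split: split_indicator)
      finally show ?thesis .
    qed
    have pointwise: "propagator_defined m f x t \<and> ennreal (norm (propagator m f x t) powr q) \<le> ennreal (C3 powr q) * T x"
      if x: "x \<in> I01" and t: "t \<in> I01" and fin: "T x < \<infinity>" for x t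
    proof -
      define \<tau> where "\<tau> = enn2real (T x)"
      have \<tau>: "T x = ennreal \<tau>" "\<tau> \<ge> 0" using fin by (auto simp: \<tau>_def)
      have A_le: "norm (A k x t c) \<le> \<theta> ^ k * \<tau> powr (1/q)" if c: "c \<in> insert 0 (range reg)" for k c
      proof -
        have "ennreal ((2 ^ k) powr (b * q)) * ennreal (norm (A k x t c) powr q) \<le> ennreal ((2 ^ k) powr (b * q)) * S k x"
          unfolding A_def by (intro mult_left_mono S x t c) auto
        also have "\<dots> \<le> T x"
          unfolding T_def using sum_le_suminf[of "\<lambda>k. ennreal ((2 ^ k) powr (b * q)) * S k x" "{k}"] by (auto intro: summableI)
        finally have "(2 ^ k) powr (b * q) * norm (A k x t c) powr q \<le> \<tau>"
          using \<tau> by (simp add: ennreal_mult[symmetric])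
        hence "((2 ^ k) powr (b * q) * norm (A k x t c) powr q) powr (1/q) \<le> \<tau> powr (1/q)"
          using q by (intro powr_mono2) auto
        also have "((2 ^ k) powr (b * q) * norm (A k x t c) powr q) powr (1/q) = (2 ^ k) powr b * norm (A k x t c)"
          using q by (simp add: powr_mult powr_powr)
        finally have "(2 ^ k) powr (- b) * ((2 ^ k) powr b * norm (A k x t c)) \<le> (2 ^ k) powr (- b) * \<tau> powr (1/q)"
          by (intro mult_left_mono) auto
        moreover have "((2::real) ^ k) powr (- b) * (2 ^ k) powr b = 1" by (simp add: powr_add[symmetric])
        ultimately show ?thesis unfolding \<theta>_def pw[symmetric] by (simp add: mult.assoc[symmetric])
      qed
      have hint: "integrable lborel (g k)" for k
        by (rule integrable_L2_annulus[OF gL2, of k k]) (simp add: g_def)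
      have sM: "summable (\<lambda>k. \<theta> ^ k * \<tau> powr (1/q))" using \<theta> by (intro summable_mult2 summable_geometric) auto
      \<comment> \<open>Tannery's theorem, with a geometric majorant that is uniform in n.\<close>
      have tann: "summable (\<lambda>k. norm (A k x t 0)) \<and> (\<lambda>n. \<Sum>k. A k x t (reg n)) \<longlonglongrightarrow> (\<Sum>k. A k x t 0)"
      proof -
        have lims: "(\<lambda>n. A k x t (reg n)) \<longlonglongrightarrow> A k x t 0" for k
          unfolding A_def by (intro osc_integral_tendsto hint reg_tendsto tendsto_const) auto
        have bnd: "\<forall>\<^sub>F (k, n) in sequentially \<times>\<^sub>F sequentially. norm (A k x t (reg n)) \<le> \<theta> ^ k * \<tau> powr (1/q)"
          using A_le by (intro always_eventually) auto
        from tannerys_theorem[where a = "\<lambda>k n. A k x t (reg n)" and b = "\<lambda>k. A k x t 0", OF lims bnd sM]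
        show ?thesis by simp
      qed
      let ?V = "of_real (1 / (2 * pi)) * (\<Sum>k. A k x t 0)"
      have "(\<lambda>n. propagator_reg m f x t (Suc n)) \<longlonglongrightarrow> ?V"
        unfolding propagator_reg_Suc h_def[symmetric] split using tann by (intro tendsto_intros) auto
      \<comment> \<open>Shifting the sequence back brings in N = 0, whose value does not affect the
        limit.\<close>
      hence lim: "propagator_reg m f x t \<longlonglongrightarrow> ?V" by (rule LIMSEQ_imp_Suc)
      hence def: "propagator_defined m f x t" by (auto simp: propagator_defined_def convergent_def)
      have "propagator m f x t = ?V" using def lim by (simp add: propagator_def limI)
      hence "norm (propagator m f x t) = 1 / (2 * pi) * norm (\<Sum>k. A k x t 0)" by (simp add: norm_mult norm_divide)
      also have "\<dots> \<le> 1 * norm (\<Sum>k. A k x t 0)" using pi_ge_two by (intro mult_right_mono) auto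
      also have "\<dots> \<le> (\<Sum>k. norm (A k x t 0))" using tann by (simp add: summable_norm)
      also have "\<dots> \<le> (\<Sum>k. \<theta> ^ k * \<tau> powr (1/q))" using A_le tann sM by (intro suminf_le) auto
      also have "\<dots> = C3 * \<tau> powr (1/q)"
        using \<theta> suminf_mult2[of "\<lambda>k. \<theta> ^ k" "\<tau> powr (1/q)"] suminf_geometric[of \<theta>] by (simp add: C3_def)
      finally have "norm (propagator m f x t) powr q \<le> (C3 * \<tau> powr (1/q)) powr q" using q by (intro powr_mono2) auto
      also have "\<dots> = C3 powr q * \<tau>" using q C3 \<tau>(2) by (simp add: powr_mult powr_powr)
      finally have "ennreal (norm (propagator m f x t) powr q) \<le> ennreal (C3 powr q) * T x"
        using \<tau> by (simp add: ennreal_mult[symmetric])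
      thus ?thesis using def by simp
    qed
    have AEfin: "AE x in \<mu>. T x < \<infinity>"
    proof -
      have "(\<integral>\<^sup>+x. T x \<partial>\<mu>) \<noteq> \<infinity>" using TI by (auto simp: top_unique)
      hence "AE x in \<mu>. T x \<noteq> \<infinity>" by (intro nn_integral_PInf_AE) measurable
      thus ?thesis by eventually_elim (simp add: less_top)
    qed
    have "(\<integral>\<^sup>+x\<in>I01. (SUP t\<in>I01. ennreal (norm (propagator m f x t) powr q)) \<partial>\<mu>) \<le> (\<integral>\<^sup>+x. ennreal (C3 powr q) * T x \<partial>\<mu>)"
      using AEfin by (intro nn_integral_mono_AE, eventually_elim)
        (auto intro!: SUP_least simp: pointwise split: split_indicator)
    also have "\<dots> = ennreal (C3 powr q) * (\<integral>\<^sup>+x. T x \<partial>\<mu>)" by (intro nn_integral_cmult) measurable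
    also have "\<dots> \<le> ennreal (C3 powr q) * ennreal (C2 * I powr (q/2))" by (intro mult_left_mono TI) auto
    also have "\<dots> = ennreal ((C3 powr q * C2) * I powr (q/2))" using C2 by (simp add: ennreal_mult[symmetric] mult.assoc)
    finally have "mixed_norm q \<mu> (propagator m f) \<le> ennreal (((C3 powr q * C2) * I powr (q/2)) powr (1/q))"
      unfolding mixed_norm_def using q by (intro ennpowr_le) auto
    also have "\<dots> \<le> ennreal (CC * sobolev_norm s f)"
    proof (rule ennreal_leI)
      have n0: "sobolev_norm s f \<ge> 0"
        unfolding sobolev_norm_def L2_norm_fun_def by (intro real_sqrt_ge_zero integral_nonneg_AE AE_I2) auto
      have "((C3 powr q * C2) * I powr (q/2)) powr (1/q) = (C3 powr q * C2) powr (1/q) * sqrt I"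
        using q C2 I0 by (simp add: powr_mult powr_powr powr_half_sqrt)
      also have "sqrt I \<le> sqrt (2 * pi * (sobolev_norm s f)\<^sup>2)" using I_le by simp
      also have "\<dots> = sqrt (2 * pi) * sobolev_norm s f" using n0 by (simp add: real_sqrt_mult)
      finally show "((C3 powr q * C2) * I powr (q/2)) powr (1/q) \<le> CC * sobolev_norm s f"
        by (simp add: CC_def mult.assoc mult_left_mono)
    qed
    finally show ?thesis using AEfin pointwise by (auto elim!: eventually_mono)
  qed
  have "CC \<ge> 0" by (simp add: CC_def)
  thus ?thesis using main by (rule that)
qed

section \<open>Sharpness\<close>

lemma inv_fourier_multiplication_formula:
  assumes "integrable lborel f" "integrable lborel g"
  shows "(\<integral>x. f x * inv_fourier g x \<partial>lborel) = (\<integral>\<xi>. inv_fourier f \<xi> * g \<xi> \<partial>lborel)"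
proof -
  have "(\<integral>x. f x * (\<integral>y. cis (x * y) * g y \<partial>lborel) \<partial>lborel) =
        (\<integral>y. g y * (\<integral>x. cis (x * y) * f x \<partial>lborel) \<partial>lborel)"
    using assms by (intro Fubini_bounded_kernel[where B = 1] sigma_finite_lborel) auto
  also have "(\<lambda>y. g y * (\<integral>x. cis (x * y) * f x \<partial>lborel)) = (\<lambda>y. g y * (\<integral>x. cis (y * x) * f x \<partial>lborel))"
    by (simp add: mult.commute)
  finally have base: "(\<integral>x. f x * (\<integral>y. cis (x * y) * g y \<partial>lborel) \<partial>lborel) =
        (\<integral>y. g y * (\<integral>x. cis (y * x) * f x \<partial>lborel) \<partial>lborel)" .
  define c :: complex where "c = of_real (1 / (2 * pi))"
  have "(\<integral>x. f x * inv_fourier g x \<partial>lborel) = (\<integral>x. c * (f x * (\<integral>y. cis (x * y) * g y \<partial>lborel)) \<partial>lborel)"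
    unfolding inv_fourier_cis c_def by (simp only: mult.left_commute)
  also have "\<dots> = (\<integral>y. c * (g y * (\<integral>x. cis (y * x) * f x \<partial>lborel)) \<partial>lborel)"
    unfolding integral_mult_right_zero base ..
  also have "\<dots> = (\<integral>\<xi>. inv_fourier f \<xi> * g \<xi> \<partial>lborel)"
    unfolding inv_fourier_cis c_def by (intro Bochner_Integration.integral_cong) auto
  finally show ?thesis .
qed

lemma inv_fourier_L2:
  assumes g: "integrable lborel g" and g2: "in_L2 g"
  shows "in_L2 (inv_fourier g)" "(\<integral>x. (norm (inv_fourier g x))\<^sup>2 \<partial>lborel) \<le> (\<integral>\<xi>. (norm (g \<xi>))\<^sup>2 \<partial>lborel)"
proof -
  note [measurable] = inv_fourier_measurable[OF g] fourier_measurable[OF g]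
  have "(\<integral>\<^sup>+x. ennreal ((norm (inv_fourier g x))\<^sup>2) \<partial>lborel)
     = (\<integral>\<^sup>+x. ennreal ((1 / (2 * pi))\<^sup>2) * ennreal ((norm (fourier g (- x)))\<^sup>2) \<partial>lborel)"
    by (intro nn_integral_cong) (simp add: inv_fourier_eq norm_mult power_mult_distrib norm_divide power_divide ennreal_mult[symmetric])
  also have "\<dots> = ennreal ((1 / (2 * pi))\<^sup>2) * (\<integral>\<^sup>+x. ennreal ((norm (fourier g (- x)))\<^sup>2) \<partial>lborel)"
    by (intro nn_integral_cmult) measurable
  also have "(\<integral>\<^sup>+x. ennreal ((norm (fourier g (- x)))\<^sup>2) \<partial>lborel) = (\<integral>\<^sup>+x. ennreal ((norm (fourier g x))\<^sup>2) \<partial>lborel)"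
    using nn_integral_real_affine[of "\<lambda>x. ennreal ((norm (fourier g x))\<^sup>2)" "-1" 0] by simp
  also have "ennreal ((1 / (2 * pi))\<^sup>2) * \<dots> \<le> ennreal ((1 / (2 * pi))\<^sup>2) * (ennreal (2 * pi) * (\<integral>\<^sup>+x. ennreal ((norm (g x))\<^sup>2) \<partial>lborel))"
    by (intro mult_left_mono Plancherel_le g) auto
  also have "\<dots> = ennreal ((1 / (2 * pi))\<^sup>2 * (2 * pi * (\<integral>x. (norm (g x))\<^sup>2 \<partial>lborel)))"
    unfolding in_L2_nn_eq[OF g2] by (simp add: ennreal_mult[symmetric])
  also have "\<dots> \<le> ennreal (\<integral>x. (norm (g x))\<^sup>2 \<partial>lborel)"
  proof (rule ennreal_leI)
    have "(1 / (2 * pi))\<^sup>2 * (2 * pi * (\<integral>x. (norm (g x))\<^sup>2 \<partial>lborel)) = (1 / (2 * pi)) * (\<integral>x. (norm (g x))\<^sup>2 \<partial>lborel)"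
      by (simp add: power2_eq_square)
    also have "\<dots> \<le> 1 * (\<integral>x. (norm (g x))\<^sup>2 \<partial>lborel)"
      using pi_ge_two by (intro mult_right_mono) auto
    finally show "(1 / (2 * pi))\<^sup>2 * (2 * pi * (\<integral>x. (norm (g x))\<^sup>2 \<partial>lborel)) \<le> (\<integral>x. (norm (g x))\<^sup>2 \<partial>lborel)" by simp
  qed
  finally have le: "(\<integral>\<^sup>+x. ennreal ((norm (inv_fourier g x))\<^sup>2) \<partial>lborel) \<le> ennreal (\<integral>x. (norm (g x))\<^sup>2 \<partial>lborel)" .
  show L2: "in_L2 (inv_fourier g)" unfolding in_L2_nn using le by (auto intro: le_less_trans)
  show "(\<integral>x. (norm (inv_fourier g x))\<^sup>2 \<partial>lborel) \<le> (\<integral>\<xi>. (norm (g \<xi>))\<^sup>2 \<partial>lborel)"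
    using le unfolding in_L2_nn_eq[OF L2] by (subst (asm) ennreal_le_iff) auto
qed

section \<open>Frequency bands as Sobolev distributions\<close>

lemma schwartz_seminorm_upper:
  assumes "\<phi> \<in> schwartz"
  shows "norm (x ^ j *\<^sub>R (vderiv ^^ k) \<phi> x) \<le> schwartz_seminorm j k \<phi>"
proof -
  have "bounded (range (\<lambda>x. x ^ j *\<^sub>R (vderiv ^^ k) \<phi> x))" using assms by (simp add: schwartz_def)
  hence "bdd_above (range (\<lambda>x. norm (x ^ j *\<^sub>R (vderiv ^^ k) \<phi> x)))"
    by (auto simp: bounded_iff bdd_above_def)
  thus ?thesis unfolding schwartz_seminorm_def by (intro cSUP_upper) auto
qed

lemma schwartz_seminorm_nonneg: "\<phi> \<in> schwartz \<Longrightarrow> 0 \<le> schwartz_seminorm j k \<phi>"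
  using schwartz_seminorm_upper[of \<phi> 0 j k] norm_ge_zero order_trans by blast

text \<open>Continuity of \<open>band\<close> is measured through the L1 norm of the test function.
  The two seminorms with weights 1 and \<open>x\<^sup>2\<close> and no derivative control it; the
  sum is enlarged to the shape that \<open>tempered\<close> asks for.\<close>

lemma L1_le_seminorms:
  assumes "\<phi> \<in> schwartz"
  shows "(\<integral>x. norm (\<phi> x) \<partial>lborel) \<le> (integral\<^sup>L lborel (\<lambda>x::real. inverse (1 + x\<^sup>2))) * (\<Sum>j\<le>2. \<Sum>k\<le>2. schwartz_seminorm j k \<phi>)"
proof -
  let ?P = "schwartz_seminorm 0 0 \<phi> + schwartz_seminorm 2 0 \<phi>"
  have "(\<integral>x. norm (\<phi> x) \<partial>lborel) \<le> (\<integral>x. inverse (1 + x\<^sup>2) * ?P \<partial>lborel)"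
  proof (rule integral_mono)
    show "integrable lborel (\<lambda>x. norm (\<phi> x))" using schwartz_integrable[OF assms] by simp
    show "integrable lborel (\<lambda>x. inverse (1 + x\<^sup>2) * ?P)" using integrable_inverse_quadratic by simp
    fix x :: real
    have "norm (\<phi> x) + x\<^sup>2 * norm (\<phi> x) \<le> ?P"
      using schwartz_seminorm_upper[OF assms, of x 0 0] schwartz_seminorm_upper[OF assms, of x 2 0] by simp
    moreover have "1 + x\<^sup>2 > 0" by (simp add: add_pos_nonneg)
    ultimately show "norm (\<phi> x) \<le> inverse (1 + x\<^sup>2) * ?P" by (simp add: field_simps)
  qed
  also have "\<dots> = (integral\<^sup>L lborel (\<lambda>x::real. inverse (1 + x\<^sup>2))) * ?P" by simp
  also have "\<dots> \<le> (integral\<^sup>L lborel (\<lambda>x::real. inverse (1 + x\<^sup>2))) * (\<Sum>j\<le>2. \<Sum>k\<le>2. schwartz_seminorm j k \<phi>)"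
  proof (rule mult_left_mono)
    have "?P = (\<Sum>(j, k)\<in>{(0, 0), (2, 0)}. schwartz_seminorm j k \<phi>)" by simp
    also have "\<dots> \<le> (\<Sum>(j, k)\<in>{..2} \<times> {..2}. schwartz_seminorm j k \<phi>)"
      by (intro sum_mono2) (auto simp: schwartz_seminorm_nonneg[OF assms])
    also have "\<dots> = (\<Sum>j\<le>2. \<Sum>k\<le>2. schwartz_seminorm j k \<phi>)" by (simp add: sum.cartesian_product)
    finally show "?P \<le> (\<Sum>j\<le>2. \<Sum>k\<le>2. schwartz_seminorm j k \<phi>)" .
    show "0 \<le> (integral\<^sup>L lborel (\<lambda>x::real. inverse (1 + x\<^sup>2)))" by (intro integral_nonneg_AE AE_I2) auto
  qed
  finally show ?thesis .
qed

text \<open>The inverse Fourier transform of the indicator function of \<open>[a, b]\<close>, as a distribution.\<close>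

definition band :: "real \<Rightarrow> real \<Rightarrow> distr" where
  "band a b \<phi> = (\<integral>\<xi>. indicator {a..b} \<xi> * inv_fourier \<phi> \<xi> \<partial>lborel)"

lemma integrable_indicator_Icc: "integrable lborel (\<lambda>\<xi>::real. indicator {a..b} \<xi> :: complex)"
proof -
  have "integrable lborel (\<lambda>\<xi>. complex_of_real (indicator {a..b} \<xi>))"
    by (intro integrable_of_real integrable_real_indicator) (auto simp: emeasure_lborel_Icc_eq)
  thus ?thesis by (simp add: of_real_indicator)
qed

lemma integrable_indicator_schwartz:
  assumes "\<phi> \<in> schwartz" shows "integrable lborel (\<lambda>\<xi>. indicator {a..b} \<xi> * \<phi> \<xi>)"
  by (intro integrable_bounded_mult[of _ _ _ 1] schwartz_integrable assms) (auto split: split_indicator)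

lemma band_tempered: "tempered (band a b)"
  unfolding tempered_def
proof (intro conjI ballI allI)
  fix \<phi> \<psi> assume \<phi>: "\<phi> \<in> schwartz" and \<psi>: "\<psi> \<in> schwartz"
  have "integrable lborel (\<lambda>\<xi>. cis (x * \<xi>) * \<phi> \<xi>)" "integrable lborel (\<lambda>\<xi>. cis (x * \<xi>) * \<psi> \<xi>)" for x
    by (intro integrable_cis_mult schwartz_integrable \<phi> \<psi>; simp)+
  hence "inv_fourier (\<lambda>x. \<phi> x + \<psi> x) = (\<lambda>\<xi>. inv_fourier \<phi> \<xi> + inv_fourier \<psi> \<xi>)"
    unfolding inv_fourier_cis by (simp add: distrib_left)
  thus "band a b (\<lambda>x. \<phi> x + \<psi> x) = band a b \<phi> + band a b \<psi>"
    using integrable_indicator_schwartz[OF inv_fourier_schwartz[OF \<phi>], of a b]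
      integrable_indicator_schwartz[OF inv_fourier_schwartz[OF \<psi>], of a b]
    by (simp add: band_def distrib_left)
next
  fix c \<phi> assume \<phi>: "\<phi> \<in> schwartz"
  have "inv_fourier (\<lambda>x. c * \<phi> x) \<xi> = c * inv_fourier \<phi> \<xi>" for \<xi>
    unfolding inv_fourier_cis by (simp add: mult.left_commute[of _ c])
  thus "band a b (\<lambda>x. c * \<phi> x) = c * band a b \<phi>"
    by (simp add: band_def mult.left_commute[of _ c])
next
  let ?l = "integral\<^sup>L lborel (\<lambda>\<xi>. indicat_real {a..b} \<xi>)" and ?D = "integral\<^sup>L lborel (\<lambda>x::real. inverse (1 + x\<^sup>2))"
  have "norm (band a b \<phi>) \<le> (?l * ?D) * (\<Sum>j\<le>2. \<Sum>k\<le>2. schwartz_seminorm j k \<phi>)" if \<phi>: "\<phi> \<in> schwartz" for \<phi>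
  proof -
    define N where "N = (\<integral>x. norm (\<phi> x) \<partial>lborel)"
    have N0: "N \<ge> 0" unfolding N_def by (intro integral_nonneg_AE AE_I2) auto
    have "norm (band a b \<phi>) \<le> (\<integral>\<xi>. indicat_real {a..b} \<xi> * N \<partial>lborel)"
      unfolding band_def
    proof (rule Bochner_Integration.integral_norm_bound_integral)
      show "integrable lborel (\<lambda>\<xi>. indicator {a..b} \<xi> * inv_fourier \<phi> \<xi>)"
        by (intro integrable_indicator_schwartz inv_fourier_schwartz \<phi>)
      show "integrable lborel (\<lambda>\<xi>. indicat_real {a..b} \<xi> * N)"
        by (intro integrable_mult_left integrable_real_indicator) (auto simp: emeasure_lborel_Icc_eq)
      fix \<xi>
      have "norm (inv_fourier \<phi> \<xi>) = 1 / (2 * pi) * norm (fourier \<phi> (- \<xi>))"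
        by (simp add: inv_fourier_eq norm_mult norm_divide)
      also have "\<dots> \<le> 1 * norm (fourier \<phi> (- \<xi>))" using pi_ge_two by (intro mult_right_mono) auto
      also have "\<dots> \<le> N" using norm_fourier_le[of \<phi> "- \<xi>"] by (simp add: N_def)
      finally show "norm (indicator {a..b} \<xi> * inv_fourier \<phi> \<xi>) \<le> indicat_real {a..b} \<xi> * N"
        by (auto simp: norm_mult split: split_indicator)
    qed
    also have "\<dots> = ?l * N" by (rule integral_mult_left_zero)
    also have "\<dots> \<le> ?l * (?D * (\<Sum>j\<le>2. \<Sum>k\<le>2. schwartz_seminorm j k \<phi>))"
      unfolding N_def by (intro mult_left_mono L1_le_seminorms \<phi> integral_nonneg_AE AE_I2) auto
    finally show ?thesis by (simp only: mult.assoc)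
  qed
  thus "\<exists>C n. \<forall>\<phi>\<in>schwartz. norm (band a b \<phi>) \<le> C * (\<Sum>j\<le>n. \<Sum>k\<le>n. schwartz_seminorm j k \<phi>)" by blast
qed

lemma band_fourier:
  assumes "\<phi> \<in> schwartz"
  shows "band a b (fourier \<phi>) = (\<integral>\<xi>. indicator {a..b} \<xi> * \<phi> \<xi> \<partial>lborel)"
  unfolding band_def fourier_inversion_schwartz[OF assms] ..

lemma fhat_band: "AE \<xi> in lborel. fhat (band a b) \<xi> = indicator {a..b} \<xi>" "fhat (band a b) \<in> borel_measurable borel"
proof -
  have r: "represents (indicator {a..b}) (distr_fourier (band a b))"
    unfolding represents_def distr_fourier_def
    by (auto simp: band_fourier intro: integrable_indicator_schwartz)
  from function_of_AE[OF this] show "AE \<xi> in lborel. fhat (band a b) \<xi> = indicator {a..b} \<xi>" "fhat (band a b) \<in> borel_measurable borel"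
    by (auto simp: fhat_def represents_def)
qed

text \<open>\<open>bessel s\<close> of the band is the inverse transform of the symbol restricted to
  the band. Its L2 norm is at most that of the restricted symbol, where a constant 1 / (2 \<pi>) has
  been estimated by 1.\<close>

lemma band_sobolev:
  assumes a: "\<And>\<xi>. \<xi> \<in> {a..b} \<Longrightarrow> (1 + \<xi>\<^sup>2) powr s \<le> K" and ab: "a \<le> b"
  shows "band a b \<in> sobolev s" "sobolev_norm s (band a b) \<le> sqrt (K * (b - a))"
proof -
  have K0: "K \<ge> 0" using a[of a] ab by (meson atLeastAtMost_iff order_refl order_trans powr_ge_zero)
  define g where "g = (\<lambda>\<xi>. of_real ((1 + \<xi>\<^sup>2) powr (s / 2)) * indicator {a..b} \<xi> :: complex)"
  have [measurable]: "g \<in> borel_measurable borel" unfolding g_def by measurable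
  have g2: "(norm (g \<xi>))\<^sup>2 \<le> K * indicator {a..b} \<xi>" for \<xi>
  proof -
    have "((1 + \<xi>\<^sup>2) powr (s / 2))\<^sup>2 = (1 + \<xi>\<^sup>2) powr s" by (simp add: power2_eq_square powr_add[symmetric])
    thus ?thesis using a[of \<xi>] by (auto simp: g_def norm_mult split: split_indicator)
  qed
  have Ki: "integrable lborel (\<lambda>\<xi>. K * indicat_real {a..b} \<xi>)"
    by (intro integrable_mult_right integrable_real_indicator) (auto simp: emeasure_lborel_Icc_eq)
  have gL2: "in_L2 g"
    unfolding in_L2_def
  proof
    show "integrable lborel (\<lambda>\<xi>. (norm (g \<xi>))\<^sup>2)"
      by (rule Bochner_Integration.integrable_bound[OF Ki]) (use g2 in \<open>auto intro: order_trans[OF _ abs_ge_self]\<close>)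
  qed measurable
  have gi: "integrable lborel g"
  proof -
    define r where "r = max \<bar>a\<bar> \<bar>b\<bar>"
    have "g = (\<lambda>\<xi>. indicator {- r..r} \<xi> * g \<xi>)"
      by (intro ext) (auto simp: g_def r_def abs_le_iff split: split_indicator)
    thus ?thesis using integrable_L2_truncation[OF gL2, of r] by simp
  qed
  define h where "h = inv_fourier g"
  have hL2: "in_L2 h" unfolding h_def by (rule inv_fourier_L2[OF gi gL2])
  have rep: "represents h (bessel s (band a b))"
    unfolding represents_def
  proof (intro conjI ballI)
    show "h \<in> borel_measurable borel" using hL2 by (simp add: in_L2_def)
    fix \<phi> assume \<phi>: "\<phi> \<in> schwartz"
    show "integrable lborel (\<lambda>x. h x * \<phi> x)" by (rule schwartz_integrable_mult_L2[OF hL2 \<phi>])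
    have "bessel s (band a b) \<phi> = band a b (fourier (\<lambda>\<xi>. of_real ((1 + \<xi>\<^sup>2) powr (s / 2)) * inv_fourier \<phi> \<xi>))"
      by (simp add: bessel_def distr_inv_fourier_def distr_mult_def distr_fourier_def)
    also have "\<dots> = (\<integral>\<xi>. indicator {a..b} \<xi> * (of_real ((1 + \<xi>\<^sup>2) powr (s / 2)) * inv_fourier \<phi> \<xi>) \<partial>lborel)"
      by (intro band_fourier schwartz_mult_symbol inv_fourier_schwartz \<phi>)
    also have "\<dots> = (\<integral>\<xi>. g \<xi> * inv_fourier \<phi> \<xi> \<partial>lborel)"
      by (simp add: g_def mult_ac)
    also have "\<dots> = (\<integral>x. h x * \<phi> x \<partial>lborel)"
      unfolding h_def by (rule inv_fourier_multiplication_formula[OF gi schwartz_integrable[OF \<phi>]])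
    finally show "bessel s (band a b) \<phi> = (\<integral>x. h x * \<phi> x \<partial>lborel)" .
  qed
  show "band a b \<in> sobolev s" unfolding sobolev_def using band_tempered hL2 rep by blast
  have "(L2_norm_fun (function_of (bessel s (band a b))))\<^sup>2 = (\<integral>x. (norm (h x))\<^sup>2 \<partial>lborel)"
    unfolding L2_norm_fun_square
  proof (rule integral_cong_AE)
    show "AE x in lborel. (norm (function_of (bessel s (band a b)) x))\<^sup>2 = (norm (h x))\<^sup>2"
      using function_of_AE(2)[OF rep] by eventually_elim simp
  qed (use function_of_AE(1)[OF rep] hL2 in \<open>auto simp: represents_def in_L2_def\<close>)
  also have "\<dots> \<le> (\<integral>\<xi>. (norm (g \<xi>))\<^sup>2 \<partial>lborel)" unfolding h_def by (rule inv_fourier_L2(2)[OF gi gL2])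
  also have "\<dots> \<le> (\<integral>\<xi>. K * indicat_real {a..b} \<xi> \<partial>lborel)"
    using gL2 Ki g2 by (intro integral_mono) (auto simp: in_L2_def)
  also have "\<dots> = K * (b - a)" using ab by simp
  finally show "sobolev_norm s (band a b) \<le> sqrt (K * (b - a))"
    unfolding sobolev_norm_def by (rule real_le_rsqrt)
qed

text \<open>If the phase stays within 1 of \<open>\<theta>\<close> on the band, rotation by
  \<open>cis (- \<theta>)\<close> leaves an integrand with real part at least cos 1 \<ge> 1/2, so
  nothing cancels.\<close>

lemma propagator_band_ge:
  assumes ab: "a \<le> b" and phase: "\<And>\<xi>. \<xi> \<in> {a..b} \<Longrightarrow> \<bar>x * \<xi> + t * \<bar>\<xi>\<bar> powr m - \<theta>\<bar> \<le> 1"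
  shows "(b - a) / (4 * pi) \<le> norm (propagator m (band a b) x t)"
proof -
  let ?i = "\<lambda>\<xi>. indicator {a..b} \<xi> :: complex"
  note [measurable] = fhat_band(2)
  have cosge: "1 / 2 \<le> cos y" if "\<bar>y\<bar> \<le> 1" for y :: real
  proof -
    have "cos (pi / 3) \<le> cos \<bar>y\<bar>" using that pi_gt3 by (intro cos_monotone_0_pi_le) auto
    thus ?thesis by (simp add: cos_60)
  qed
  have reg: "propagator_reg m (band a b) x t (Suc n) = of_real (1 / (2 * pi)) * (\<integral>\<xi>. osc m x t (1 / (real n + 1)\<^sup>2) \<xi> * ?i \<xi> \<partial>lborel)" for n
  proof -
    have "propagator_reg m (band a b) x t (Suc n) = of_real (1 / (2 * pi)) * (\<integral>\<xi>. osc m x t (1 / (real n + 1)\<^sup>2) \<xi> * fhat (band a b) \<xi> \<partial>lborel)"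
      unfolding propagator_reg_def osc_def cis_conv_exp by (simp add: add.commute)
    also have "(\<integral>\<xi>. osc m x t (1 / (real n + 1)\<^sup>2) \<xi> * fhat (band a b) \<xi> \<partial>lborel) = (\<integral>\<xi>. osc m x t (1 / (real n + 1)\<^sup>2) \<xi> * ?i \<xi> \<partial>lborel)"
      by (rule integral_cong_AE) (measurable, use fhat_band(1)[of a b] in \<open>eventually_elim, simp\<close>)
    finally show ?thesis .
  qed
  define V where "V = (\<integral>\<xi>. osc m x t 0 \<xi> * ?i \<xi> \<partial>lborel)"
  have "(\<lambda>n. \<integral>\<xi>. osc m x t (1 / (real n + 1)\<^sup>2) \<xi> * ?i \<xi> \<partial>lborel) \<longlonglongrightarrow> V"
    unfolding V_def
  proof (rule osc_integral_tendsto[OF integrable_indicator_Icc])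
    show "(\<lambda>n. 1 / (real n + 1)\<^sup>2) \<longlonglongrightarrow> 0" by real_asymp
  qed auto
  hence "(\<lambda>n. propagator_reg m (band a b) x t (Suc n)) \<longlonglongrightarrow> of_real (1 / (2 * pi)) * V"
    unfolding reg by (intro tendsto_intros)
  hence lim: "propagator_reg m (band a b) x t \<longlonglongrightarrow> of_real (1 / (2 * pi)) * V" by (rule LIMSEQ_imp_Suc)
  hence "propagator m (band a b) x t = of_real (1 / (2 * pi)) * V"
    by (auto simp: propagator_def propagator_defined_def convergent_def limI)
  hence P: "norm (propagator m (band a b) x t) = norm V / (2 * pi)" by (simp add: norm_mult norm_divide)
  define \<psi> where "\<psi> = (\<lambda>\<xi>. cis (x * \<xi> + t * \<bar>\<xi>\<bar> powr m - \<theta>) * ?i \<xi>)"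
  have \<psi>i: "integrable lborel \<psi>" unfolding \<psi>_def by (intro integrable_cis_mult integrable_indicator_Icc) measurable
  have "cis (- \<theta>) * V = (\<integral>\<xi>. \<psi> \<xi> \<partial>lborel)"
  proof -
    have "cis (- \<theta>) * (osc m x t 0 \<xi> * ?i \<xi>) = \<psi> \<xi>" for \<xi>
      by (simp add: osc_def \<psi>_def cis_mult mult.assoc[symmetric])
    thus ?thesis unfolding V_def by (subst integral_mult_right_zero[symmetric]) simp
  qed
  hence "norm V = norm (\<integral>\<xi>. \<psi> \<xi> \<partial>lborel)" by (metis mult_1 norm_cis norm_mult)
  also have "\<dots> \<ge> Re (\<integral>\<xi>. \<psi> \<xi> \<partial>lborel)" by (rule complex_Re_le_cmod)
  also have "Re (\<integral>\<xi>. \<psi> \<xi> \<partial>lborel) = (\<integral>\<xi>. Re (\<psi> \<xi>) \<partial>lborel)" using integral_Re[OF \<psi>i] by simp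
  also have "(\<integral>\<xi>. Re (\<psi> \<xi>) \<partial>lborel) \<ge> (\<integral>\<xi>. (1/2) * indicat_real {a..b} \<xi> \<partial>lborel)"
  proof (rule integral_mono)
    show "integrable lborel (\<lambda>\<xi>. (1/2) * indicat_real {a..b} \<xi>)"
      by (intro integrable_mult_right integrable_real_indicator) (auto simp: emeasure_lborel_Icc_eq)
    show "integrable lborel (\<lambda>\<xi>. Re (\<psi> \<xi>))" using \<psi>i by (rule integrable_Re)
    show "(1/2) * indicat_real {a..b} \<xi> \<le> Re (\<psi> \<xi>)" for \<xi>
      using cosge[OF phase[of \<xi>]] by (auto simp: \<psi>_def split: split_indicator)
  qed
  also have "(\<integral>\<xi>. (1/2) * indicat_real {a..b} \<xi> \<partial>lborel) = (b - a) / 2" using ab by simp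
  finally have "(b - a) / 2 \<le> norm V" by simp
  hence "(b - a) / 2 / (2 * pi) \<le> norm V / (2 * pi)" by (intro divide_right_mono) auto
  thus ?thesis unfolding P by simp
qed

text \<open>The measure with density \<open>\<alpha> x powr (\<alpha> - 1)\<close> on the unit interval, as an image of Lebesgue measure.\<close>

definition power_measure :: "real \<Rightarrow> real measure" where
  "power_measure \<alpha> = distr (density lborel (indicator {0<..<1})) borel (\<lambda>y. y powr (1 / \<alpha>))"

section \<open>The extremal measure\<close>

lemma emeasure_power_measure:
  assumes "A \<in> sets borel"
  shows "emeasure (power_measure \<alpha>) A = emeasure lborel {y \<in> {0<..<1}. y powr (1 / \<alpha>) \<in> A}"
proof -
  have m: "(\<lambda>y::real. y powr (1 / \<alpha>)) \<in> borel_measurable borel" by measurable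
  have vs: "(\<lambda>y. y powr (1 / \<alpha>)) -` A \<in> sets borel" using measurable_sets[OF m assms] by simp
  have "emeasure (power_measure \<alpha>) A = emeasure (density lborel (indicator {0<..<1})) ((\<lambda>y. y powr (1 / \<alpha>)) -` A)"
    unfolding power_measure_def using assms m by (subst emeasure_distr) auto
  also have "\<dots> = (\<integral>\<^sup>+y. indicator {0<..<1::real} y * indicator ((\<lambda>y. y powr (1 / \<alpha>)) -` A) y \<partial>lborel)"
    using vs by (subst emeasure_density) auto
  also have "\<dots> = (\<integral>\<^sup>+y. indicator ({0<..<1} \<inter> (\<lambda>y. y powr (1 / \<alpha>)) -` A) y \<partial>lborel)"
    by (intro nn_integral_cong) (auto split: split_indicator)
  also have "\<dots> = emeasure lborel ({0<..<1} \<inter> (\<lambda>y. y powr (1 / \<alpha>)) -` A)"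
    using vs by (intro nn_integral_indicator) auto
  also have "{0<..<1} \<inter> (\<lambda>y. y powr (1 / \<alpha>)) -` A = {y \<in> {0<..<1}. y powr (1 / \<alpha>) \<in> A}" by auto
  finally show ?thesis .
qed

lemma power_measure_greaterThanLessThan:
  assumes \<alpha>: "0 < \<alpha>" and \<delta>: "0 < \<delta>" "\<delta> \<le> 1"
  shows "emeasure (power_measure \<alpha>) {0<..<\<delta>} = ennreal (\<delta> powr \<alpha>)"
proof -
  have "{y \<in> {0<..<1}. y powr (1 / \<alpha>) \<in> {0<..<\<delta>}} = {0<..<\<delta> powr \<alpha>}"
  proof -
    have "y powr (1 / \<alpha>) < \<delta> \<longleftrightarrow> y < \<delta> powr \<alpha>" if "y > 0" for y
    proof
      assume "y powr (1 / \<alpha>) < \<delta>"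
      hence "(y powr (1 / \<alpha>)) powr \<alpha> < \<delta> powr \<alpha>" using \<alpha> by (intro powr_less_mono2) auto
      thus "y < \<delta> powr \<alpha>" using \<alpha> that by (simp add: powr_powr)
    next
      assume "y < \<delta> powr \<alpha>"
      hence "y powr (1 / \<alpha>) < (\<delta> powr \<alpha>) powr (1 / \<alpha>)" using \<alpha> that by (intro powr_less_mono2) auto
      thus "y powr (1 / \<alpha>) < \<delta>" using \<alpha> \<delta> by (simp add: powr_powr)
    qed
    moreover have "\<delta> powr \<alpha> \<le> 1" using \<delta> \<alpha> powr_mono2[of \<alpha> \<delta> 1] by simp
    ultimately show ?thesis by auto
  qed
  thus ?thesis by (subst emeasure_power_measure) auto
qed

lemma powr_superadditive:
  fixes a b p :: real
  assumes "0 \<le> a" "a \<le> b" "1 \<le> p"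
  shows "(b - a) powr p \<le> b powr p - a powr p"
proof (cases "b = 0")
  case False
  hence b: "b > 0" using assms by simp
  \<comment> \<open>For x up to b, x powr p is at most x times b powr (p - 1); applied to b - a and
    to a, the right sides add up to b powr p.\<close>
  have split: "x powr p \<le> x * b powr (p - 1)" if "0 \<le> x" "x \<le> b" for x
  proof (cases "x = 0")
    case False
    hence "x powr p = x * x powr (p - 1)" using that powr_add[of x 1 "p - 1"] by simp
    also have "\<dots> \<le> x * b powr (p - 1)" using that assms by (intro mult_left_mono powr_mono2) auto
    finally show ?thesis .
  qed simp
  have "(b - a) powr p + a powr p \<le> (b - a) * b powr (p - 1) + a * b powr (p - 1)"
    using assms by (intro add_mono split) auto
  also have "\<dots> = b * b powr (p - 1)" by (simp add: algebra_simps)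
  also have "\<dots> = b powr p" using b powr_add[of b 1 "p - 1"] by simp
  finally show ?thesis by simp
qed (use assms in auto)

text \<open>Points of the preimage of a ball of radius r have images less than 2 r apart, and since
  \<open>y powr (1 / \<alpha>)\<close> is superadditive, they are themselves less than (2 r) powr
  \<alpha> apart. The outer factor 2 comes from an interval extending to both sides of an arbitrary
  point of the preimage.\<close>

lemma power_measure_ball_le:
  assumes \<alpha>: "0 < \<alpha>" "\<alpha> \<le> 1" and r: "0 < r"
  shows "emeasure (power_measure \<alpha>) (ball x r) \<le> ennreal (2 * (2 * r) powr \<alpha>)"
proof -
  let ?p = "1 / \<alpha>"
  define E where "E = {y \<in> {0<..<1}. y powr ?p \<in> ball x r}"
  have p: "1 \<le> ?p" using \<alpha> by simp
  show ?thesis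
  proof (cases "E = {}")
    case True
    thus ?thesis unfolding E_def by (subst emeasure_power_measure, simp, simp only: emeasure_empty zero_le)
  next
    case False
    then obtain y0 where y0: "y0 \<in> E" by blast
    have close: "z - y < (2 * r) powr \<alpha>" if "y \<in> E" "z \<in> E" "y \<le> z" for y z
    proof -
      have "(z - y) powr ?p \<le> z powr ?p - y powr ?p"
        using that p by (intro powr_superadditive) (auto simp: E_def)
      also have "\<dots> < 2 * r" using that by (auto simp: E_def dist_real_def)
      finally have "((z - y) powr ?p) powr \<alpha> < (2 * r) powr \<alpha>" using \<alpha> by (intro powr_less_mono2) auto
      thus ?thesis using that \<alpha> by (simp add: powr_powr)
    qed
    let ?R = "(2 * r) powr \<alpha>"
    have "E \<subseteq> {y0 - ?R..y0 + ?R}"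
    proof
      fix z assume z: "z \<in> E"
      show "z \<in> {y0 - ?R..y0 + ?R}"
        using close[OF y0 z] close[OF z y0] r by (cases "y0 \<le> z") (auto intro: order_trans[OF _ powr_ge_zero])
    qed
    hence "emeasure lborel E \<le> emeasure lborel {y0 - ?R..y0 + ?R}" by (intro emeasure_mono) auto
    also have "\<dots> = ennreal (2 * ?R)" by simp
    finally show ?thesis by (subst emeasure_power_measure) (auto simp: E_def)
  qed
qed

lemma power_measure_fractal:
  assumes \<alpha>: "0 < \<alpha>" "\<alpha> \<le> 1"
  shows "power_measure \<alpha> \<in> fractal_measures \<alpha>"
proof -
  have "{y \<in> {0<..<1}. y powr (1 / \<alpha>) \<in> - cball 0 1} = {}"
  proof -
    have "y powr (1 / \<alpha>) \<le> 1" if "0 < y" "y < 1" for y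
      using that \<alpha> powr_mono2[of "1 / \<alpha>" y 1] by simp
    thus ?thesis by (auto simp: dist_real_def)
  qed
  hence "emeasure (power_measure \<alpha>) (- cball 0 1) = 0"
    by (subst emeasure_power_measure, simp, simp only: emeasure_empty)
  moreover have "dimensional \<alpha> (power_measure \<alpha>)"
  proof -
    have "emeasure (power_measure \<alpha>) (ball x r) / ennreal (r powr \<alpha>) \<le> ennreal (2 * 2 powr \<alpha>)" if r: "r > 0" for x r
    proof -
      have "emeasure (power_measure \<alpha>) (ball x r) / ennreal (r powr \<alpha>) \<le> ennreal (2 * (2 * r) powr \<alpha>) / ennreal (r powr \<alpha>)"
        by (intro divide_right_mono_ennreal power_measure_ball_le \<alpha> r)
      also have "\<dots> = ennreal (2 * 2 powr \<alpha>)" using r by (subst divide_ennreal) (auto simp: powr_mult)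
      finally show ?thesis .
    qed
    hence "(SUP x. SUP r\<in>{0<..}. emeasure (power_measure \<alpha>) (ball x r) / ennreal (r powr \<alpha>)) \<le> ennreal (2 * 2 powr \<alpha>)"
      by (intro SUP_least) auto
    also have "\<dots> < top" by simp
    finally show ?thesis unfolding dimensional_def .
  qed
  ultimately show ?thesis by (simp add: fractal_measures_def power_measure_def)
qed

text \<open>Each x below \<delta> contributes at least the value of
  \<open>propagator_band_ge\<close>, at a time that may vary with x, and these x have mass \<delta>
  powr \<alpha>.\<close>

lemma band_mixed_norm_ge:
  assumes \<alpha>: "0 < \<alpha>" and q: "2 \<le> q" and \<delta>: "0 < \<delta>" "\<delta> \<le> 1" and ab: "a \<le> b" and B: "0 \<le> B"
    and phase: "\<And>x. 0 < x \<Longrightarrow> x < \<delta> \<Longrightarrow> \<exists>t\<in>I01. \<exists>\<theta>. \<forall>\<xi>\<in>{a..b}. \<bar>x * \<xi> + t * \<bar>\<xi>\<bar> powr m - \<theta>\<bar> \<le> 1"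
    and le: "mixed_norm q (power_measure \<alpha>) (propagator m (band a b)) \<le> ennreal B"
  shows "(b - a) / (4 * pi) * \<delta> powr (\<alpha> / q) \<le> B"
proof -
  define c where "c = (b - a) / (4 * pi)"
  have c: "c \<ge> 0" using ab by (simp add: c_def)
  define Y where "Y = (\<integral>\<^sup>+x\<in>I01. (SUP t\<in>I01. ennreal (norm (propagator m (band a b) x t) powr q)) \<partial>power_measure \<alpha>)"
  have "ennreal (c powr q * \<delta> powr \<alpha>) = ennreal (c powr q) * emeasure (power_measure \<alpha>) {0<..<\<delta>}"
    using c by (simp add: power_measure_greaterThanLessThan[OF \<alpha> \<delta>] ennreal_mult)
  also have "\<dots> = (\<integral>\<^sup>+x. ennreal (c powr q) * indicator {0<..<\<delta>} x \<partial>power_measure \<alpha>)"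
    by (intro nn_integral_cmult_indicator[symmetric]) (simp add: power_measure_def)
  also have "\<dots> \<le> Y"
    unfolding Y_def
  proof (intro nn_integral_mono)
    fix x
    show "ennreal (c powr q) * indicator {0<..<\<delta>} x \<le> (SUP t\<in>I01. ennreal (norm (propagator m (band a b) x t) powr q)) * indicator I01 x"
    proof (cases "x \<in> {0<..<\<delta>}")
      case True
      hence "0 < x" "x < \<delta>" by auto
      from bexE[OF phase[OF this]] obtain t where t1: "t \<in> I01"
        and "\<exists>\<theta>. \<forall>\<xi>\<in>{a..b}. \<bar>x * \<xi> + t * \<bar>\<xi>\<bar> powr m - \<theta>\<bar> \<le> 1" .
      then obtain \<theta> where t2: "\<forall>\<xi>\<in>{a..b}. \<bar>x * \<xi> + t * \<bar>\<xi>\<bar> powr m - \<theta>\<bar> \<le> 1" by (elim exE)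
      have "ennreal (c powr q) \<le> ennreal (norm (propagator m (band a b) x t) powr q)"
        using c q propagator_band_ge[OF ab bspec[OF t2]] unfolding c_def by (intro ennreal_leI powr_mono2) auto
      also have "\<dots> \<le> (SUP t\<in>I01. ennreal (norm (propagator m (band a b) x t) powr q))"
        using t1 by (intro SUP_upper)
      finally show ?thesis using True \<delta> by simp
    qed simp
  qed
  finally have Y: "ennreal (c powr q * \<delta> powr \<alpha>) \<le> Y" .
  have le': "ennpowr Y (1 / q) \<le> ennreal B" using le by (simp add: mixed_norm_def Y_def)
  \<comment> \<open>\<open>ennpowr\<close> maps infinity to infinity, so a finite norm means a
    finite integral.\<close>
  hence Yfin: "Y \<noteq> top" by (auto simp: ennpowr_def top_unique)
  hence "c powr q * \<delta> powr \<alpha> \<le> enn2real Y" using enn2real_mono[OF Y] by (simp add: less_top)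
  hence "(c powr q * \<delta> powr \<alpha>) powr (1 / q) \<le> enn2real Y powr (1 / q)" using q by (intro powr_mono2) auto
  also have "\<dots> \<le> B" using le' Yfin B by (simp add: ennpowr_def ennreal_le_iff)
  also have "(c powr q * \<delta> powr \<alpha>) powr (1 / q) = c * \<delta> powr (\<alpha> / q)"
    using q c by (simp add: powr_mult powr_powr)
  finally show ?thesis by (simp add: c_def)
qed

text \<open>On the band |\<xi>| lies between L and 2 L, so \<open>1 + \<xi>\<^sup>2\<close> lies
  between \<open>L\<^sup>2\<close> and \<open>5 * L\<^sup>2\<close>, where 5 = 1 + 4 uses L \<ge> 1.
  The exponent |s| covers both signs of s.\<close>

lemma band_symbol_bound:
  fixes L w s \<xi> :: real
  assumes L: "1 \<le> L" and w: "w \<le> L" and \<xi>: "\<xi> \<in> {- (L + w)..- L}"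
  shows "(1 + \<xi>\<^sup>2) powr s \<le> 5 powr \<bar>s\<bar> * L powr (2 * s)"
proof -
  have L2: "L powr (2 * s) = (L\<^sup>2) powr s" using L powr_powr[of L 2 s] by simp
  have "L\<^sup>2 \<le> (- \<xi>)\<^sup>2" using \<xi> L by (intro power_mono) auto
  hence lo: "L\<^sup>2 \<le> 1 + \<xi>\<^sup>2" by simp
  have "(- \<xi>)\<^sup>2 \<le> (2 * L)\<^sup>2" using \<xi> L w by (intro power_mono) auto
  moreover have "1 \<le> L\<^sup>2" using L by simp
  ultimately have hi: "1 + \<xi>\<^sup>2 \<le> 5 * L\<^sup>2" by (simp add: power2_eq_square)
  show ?thesis
  proof (cases "s \<ge> 0")
    case True
    have "(1 + \<xi>\<^sup>2) powr s \<le> (5 * L\<^sup>2) powr s" using hi True by (intro powr_mono2) auto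
    thus ?thesis using True by (simp add: powr_mult L2)
  next
    case False
    have "(1 + \<xi>\<^sup>2) powr s \<le> (L\<^sup>2) powr s" using lo False L by (intro powr_mono2') auto
    also have "\<dots> \<le> 5 powr \<bar>s\<bar> * (L\<^sup>2) powr s"
      using ge_one_powr_ge_zero[of 5 "\<bar>s\<bar>"] by (simp add: mult_le_cancel_right1)
    finally show ?thesis by (simp add: L2)
  qed
qed

text \<open>With x and t positive, the derivative of the phase can vanish at negative frequencies
  only, and t is chosen so that it vanishes at -L; t < 1 is exactly x < m * L powr (m - 1). The
  second derivative has size at most L powr (m - 2) on the band, so over a length w the phase moves
  by at most 1 as long as \<open>w\<^sup>2 * L powr (m - 2) \<le> 1\<close>, which is the origin of
  L powr (1 - m/2).\<close>

lemma band_phase_stationary: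
  fixes m L x :: real
  assumes m: "0 < m" "m < 1" and L: "1 \<le> L" and x: "0 < x" "x < m * L powr (m - 1)"
  shows "\<exists>t\<in>I01. \<exists>\<theta>. \<forall>\<xi>\<in>{- (L + L powr (1 - m/2))..- L}. \<bar>x * \<xi> + t * \<bar>\<xi>\<bar> powr m - \<theta>\<bar> \<le> 1"
proof -
  let ?w = "L powr (1 - m/2)"
  define t where "t = x * L powr (1 - m) / m"
  \<comment> \<open>The phase at -\<eta> divided by t, with x expressed through t; its derivative
    vanishes at L.\<close>
  define D where "D = (\<lambda>\<eta>. \<eta> powr m - m * L powr (m - 1) * \<eta>)"
  have cancel: "L powr (m - 1) * L powr (1 - m) = 1" using L by (simp add: powr_add[symmetric])
  have tx: "x = t * (m * L powr (m - 1))" using cancel m by (simp add: t_def mult_ac)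
  have t: "t \<in> I01"
  proof -
    have "t * (m * L powr (m - 1)) < 1 * (m * L powr (m - 1))" using x(2) tx by simp
    hence "t < 1" by (rule mult_right_less_imp_less) (use m in auto)
    moreover have "t > 0" using x m L by (simp add: t_def)
    ultimately show ?thesis by simp
  qed
  have D: "\<bar>D \<eta> - D L\<bar> \<le> 1" if \<eta>: "L \<le> \<eta>" "\<eta> \<le> L + ?w" for \<eta>
  proof (cases "\<eta> = L")
    case False
    hence "L < \<eta>" using \<eta> by simp
    have "\<exists>z. z > L \<and> z < \<eta> \<and> D \<eta> - D L = (\<eta> - L) * (m * z powr (m - 1) - m * L powr (m - 1))"
    proof (rule MVT2[OF \<open>L < \<eta>\<close>])
      fix z assume "L \<le> z"
      thus "(D has_real_derivative (m * z powr (m - 1) - m * L powr (m - 1))) (at z)"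
        unfolding D_def using L by (auto intro!: derivative_eq_intros)
    qed
    then obtain z where z: "L < z" "z < \<eta>" "D \<eta> - D L = (\<eta> - L) * (m * z powr (m - 1) - m * L powr (m - 1))"
      by blast
    have "\<exists>y. y > L \<and> y < z \<and> z powr (m - 1) - L powr (m - 1) = (z - L) * ((m - 1) * y powr (m - 1 - 1))"
    proof (rule MVT2[OF z(1)])
      fix y assume "L \<le> y"
      thus "((\<lambda>z. z powr (m - 1)) has_real_derivative (m - 1) * y powr (m - 1 - 1)) (at y)"
        using L by (auto intro!: derivative_eq_intros)
    qed
    then obtain y where y: "L < y" "y < z" "z powr (m - 1) - L powr (m - 1) = (z - L) * ((m - 1) * y powr (m - 1 - 1))"
      by blast
    have yL: "y powr (m - 2) \<le> L powr (m - 2)" using y L m by (intro powr_mono2') auto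
    have "\<bar>z powr (m - 1) - L powr (m - 1)\<bar> = (z - L) * ((1 - m) * y powr (m - 2))"
      using y(3) z m by (simp add: abs_mult)
    also have "\<dots> \<le> ?w * (1 * L powr (m - 2))"
      using z \<eta> m yL by (intro mult_mono) auto
    finally have 1: "\<bar>z powr (m - 1) - L powr (m - 1)\<bar> \<le> ?w * L powr (m - 2)" by simp
    have "\<bar>D \<eta> - D L\<bar> = (\<eta> - L) * (m * \<bar>z powr (m - 1) - L powr (m - 1)\<bar>)"
      using z(3) \<eta> m by (simp add: abs_mult flip: right_diff_distrib)
    also have "\<dots> \<le> ?w * (1 * (?w * L powr (m - 2)))"
      using \<eta> m 1 by (intro mult_mono) auto
    also have "\<dots> = 1"
    proof -
      have "?w * (?w * L powr (m - 2)) = L powr ((1 - m/2) + ((1 - m/2) + (m - 2)))" by (simp only: powr_add)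
      also have "(1 - m/2) + ((1 - m/2) + (m - 2)) = 0" by simp
      finally show ?thesis using L by simp
    qed
    finally show ?thesis .
  qed simp
  have "\<bar>x * \<xi> + t * \<bar>\<xi>\<bar> powr m - t * D L\<bar> \<le> 1" if \<xi>: "\<xi> \<in> {- (L + ?w)..- L}" for \<xi>
  proof -
    have "x * \<xi> + t * \<bar>\<xi>\<bar> powr m - t * D L = t * (D (- \<xi>) - D L)"
      using \<xi> L by (subst tx) (simp add: D_def algebra_simps)
    hence "\<bar>x * \<xi> + t * \<bar>\<xi>\<bar> powr m - t * D L\<bar> = t * \<bar>D (- \<xi>) - D L\<bar>" using t by (simp add: abs_mult)
    also have "\<dots> \<le> 1 * 1" using t D[of "- \<xi>"] \<xi> by (intro mult_mono) auto
    finally show ?thesis by simp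
  qed
  thus ?thesis using t by blast
qed

text \<open>Here the phase is small rather than stationary: |\<xi>| \<le> 2 L leaves at most 1/2 for
  x \<xi>, and t = L powr (-m) / 8 leaves at most 1/4 for the other term while lying in the unit
  interval.\<close>

lemma band_phase_small:
  fixes m L x :: real
  assumes m: "0 < m" "m < 1" and L: "1 \<le> L" and x: "0 < x" "x < 1 / (4 * L)"
  shows "\<exists>t\<in>I01. \<exists>\<theta>. \<forall>\<xi>\<in>{- (L + L)..- L}. \<bar>x * \<xi> + t * \<bar>\<xi>\<bar> powr m - \<theta>\<bar> \<le> 1"
proof -
  define t where "t = L powr (- m) / 8"
  have "L powr (- m) \<le> 1" using L m powr_mono2'[of "- m" 1 L] by simp
  moreover have "L powr (- m) > 0" using L by simp
  ultimately have t: "t \<in> I01" by (simp add: t_def)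
  have "\<bar>x * \<xi> + t * \<bar>\<xi>\<bar> powr m - 0\<bar> \<le> 1" if \<xi>: "\<xi> \<in> {- (L + L)..- L}" for \<xi>
  proof -
    have "\<bar>x * \<xi>\<bar> \<le> 1 / (4 * L) * (2 * L)"
      unfolding abs_mult using x \<xi> L by (intro mult_mono) auto
    also have "\<dots> = 1 / 2" using L by simp
    finally have 1: "\<bar>x * \<xi>\<bar> \<le> 1 / 2" .
    have "\<bar>\<xi>\<bar> powr m \<le> (2 * L) powr m" using \<xi> L m by (intro powr_mono2) auto
    also have "\<dots> = 2 powr m * L powr m" using L by (simp add: powr_mult)
    also have "\<dots> \<le> 2 * L powr m" using m powr_mono[of m 1 2] by (intro mult_right_mono) auto
    finally have "t * \<bar>\<xi>\<bar> powr m \<le> t * (2 * L powr m)" using t by (intro mult_left_mono) auto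
    also have "\<dots> = (L powr (- m) * L powr m) / 4" by (simp add: t_def)
    also have "\<dots> = 1 / 4" using L by (simp add: powr_add[symmetric])
    finally have "t * \<bar>\<xi>\<bar> powr m \<le> 1 / 4" .
    moreover have "t * \<bar>\<xi>\<bar> powr m \<ge> 0" using t by auto
    ultimately show ?thesis using 1 by linarith
  qed
  thus ?thesis using t by blast
qed

section \<open>Failure of the estimate for small s\<close>

lemma powr_unbounded:
  fixes e K :: real
  assumes "0 < e"
  obtains L where "1 \<le> L" "K < L powr e"
proof
  let ?L = "(\<bar>K\<bar> + 1) powr (1 / e)"
  show "1 \<le> ?L" using assms by (intro ge_one_powr_ge_zero) auto
  show "K < ?L powr e" using assms by (simp add: powr_powr)
qed

text \<open>The propagator has size at least a multiple of w on an interval of mass \<delta> powr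
  \<alpha>, while the Sobolev norm of the band is at most a multiple of sqrt w * L powr s; one
  factor sqrt w cancels.\<close>

lemma band_necessary:
  fixes C s w L \<delta> :: real
  assumes \<alpha>: "0 < \<alpha>" and q: "2 \<le> q" and L: "1 \<le> L" and w: "0 < w" "w \<le> L" and \<delta>: "0 < \<delta>" "\<delta> \<le> 1" and C: "0 \<le> C"
    and bound: "\<And>f. f \<in> sobolev s \<Longrightarrow> mixed_norm q (power_measure \<alpha>) (propagator m f) \<le> ennreal (C * sobolev_norm s f)"
    and phase: "\<And>x. 0 < x \<Longrightarrow> x < \<delta> \<Longrightarrow> \<exists>t\<in>I01. \<exists>\<theta>. \<forall>\<xi>\<in>{- (L + w)..- L}. \<bar>x * \<xi> + t * \<bar>\<xi>\<bar> powr m - \<theta>\<bar> \<le> 1"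
  shows "sqrt w * \<delta> powr (\<alpha> / q) \<le> 4 * pi * C * sqrt (5 powr \<bar>s\<bar>) * L powr s"
proof -
  let ?f = "band (- (L + w)) (- L)"
  have ab: "- (L + w) \<le> - L" using w by simp
  note f = band_sobolev[OF band_symbol_bound[OF L w(2)] ab]
  have n0: "0 \<le> sobolev_norm s ?f"
    unfolding sobolev_norm_def L2_norm_fun_def by (intro real_sqrt_ge_zero integral_nonneg_AE AE_I2) auto
  have "(- L - - (L + w)) / (4 * pi) * \<delta> powr (\<alpha> / q) \<le> C * sobolev_norm s ?f"
    by (rule band_mixed_norm_ge[OF \<alpha> q \<delta> ab _ phase bound[OF f(1)]]) (use C n0 in auto)
  also have "\<dots> \<le> C * sqrt (5 powr \<bar>s\<bar> * L powr (2 * s) * (- L - - (L + w)))"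
    by (intro mult_left_mono f(2) C)
  also have "\<dots> = C * (sqrt (5 powr \<bar>s\<bar>) * L powr s * sqrt w)"
  proof -
    have "L powr (2 * s) = (L powr s)\<^sup>2" using L by (simp add: power2_eq_square powr_add[symmetric])
    thus ?thesis by (simp add: real_sqrt_mult)
  qed
  finally have "4 * pi * ((- L - - (L + w)) / (4 * pi) * \<delta> powr (\<alpha> / q)) \<le> 4 * pi * (C * (sqrt (5 powr \<bar>s\<bar>) * L powr s * sqrt w))"
    by (rule mult_left_mono) simp
  also have "4 * pi * ((- L - - (L + w)) / (4 * pi) * \<delta> powr (\<alpha> / q)) = (sqrt w * sqrt w) * \<delta> powr (\<alpha> / q)"
    using w by simp
  finally have "sqrt w * (sqrt w * \<delta> powr (\<alpha> / q)) \<le> sqrt w * (4 * pi * C * sqrt (5 powr \<bar>s\<bar>) * L powr s)"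
    by (simp only: mult_ac)
  thus ?thesis by (rule mult_left_le_imp_le) (use w in simp)
qed

text \<open>The necessary condition for large L: w = L powr (1 - m/2) with \<delta> = m * L powr (m
  - 1) forces s \<ge> 1/2 - m/4 - (1 - m) * \<alpha> / q, and w = L with \<delta> = 1 / (4 L) forces
  s \<ge> 1/2 - \<alpha> / q. In each case \<open>e\<close> is the deficit of s, and L is chosen so
  that L powr e beats the constants.\<close>

lemma maximal_estimate_fails:
  fixes m \<alpha> q s C :: real
  assumes m: "0 < m" "m < 1" and \<alpha>: "0 < \<alpha>" "\<alpha> \<le> 1" and q: "2 \<le> q"
    and s: "s < max (1/2 - m/4 - (1 - m) * \<alpha> / q) (1/2 - \<alpha> / q)" and C: "0 \<le> C"
    and bound: "\<And>f. f \<in> sobolev s \<Longrightarrow> mixed_norm q (power_measure \<alpha>) (propagator m f) \<le> ennreal (C * sobolev_norm s f)"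
  shows False
proof -
  let ?K = "4 * pi * C * sqrt (5 powr \<bar>s\<bar>)"
  have sqrt_powr: "sqrt (L powr a) = L powr (a / 2)" for L a :: real
    by (simp add: powr_half_sqrt[symmetric] powr_powr)
  consider "s < 1/2 - m/4 - (1 - m) * \<alpha> / q" | "s < 1/2 - \<alpha> / q" using s by linarith
  thus False
  proof cases
    case 1
    define e where "e = 1/2 - m/4 - (1 - m) * \<alpha> / q - s"
    have e: "e > 0" using 1 by (simp add: e_def)
    obtain L where L: "1 \<le> L" "?K / m powr (\<alpha> / q) < L powr e" by (rule powr_unbounded[OF e])
    have \<delta>1: "m * L powr (m - 1) \<le> 1"
    proof -
      have "L powr (m - 1) \<le> 1" using L m powr_mono2'[of "m - 1" 1 L] by simp
      thus ?thesis using m mult_mono[of m 1 "L powr (m - 1)" 1] by simp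
    qed
    have w: "L powr (1 - m/2) \<le> L" using L m powr_mono[of "1 - m/2" 1 L] by simp
    have "sqrt (L powr (1 - m/2)) * (m * L powr (m - 1)) powr (\<alpha> / q) \<le> ?K * L powr s"
      by (rule band_necessary[OF \<alpha>(1) q L(1) _ w _ \<delta>1 C bound band_phase_stationary[OF m L(1)]]) (use L m in auto)
    moreover have "sqrt (L powr (1 - m/2)) * (m * L powr (m - 1)) powr (\<alpha> / q) = m powr (\<alpha> / q) * (L powr e * L powr s)"
    proof -
      have "sqrt (L powr (1 - m/2)) * (m * L powr (m - 1)) powr (\<alpha> / q) =
        m powr (\<alpha> / q) * (L powr ((1 - m/2) / 2) * L powr ((m - 1) * (\<alpha> / q)))"
        using m by (simp add: sqrt_powr powr_mult powr_powr)
      moreover have "(1 - m/2) / 2 + (m - 1) * (\<alpha> / q) = e + s"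
      proof -
        have "(m - 1) * (\<alpha> / q) = - ((1 - m) * \<alpha> / q)" by (simp add: algebra_simps diff_divide_distrib)
        thus ?thesis unfolding e_def by simp
      qed
      ultimately show ?thesis by (simp only: powr_add[symmetric])
    qed
    ultimately have "(m powr (\<alpha> / q) * L powr e) * L powr s \<le> ?K * L powr s" by (simp add: mult.assoc)
    moreover have "L powr s > 0" using L by simp
    ultimately have "m powr (\<alpha> / q) * L powr e \<le> ?K" by (rule mult_right_le_imp_le)
    moreover have "m powr (\<alpha> / q) > 0" using m by simp
    ultimately have "L powr e \<le> ?K / m powr (\<alpha> / q)" by (simp add: field_simps)
    thus False using L(2) by linarith
  next
    case 2
    define e where "e = 1/2 - \<alpha> / q - s"
    have e: "e > 0" using 2 by (simp add: e_def)
    obtain L where L: "1 \<le> L" "?K * 4 powr (\<alpha> / q) < L powr e" by (rule powr_unbounded[OF e])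
    have \<delta>1: "1 / (4 * L) \<le> 1" using L by simp
    have "sqrt L * (1 / (4 * L)) powr (\<alpha> / q) \<le> ?K * L powr s"
      by (rule band_necessary[OF \<alpha>(1) q L(1) _ order_refl _ \<delta>1 C bound band_phase_small[OF m L(1)]]) (use L in auto)
    moreover have "sqrt L * (1 / (4 * L)) powr (\<alpha> / q) * 4 powr (\<alpha> / q) = L powr e * L powr s"
    proof -
      have "(1 / (4 * L)) powr (\<alpha> / q) * 4 powr (\<alpha> / q) = L powr (- (\<alpha> / q))"
        using L by (simp add: powr_divide powr_mult powr_minus_divide)
      hence "sqrt L * (1 / (4 * L)) powr (\<alpha> / q) * 4 powr (\<alpha> / q) = L powr (1/2) * L powr (- (\<alpha> / q))"
        using L by (simp add: powr_half_sqrt mult.assoc)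
      moreover have "1/2 + - (\<alpha> / q) = e + s" by (simp add: e_def)
      ultimately show ?thesis by (simp only: powr_add[symmetric])
    qed
    ultimately have "L powr e * L powr s \<le> (?K * L powr s) * 4 powr (\<alpha> / q)"
      by (metis mult_right_mono powr_ge_zero)
    hence "L powr e * L powr s \<le> (?K * 4 powr (\<alpha> / q)) * L powr s" by (simp add: mult_ac)
    moreover have "L powr s > 0" using L by simp
    ultimately have "L powr e \<le> ?K * 4 powr (\<alpha> / q)" by (rule mult_right_le_imp_le)
    thus False using L(2) by linarith
  qed
qed

text \<open>Undefined values of the propagator count as 0, so the almost-everywhere clause in the
  first half ensures that the estimate is not obtained by discarding points. In the second half the
  convention can only lower the left side, which makes the failure stronger.\<close>

theorem mainTheorem4:
  fixes m \<alpha> q s :: real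
  assumes "0 < m" and "m < 1" and "0 < \<alpha>" and "\<alpha> \<le> 1" and "2 \<le> q"
  shows "(s > max (1/2 - m/4 - (1 - m) * \<alpha> / q) (1/2 - \<alpha> / q) \<longrightarrow>
           (\<forall>\<mu>\<in>fractal_measures \<alpha>. \<exists>C::real. C \<ge> 0 \<and>
             (\<forall>f\<in>sobolev s.
               (AE x in \<mu>. x \<in> I01 \<longrightarrow> (\<forall>t\<in>I01. propagator_defined m f x t)) \<and>
               mixed_norm q \<mu> (propagator m f) \<le> ennreal (C * sobolev_norm s f)))) \<and>
         (s < max (1/2 - m/4 - (1 - m) * \<alpha> / q) (1/2 - \<alpha> / q) \<longrightarrow>
           (\<exists>\<mu>\<in>fractal_measures \<alpha>. \<not> (\<exists>C::real. C \<ge> 0 \<and>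
             (\<forall>f\<in>sobolev s.
               mixed_norm q \<mu> (propagator m f) \<le> ennreal (C * sobolev_norm s f)))))"
proof (intro conjI impI ballI)
  fix \<mu> assume s: "s > max (1/2 - m/4 - (1 - m) * \<alpha> / q) (1/2 - \<alpha> / q)" and \<mu>: "\<mu> \<in> fractal_measures \<alpha>"
  show "\<exists>C::real. C \<ge> 0 \<and> (\<forall>f\<in>sobolev s.
      (AE x in \<mu>. x \<in> I01 \<longrightarrow> (\<forall>t\<in>I01. propagator_defined m f x t)) \<and>
      mixed_norm q \<mu> (propagator m f) \<le> ennreal (C * sobolev_norm s f))"
    by (rule maximal_estimate[OF assms s \<mu>]) blast
next
  assume s: "s < max (1/2 - m/4 - (1 - m) * \<alpha> / q) (1/2 - \<alpha> / q)"
  show "\<exists>\<mu>\<in>fractal_measures \<alpha>. \<not> (\<exists>C::real. C \<ge> 0 \<and>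
      (\<forall>f\<in>sobolev s. mixed_norm q \<mu> (propagator m f) \<le> ennreal (C * sobolev_norm s f)))"
    using maximal_estimate_fails[OF assms s] by (intro bexI[OF _ power_measure_fractal[OF assms(3,4)]]) blast
qed

end
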